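(* Let $q$ be an odd prime power. Let $n,j,i$ be integers with $0\leq i\leq j$ and $i+j\leq n$, such that $n$ is even and $j$ is odd. Let $\delta\in\{0,\pm1\}$ and $\varepsilon\in\{\pm1\}$ with $j-i-\delta\equiv1\pmod{2}$. If $i$ is odd, then \begin{align*} &\gamma_{(i,j,\delta),(n,\varepsilon),(n-j,0),\varepsilon}=q^{\frac{3}{2}jn-\frac{1}{4}n^{2}-\frac{5}{4}j^{2}-\frac{1}{2}n+\frac{1}{2}j-\frac{1}{4}}\Bigg(\sum_{m=0}^{\frac{n-j-i}{2}}\chi_{1,\frac{n-j+1}{2}-m}(q)\genfrac{[}{]}{0pt}{}{\frac{n-j-i}{2}-1}{m}_{q^{2}}q^{m(m-j+i+1)}\\ &\qquad+\left(\delta q^{\frac{1}{2}i-\frac{1}{2}j}-\varepsilon q^{\frac{1}{2}n-j}+\delta\varepsilon q^{\frac{1}{2}n-\frac{3}{2}j+\frac{1}{2}i}\right)\sum_{m=0}^{\frac{n-j-i}{2}-1}\chi_{1,\frac{n-j-1}{2}-m}(q)\genfrac{[}{]}{0pt}{}{\frac{n-j-i}{2}-1}{m}_{q^{2}}q^{m(m-j+i+1)}\Bigg). \end{align*} If $i$ is even (and thus $\delta=0$), then \begin{align*} \gamma_{(i,j,0),(n,\varepsilon),(n-j,0),\varepsilon}=&\,q^{\frac{3}{2}jn-\frac{1}{4}n^{2}-\frac{5}{4}j^{2}-\frac{1}{2}n+\frac{1}{2}j-\frac{1}{4}}\Bigg( \sum_{m=0}^{\frac{n-j-i-1}{2}}\chi_{1,\frac{n-j+1}{2}-m}(q)\genfrac{[}{]}{0pt}{}{\frac{n-j-i-1}{2}}{m}_{q^{2}}q^{m(m-j+i)}\\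 &\qquad -\varepsilon q^{\frac{1}{2}n-j}\sum_{m=0}^{\frac{n-j-i-1}{2}}\chi_{1,\frac{n-j-1}{2}-m}(q)\genfrac{[}{]}{0pt}{}{\frac{n-j-i-1}{2}}{m}_{q^{2}}q^{m(m-j+i)} \Bigg). \end{align*}
   Context: Forms and types. $q$ is an odd prime power. A quadratic form $Q$ on $\mathbb{F}_q^m$ has an associated symmetric bilinear form $f$ with $Q(v)=f(v,v)$; its radical is $\{v:\forall w,\ f(v,w)=0\}$, and $Q$ is non-degenerate if its radical is $0$. A non-degenerate quadratic form on $\mathbb{F}_q^m$ has a type: $0$ (parabolic) if $m$ is odd; if $m$ is even, the type is $1$ (hyperbolic) if the maximum dimension of a totally isotropic subspace (one on which $Q$ vanishes) is $m/2$, and $-1$ (elliptic) if it is $m/2-1$. The $0$-dimensional space has type $1$. "A quadratic form of type $\varepsilon$ on $\mathbb{F}_q^n$" always means a non-degenerate one. All subspace dimensions are vector space dimensions. Given such a form, a subspace $\pi$ is $i$-singular if the radical of the form restricted to $\pi$ has dimension $i$; non-singular means $0$-singular. The type of an $i$-singular $j$-space $\pi$ is the type of the non-degenerate form induced on $\pi/\mathrm{rad}(\pi)$. Counts. For $n$ even, fix a quadratic form of type $\varepsilon$ on $\mathbb{F}_q^n$ and an $i$-singular $j$-space $\pi$ of type $\delta$; then $\gamma_{(i,j,\delta),(n,\varepsilon),(k,\zeta),\eta}$ is the number of non-singular $k$-spaces $\sigma$ of type $\zeta$ such that $\sigma\cap\pi$ is trivial and $\langle\pi,\sigma\rangle$ is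 a non-singular $(k+j)$-space of type $\eta$. This number does not depend on the choice of $\pi$; it is only defined, and the formulae are only asserted, for parameters for which such a $\pi$ exists. Functions. For integers $b\geq a\geq0$: $\psi^{-}_{a,b}(q)=\prod_{k=a}^{b}(q^k-1)$, $\chi_{a,b}(q)=\prod_{k=a}^{b}(q^{2k-1}-1)$, and $\psi^-_{a,a-1}(q)=\chi_{a,a-1}(q)=1$ for $a\ge0$. For integers $b\ge a\ge0$, $\genfrac{[}{]}{0pt}{}{b}{a}_{q}=\psi^-_{b-a+1,b}(q)/\psi^-_{1,a}(q)$; moreover $\genfrac{[}{]}{0pt}{}{b}{a}_{q}=0$ if $a<0$ or $0\leq b<a$, and $\genfrac{[}{]}{0pt}{}{-1}{0}_{q}=1$. A sum from $m=0$ to $-1$ is empty, and a summand with zero Gaussian coefficient is $0$. *)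

theory Defs
  imports "HOL-Analysis.Analysis"
begin

section \<open>Quadratic forms on \<open>F^n\<close>\<close>

text \<open>
  The space \<open>F\<^sub>q^n\<close> is \<^typ>\<open>'a^'n\<close> with \<^term>\<open>CARD('a) = q\<close> and \<^term>\<open>CARD('n) = n\<close>.
  A quadratic form is carried together with its symmetric bilinear form.
\<close>

definition quadratic_form ::
    "('a::field^'n \<Rightarrow> 'a) \<Rightarrow> ('a^'n \<Rightarrow> 'a^'n \<Rightarrow> 'a) \<Rightarrow> bool" where
  "quadratic_form Q f \<longleftrightarrow>
     (\<forall>u v w. f (u + v) w = f u w + f v w) \<and>
     (\<forall>c v w. f (c *s v) w = c * f v w) \<and>
     (\<forall>v w. f v w = f w v) \<and>
     (\<forall>v. Q v = f v v)"

definition radical :: "('a::field^'n \<Rightarrow> 'a^'n \<Rightarrow> 'a) \<Rightarrow> ('a^'n) set \<Rightarrow> ('a^'n) set" where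
  "radical f W = {v \<in> W. \<forall>w \<in> W. f v w = 0}"

definition totally_isotropic :: "('a::field^'n \<Rightarrow> 'a) \<Rightarrow> ('a^'n) set \<Rightarrow> bool" where
  "totally_isotropic Q U \<longleftrightarrow> vec.subspace U \<and> (\<forall>u \<in> U. Q u = 0)"

definition max_isotropic_dim :: "('a::field^'n \<Rightarrow> 'a) \<Rightarrow> ('a^'n) set \<Rightarrow> nat" where
  "max_isotropic_dim Q W = Max {vec.dim U | U. totally_isotropic Q U \<and> U \<subseteq> W}"

text \<open>
  The type of a non-degenerate quadratic form on a space \<open>W\<close> (a subspace of the ambient one).
  Only the values of \<open>Q\<close> on \<open>W\<close> matter.
\<close>

definition form_has_type :: "('a::field^'n \<Rightarrow> 'a) \<Rightarrow> ('a^'n) set \<Rightarrow> int \<Rightarrow> bool" where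
  "form_has_type Q W \<delta> \<longleftrightarrow>
     (odd (vec.dim W) \<and> \<delta> = 0) \<or>
     (even (vec.dim W) \<and> int (max_isotropic_dim Q W) = int (vec.dim W) div 2 \<and> \<delta> = 1) \<or>
     (even (vec.dim W) \<and> int (max_isotropic_dim Q W) = int (vec.dim W) div 2 - 1 \<and> \<delta> = -1)"

definition form_on_full_space ::
    "('a::field^'n \<Rightarrow> 'a) \<Rightarrow> ('a^'n \<Rightarrow> 'a^'n \<Rightarrow> 'a) \<Rightarrow> int \<Rightarrow> bool" where
  "form_on_full_space Q f \<epsilon> \<longleftrightarrow>
     quadratic_form Q f \<and> radical f UNIV = {0} \<and> form_has_type Q UNIV \<epsilon>"

text \<open>
  The quotient of a subspace \<open>W\<close> by a subspace \<open>R\<close> is realised inside the ambient space: it is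
  the image of \<open>W\<close> under any linear map whose kernel on \<open>W\<close> is \<open>R\<close>. Such a map exists for
  every \<open>R \<subseteq> W\<close>, and the image is unique up to isomorphism over \<open>W\<close>.
  The form induced on the quotient is then the form \<open>Q'\<close> on the image that pulls back to \<open>Q\<close>;
  it exists for \<open>R = radical f W\<close> because \<open>Q (v + r) = Q v\<close> for \<open>r\<close> in the radical.
\<close>

definition quotient_map ::
    "('a::field^'n \<Rightarrow> 'a^'n) \<Rightarrow> ('a^'n) set \<Rightarrow> ('a^'n) set \<Rightarrow> bool" where
  "quotient_map \<phi> W R \<longleftrightarrow> Vector_Spaces.linear (*s) (*s) \<phi> \<and> {v \<in> W. \<phi> v = 0} = R"

definition space_has_type ::
    "('a::field^'n \<Rightarrow> 'a) \<Rightarrow> ('a^'n \<Rightarrow> 'a^'n \<Rightarrow> 'a) \<Rightarrow> ('a^'n) set \<Rightarrow> int \<Rightarrow> bool" where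
  "space_has_type Q f W \<delta> \<longleftrightarrow>
     (\<exists>\<phi> Q'. quotient_map \<phi> W (radical f W) \<and> (\<forall>v \<in> W. Q' (\<phi> v) = Q v) \<and>
             form_has_type Q' (\<phi> ` W) \<delta>)"

text \<open>\<open>W\<close> is an \<open>i\<close>-singular \<open>j\<close>-space of type \<open>\<delta>\<close>; non-singular means \<open>i = 0\<close>.\<close>

definition singular_space ::
    "('a::field^'n \<Rightarrow> 'a) \<Rightarrow> ('a^'n \<Rightarrow> 'a^'n \<Rightarrow> 'a) \<Rightarrow> int \<Rightarrow> int \<Rightarrow> int \<Rightarrow> ('a^'n) set \<Rightarrow> bool"
  where
  "singular_space Q f i j \<delta> W \<longleftrightarrow>
     vec.subspace W \<and> int (vec.dim W) = j \<and> int (vec.dim (radical f W)) = i \<and>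
     space_has_type Q f W \<delta>"

text \<open>
  \<open>\<gamma>\<^bsub>(i,j,\<delta>),(n,\<epsilon>),(k,\<zeta>),\<eta>\<^esub>\<close>; the parameters \<open>i, j, \<delta>\<close> and \<open>n, \<epsilon>\<close> are those of the given
  subspace \<open>W\<close> and of the given form.
\<close>

definition gamma_count ::
    "('a::field^'n \<Rightarrow> 'a) \<Rightarrow> ('a^'n \<Rightarrow> 'a^'n \<Rightarrow> 'a) \<Rightarrow> ('a^'n) set \<Rightarrow> int \<Rightarrow> int \<Rightarrow> int \<Rightarrow> nat"
  where
  "gamma_count Q f W k \<zeta> \<eta> =
     card {S. singular_space Q f 0 k \<zeta> S \<and> S \<inter> W = {0} \<and>
              singular_space Q f 0 (k + int (vec.dim W)) \<eta> (vec.span (W \<union> S))}"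


section \<open>The functions \<open>\<psi>\<close>, \<open>\<chi>\<close> and the Gaussian coefficients\<close>

text \<open>The indices are integers: an interval \<open>{a..a - 1}\<close> is empty, giving the value 1.\<close>

definition psi_minus :: "int \<Rightarrow> int \<Rightarrow> real \<Rightarrow> real" where
  "psi_minus a b x = (\<Prod>k = a..b. x powi k - 1)"

definition chi :: "int \<Rightarrow> int \<Rightarrow> real \<Rightarrow> real" where
  "chi a b x = (\<Prod>k = a..b. x powi (2 * k - 1) - 1)"

text \<open>
  Note the convention \<open>[-1 choose 0] = 1\<close>; the remaining values with \<open>b < 0\<close> are irrelevant
  and set to 0.
\<close>

definition gauss_binomial :: "int \<Rightarrow> int \<Rightarrow> real \<Rightarrow> real" where
  "gauss_binomial b a x =
     (if b = -1 \<and> a = 0 then 1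
      else if a < 0 \<or> b < a then 0
      else psi_minus (b - a + 1) b x / psi_minus 1 a x)"

end

theory Submission
  imports Defs "HOL-Computational_Algebra.Polynomial"
begin

text \<open>
  The number of subspaces in question is the number of non-singular complements \<open>S\<close> of \<open>W\<close>.
  For a quadratic space \<open>S\<close> let \<open>E S\<close> be the sum of the Moebius weights \<open>(-1)^t q^(t choose 2)\<close> over
  its totally isotropic subspaces (\<open>t\<close> being their dimension). It vanishes for singular \<open>S\<close> and
  equals \<open>(-1)^h q^(h^2)\<close> for non-singular \<open>S\<close> of dimension \<open>2h + 1\<close>, so summing \<open>E\<close> over all
  complements counts the non-singular ones. As \<open>q^(j(n-j-t))\<close> complements contain a given \<open>t\<close>-space
  that meets \<open>W\<close> trivially, the count becomes the value at \<open>x = q^(-j)\<close> of the generating function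
  \<open>\<Phi> V x\<close> of the totally isotropic subspaces of \<open>V\<close> meeting \<open>W\<close> trivially.

  For a hyperplane \<open>H\<close> of \<open>P\<close> with \<open>W \<subseteq> H\<close>, counting the extensions of the isotropic subspaces of \<open>H\<close>
  gives \<open>\<Phi> P x = (1 - \<nu> x) \<Phi> H x - x q^(dim P - 2) \<Phi> H (x/q)\<close>, where \<open>\<nu>\<close> depends only on the numbers of
  isotropic vectors of \<open>P\<close> and \<open>H\<close>. Replacing \<open>Y^r\<close> by \<open>\<xi>^r h(M-r, \<xi>)\<close>, with \<open>h\<close> the Rogers-Szego
  polynomials, turns this recursion into multiplication of polynomials in \<open>Y\<close> by \<open>1 + aY\<close>. Along a
  chain of hyperplanes from \<open>V\<close> down to \<open>W\<close> the product of these factors telescopes to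
  \<open>(1 - bW Y)(1 + bV Y) \<Prod>(1 - c q^(2k) Y^2)\<close>, which the \<open>q\<close>-binomial theorem expands; the values
  \<open>h(N, -1/q)\<close> are products of the numbers \<open>q^(2k-1) - 1\<close>.
\<close>

section \<open>Subspaces over a finite field\<close>

lemma card_span_independent:
  fixes B :: "('a::{field,finite}^'n) set"
  assumes "vec.independent B"
  shows "card (vec.span B) = CARD('a) ^ card B"
proof -
  have "finite B" using vec.finiteI_independent[OF assms] .
  from this assms show ?thesis
  proof (induction B rule: finite_induct)
    case empty
    then show ?case by simp
  next
    case (insert b B)
    then have ind: "vec.independent B" and b: "b \<notin> vec.span B"
      by (auto simp: vec.independent_insert split: if_splits)
    have "bij_betw (\<lambda>(c, v). c *s b + v) (UNIV \<times> vec.span B) (vec.span (insert b B))"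
    proof (intro bij_betw_imageI)
      show "inj_on (\<lambda>(c, v). c *s b + v) (UNIV \<times> vec.span B)"
      proof (rule inj_onI, clarsimp)
        fix c d v w assume v: "v \<in> vec.span B" and w: "w \<in> vec.span B"
          and eq: "c *s b + v = d *s b + w"
        have "(c - d) *s b = w - v" using eq by (simp add: vec.scale_left_diff_distrib algebra_simps)
        then have m: "(c - d) *s b \<in> vec.span B" using v w by (simp add: vec.span_diff)
        have "c = d"
        proof (rule ccontr)
          assume "c \<noteq> d"
          then have "inverse (c - d) *s ((c - d) *s b) = b"
            unfolding vec.scale_scale by simp
          then show False using vec.span_scale[OF m, of "inverse (c - d)"] b by simp
        qed
        with eq show "c = d \<and> v = w" by simp
      qed
      show "(\<lambda>(c, v). c *s b + v) ` (UNIV \<times> vec.span B) = vec.span (insert b B)"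
      proof -
        have "x \<in> vec.span (insert b B) \<longleftrightarrow> (\<exists>c. \<exists>v\<in>vec.span B. x = c *s b + v)" for x
          by (metis vec.span_breakdown_eq add.commute add_diff_cancel_left' diff_add_cancel)
        then show ?thesis by (auto simp: image_iff)
      qed
    qed
    then have "card (vec.span (insert b B)) = card ((UNIV :: 'a set) \<times> vec.span B)"
      by (simp add: bij_betw_same_card)
    then show ?case using insert ind by (simp add: card_cartesian_product)
  qed
qed

lemma card_subspace:
  fixes S :: "('a::{field,finite}^'n) set"
  assumes "vec.subspace S"
  shows "card S = CARD('a) ^ vec.dim S"
proof -
  obtain B where B: "B \<subseteq> S" "vec.independent B" "S \<subseteq> vec.span B" "card B = vec.dim S"
    using vec.basis_exists by blast
  then have "S = vec.span B" using assms by (simp add: vec.span_subspace)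
  then show ?thesis using B card_span_independent by metis
qed

lemma card_field_gt_1: "1 < CARD('a::{field,finite})"
proof -
  have "card {0::'a, 1} \<le> CARD('a)" by (rule card_mono) auto
  then show ?thesis by simp
qed

lemma dim_span_Un:
  fixes A B :: "('a::field^'n) set"
  assumes "vec.subspace A" "vec.subspace B"
  shows "vec.dim (vec.span (A \<union> B)) + vec.dim (A \<inter> B) = vec.dim A + vec.dim B"
proof -
  have "vec.span (A \<union> B) = {x + y |x y. x \<in> A \<and> y \<in> B}"
    using assms by (simp add: vec.span_Un vec.span_eq_iff[THEN iffD2])
      
  then show ?thesis using vec.dim_sums_Int[OF assms] by simp
qed

lemma dim_span_insert:
  fixes T :: "('a::field^'n) set"
  assumes "vec.subspace T" "v \<notin> T"
  shows "vec.dim (vec.span (insert v T)) = Suc (vec.dim T)"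
  using assms by (simp add: vec.dim_insert vec.span_eq_iff[THEN iffD2])

lemma mem_span_insert:
  fixes T :: "('a::field^'n) set"
  assumes "vec.subspace T"
  shows "x \<in> vec.span (insert v T) \<longleftrightarrow> (\<exists>c. \<exists>t\<in>T. x = c *s v + t)"
  using assms vec.span_breakdown_eq[of x v T]
  by (metis add.commute add_diff_cancel_left' diff_add_cancel vec.span_eq_iff)

lemma span_insert_subset_iff:
  fixes S :: "('a::field^'n) set"
  assumes "vec.subspace S"
  shows "vec.span (insert v T) \<subseteq> S \<longleftrightarrow> v \<in> S \<and> T \<subseteq> S"
  by (meson assms insert_subset order_trans vec.span_minimal vec.span_superset)

lemma subspace_zero: "vec.subspace {0}"
  by (simp add: vec.subspace_def)

section \<open>Counting the complements of a subspace\<close>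

definition complements :: "('a::field^'n) set \<Rightarrow> ('a^'n) set \<Rightarrow> ('a^'n) set set" where
  "complements W P =
     {S. vec.subspace S \<and> S \<subseteq> P \<and> S \<inter> W = {0} \<and> vec.dim S + vec.dim W = vec.dim P}"

text \<open>Induction on the codimension of \<open>W + T\<close> in \<open>P\<close>, double
  counting the pairs \<open>(S, v)\<close> with \<open>v \<in> S - T\<close>. Every \<open>S\<close>
  offers equally many \<open>v\<close>; conversely \<open>v\<close> runs over
  \<open>P - (W + T)\<close> and \<open>S\<close> over the complements containing
  \<open>T + <v>\<close>, which the induction hypothesis counts.\<close>

lemma card_complements_above:
  fixes W P T :: "('a::{field,finite}^'n) set"
  assumes W: "vec.subspace W" "W \<subseteq> P" and P: "vec.subspace P"
    and "vec.subspace T" "T \<subseteq> P" "T \<inter> W = {0}"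
  shows "card {S \<in> complements W P. T \<subseteq> S} =
     CARD('a) ^ (vec.dim W * (vec.dim P - vec.dim W - vec.dim T))"
  using assms(4-6)
proof (induction "vec.dim P - vec.dim W - vec.dim T" arbitrary: T)
  case (0 T)
  have d: "vec.dim (vec.span (W \<union> T)) = vec.dim W + vec.dim T"
    using dim_span_Un[OF W(1) \<open>vec.subspace T\<close>] 0 by (simp add: Int_commute)
  have "vec.span (W \<union> T) \<subseteq> P" using W P 0 by (simp add: vec.span_minimal)
  then have le: "vec.dim W + vec.dim T \<le> vec.dim P" using d by (metis vec.dim_subset)
  have "{S \<in> complements W P. T \<subseteq> S} = {T}"
  proof -
    have "S = T" if "S \<in> complements W P" "T \<subseteq> S" for S
      by (rule vec.subspace_dim_equal[symmetric]) (use that 0 le in \<open>auto simp: complements_def\<close>)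
    then show ?thesis using 0 le by (auto simp: complements_def)
  qed
  then show ?case using 0(1) by simp
next
  case (Suc d T)
  let ?q = "CARD('a)" and ?C = "\<lambda>T. {S \<in> complements W P. T \<subseteq> S}"
  let ?j = "vec.dim W" and ?t = "vec.dim T"
  define U where "U = vec.span (W \<union> T)"
  have U: "vec.subspace U" "U \<subseteq> P" "W \<subseteq> U" "T \<subseteq> U" unfolding U_def using W P Suc
    by (auto simp: vec.span_minimal vec.span_superset intro: vec.span_base)
  have dU: "vec.dim U = ?j + ?t"
    using dim_span_Un[OF W(1) \<open>vec.subspace T\<close>] Suc by (simp add: Int_commute U_def)
  have p: "vec.dim P = ?j + ?t + Suc d" using Suc(2) by simp
  \<comment> \<open>Adjoining to \<open>T\<close> a vector outside \<open>U = W + T\<close> keeps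
    the intersection with \<open>W\<close> trivial.\<close>
  have step: "card (?C (vec.span (insert v T))) = ?q ^ (?j * d)" if v: "v \<in> P - U" for v
  proof -
    have nT: "v \<notin> T" using v U by blast
    have dm: "vec.dim (vec.span (insert v T)) = Suc ?t" by (rule dim_span_insert) (use Suc nT in auto)
    have W0: "vec.span (insert v T) \<inter> W = {0}"
    proof -
      have "x = 0" if x: "x \<in> vec.span (insert v T)" "x \<in> W" for x
      proof -
        obtain c t where ct: "t \<in> T" "x = c *s v + t" using x mem_span_insert[OF Suc(3)] by blast
        have "c = 0"
        proof (rule ccontr)
          assume c: "c \<noteq> 0"
          have "x - t \<in> U" using x ct U by (blast intro: vec.subspace_diff)
          then have "c *s v \<in> U" using ct by simp
          then have "inverse c *s (c *s v) \<in> U" using U vec.subspace_scale by blast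
          then show False using c v by (simp add: vec.scale_scale)
        qed
        then show "x = 0" using ct x Suc(5) by auto
      qed
      then show ?thesis using W(1) by (auto simp: vec.span_zero vec.subspace_0)
    qed
    have "card (?C (vec.span (insert v T))) = 
        ?q ^ (?j * (vec.dim P - ?j - vec.dim (vec.span (insert v T))))"
    proof (rule Suc(1))
      show "vec.span (insert v T) \<subseteq> P" using Suc v P by (simp add: vec.span_minimal)
    qed (use dm W0 Suc in auto)
    then show ?thesis using dm p by simp
  qed
  \<comment> \<open>If \<open>v \<in> S - T\<close> were in \<open>W + T\<close>, its
    \<open>W\<close>-component would lie in \<open>S \<inter> W = {0}\<close> and \<open>v\<close>
    in \<open>T\<close>.\<close>
  have eq: "(SIGMA S:?C T. S - T) = (\<lambda>(v, S). (S, v)) ` (SIGMA v:P - U. ?C (vec.span (insert v T)))"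
  proof -
    have "v \<notin> U" if "S \<in> ?C T" "v \<in> S - T" for S v
    proof
      assume "v \<in> U"
      then obtain w t where decomp: "v = w + t" "w \<in> W" "t \<in> T"
        unfolding U_def vec.span_Un using W Suc by (auto simp: vec.span_eq_iff[THEN iffD2])
      have "v - t \<in> S" using that decomp by (intro vec.subspace_diff) (auto simp: complements_def)
      then have "w \<in> S" using decomp by simp
      then have "w = 0" using that decomp by (auto simp: complements_def)
      then show False using decomp that by simp
    qed
    moreover have "vec.span (insert v T) \<subseteq> S \<longleftrightarrow> v \<in> S \<and> T \<subseteq> S" "S \<subseteq> P"
      if "S \<in> complements W P" for S v
      using that by (auto simp: complements_def span_insert_subset_iff)
    ultimately have "S \<in> ?C T \<and> v \<in> S - T \<longleftrightarrow> v \<in> P - U \<and> S \<in> ?C (vec.span (insert v T))" for S v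
      using U by blast
    then have "{(S, v). S \<in> ?C T \<and> v \<in> S - T} =
        {(S, v). v \<in> P - U \<and> S \<in> ?C (vec.span (insert v T))}" by presburger
    moreover have "(SIGMA S:?C T. S - T) = {(S, v). S \<in> ?C T \<and> v \<in> S - T}" by auto
    moreover have "(\<lambda>(v, S). (S, v)) ` (SIGMA v:P - U. ?C (vec.span (insert v T))) =
        {(S, v). v \<in> P - U \<and> S \<in> ?C (vec.span (insert v T))}" by (auto simp: image_iff)
    ultimately show ?thesis by simp
  qed
  have "card (SIGMA S:?C T. S - T) = (\<Sum>S\<in>?C T. card (S - T))"
    by (rule card_SigmaI) auto
  also have "\<dots> = (\<Sum>S\<in>?C T. ?q ^ (?t + Suc d) - ?q ^ ?t)"
  proof (rule sum.cong[OF refl])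
    fix S assume S: "S \<in> ?C T"
    then have "vec.dim S = ?t + Suc d" using p by (simp add: complements_def)
    then show "card (S - T) = ?q ^ (?t + Suc d) - ?q ^ ?t"
      using S Suc by (subst card_Diff_subset) (auto simp: card_subspace complements_def)
  qed
  finally have 1: "card (SIGMA S:?C T. S - T) = card (?C T) * (?q ^ (?t + Suc d) - ?q ^ ?t)" by simp
  have "card (SIGMA S:?C T. S - T) = card (SIGMA v:P - U. ?C (vec.span (insert v T)))"
    unfolding eq by (rule card_image) (auto simp: inj_on_def)
  also have "\<dots> = (\<Sum>v\<in>P - U. card (?C (vec.span (insert v T))))" by (rule card_SigmaI) auto
  also have "\<dots> = (\<Sum>v\<in>P - U. ?q ^ (?j * d))" using step by (intro sum.cong) auto
  also have "\<dots> = (card P - card U) * ?q ^ (?j * d)" using U by (simp add: card_Diff_subset)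
  also have "card P - card U = ?q ^ (?j + ?t + Suc d) - ?q ^ (?j + ?t)"
    using P U dU p by (simp add: card_subspace)
  also have "\<dots> = ?q ^ ?j * (?q ^ (?t + Suc d) - ?q ^ ?t)"
    by (simp add: power_add diff_mult_distrib2 mult_ac)
  finally have 2: "card (SIGMA S:?C T. S - T) = 
     ?q ^ ?j * (?q ^ (?t + Suc d) - ?q ^ ?t) * ?q ^ (?j * d)" .
  have "?q ^ ?t < ?q ^ (?t + Suc d)" using card_field_gt_1[where 'a='a] by (intro power_strict_increasing) auto
  then have "?q ^ (?t + Suc d) - ?q ^ ?t \<noteq> 0" by simp
  moreover have "card (?C T) * (?q ^ (?t + Suc d) - ?q ^ ?t) =
    (?q ^ ?j * ?q ^ (?j * d)) * (?q ^ (?t + Suc d) - ?q ^ ?t)"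
    using 1 2 by (simp only: mult_ac)
  ultimately have "card (?C T) = ?q ^ ?j * ?q ^ (?j * d)" 
    by (rule mult_right_cancel[THEN iffD1])
  then show ?case using p by (simp add: power_add)
qed

lemma card_complements:
  fixes W P :: "('a::{field,finite}^'n) set"
  assumes "vec.subspace W" "W \<subseteq> P" "vec.subspace P"
  shows "card (complements W P) = CARD('a) ^ (vec.dim W * (vec.dim P - vec.dim W))"
proof -
  have "{S \<in> complements W P. {0} \<subseteq> S} = complements W P"
    by (auto simp: complements_def vec.subspace_0)
  moreover have "{0} \<inter> W = {0}" "{0} \<subseteq> P" using assms by (auto simp: vec.subspace_0)
  ultimately show ?thesis
    using card_complements_above[OF assms subspace_zero] by simp
qed

text \<open>Pigeonhole: more than half of the field elements are squares, so the value sets of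
  \<open>a x^2\<close> and \<open>- b y^2 - c\<close> meet.\<close>

lemma sum_of_two_scaled_squares:
  fixes a b c :: "'a::{field,finite}"
  assumes two: "(2::'a) \<noteq> 0" and a: "a \<noteq> 0" and b: "b \<noteq> 0"
  shows "\<exists>x y. a * (x * x) + b * (y * y) + c = 0"
proof -
  let ?S = "range (\<lambda>x::'a. x * x)"
  \<comment> \<open>A nonzero square has at most the two roots \<open>y\<close> and
    \<open>- y\<close>; zero has only itself.\<close>
  have "CARD('a) \<le> 2 * card (?S - {0}) + 1"
  proof -
    have "(UNIV :: 'a set) = insert 0 (\<Union>s\<in>?S - {0}. {x. x * x = s})" by auto
    then have "CARD('a) = card (insert 0 (\<Union>s\<in>?S - {0}. {x::'a. x * x = s}))" by simp
    also have "\<dots> \<le> Suc (card (\<Union>s\<in>?S - {0}. {x::'a. x * x = s}))"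
      by (simp add: card_insert_if)
    also have "card (\<Union>s\<in>?S - {0}. {x::'a. x * x = s}) \<le> (\<Sum>s\<in>?S - {0}. card {x::'a. x * x = s})"
      by (rule card_UN_le) auto
    also have "\<dots> \<le> (\<Sum>s\<in>?S - {0}. 2)"
    proof (rule sum_mono)
      fix s assume "s \<in> ?S - {0}"
      then obtain y where y: "s = y * y" by auto
      have "{x. x * x = s} \<subseteq> {y, - y}" using y by (auto simp: square_eq_iff)
      then have "card {x. x * x = s} \<le> card {y, - y}" by (intro card_mono) auto
      also have "\<dots> \<le> 2" by (simp add: card_insert_if)
      finally show "card {x. x * x = s} \<le> 2" .
    qed
    finally show ?thesis by simp
  qed
  moreover have "card ?S = Suc (card (?S - {0}))"
  proof -
    have "0 \<in> ?S" by (auto intro!: image_eqI[of _ _ 0])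
    then show ?thesis by (intro card.remove) auto
  qed
  ultimately have S: "CARD('a) < 2 * card ?S" by linarith
  let ?A = "(\<lambda>s. a * s) ` ?S" and ?B = "(\<lambda>s. - (b * s) - c) ` ?S"
  have cA: "card ?A = card ?S" using a by (intro card_image) (auto simp: inj_on_def)
  have cB: "card ?B = card ?S" using b by (intro card_image) (auto simp: inj_on_def)
  have "?A \<inter> ?B \<noteq> {}"
  proof
    assume "?A \<inter> ?B = {}"
    then have "card (?A \<union> ?B) = card ?A + card ?B" by (intro card_Un_disjoint) auto
    moreover have "card (?A \<union> ?B) \<le> CARD('a)" by (rule card_mono) auto
    ultimately show False using S cA cB by linarith
  qed
  then obtain x y where "a * (x * x) = - (b * (y * y)) - c" by blast
  then have "a * (x * x) + b * (y * y) + c = 0" by simp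
  then show ?thesis by blast
qed

lemma odd_between: "2 * s \<le> m \<Longrightarrow> m \<le> 2 * s + 2 \<Longrightarrow> odd m \<Longrightarrow> m = Suc (2 * s)" for s m :: nat
  by presburger

lemma even_between: "2 * s \<le> m \<Longrightarrow> m \<le> 2 * s + 2 \<Longrightarrow> even m \<Longrightarrow> m = 2 * s \<or> m = 2 * s + 2"
  for s m :: nat
  by presburger

text \<open>If \<open>2 = 0\<close>, the pairs \<open>{x, x + 1}\<close> partition the field into
  blocks of size two.\<close>

lemma two_neq_0_of_odd_card:
  assumes "odd CARD('a::{field,finite})"
  shows "(2::'a) \<noteq> 0"
proof
  assume two: "(2::'a) = 0"
  let ?P = "(\<lambda>x::'a. {x, x + 1}) ` UNIV"
  have inv: "x + 1 + 1 = x" for x :: 'a using two by (simp add: add.assoc one_add_one)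
  have c: "card B = 2" if "B \<in> ?P" for B using that by auto
  have "card (\<Union>?P) = 2 * card ?P"
  proof (rule card_partition[symmetric])
    fix B C assume "B \<in> ?P" "C \<in> ?P" "B \<noteq> C"
    then show "B \<inter> C = {}" using inv by auto
  qed (use c in auto)
  moreover have "\<Union>?P = UNIV" by auto
  ultimately show False using assms by simp
qed

text \<open>Here \<open>d\<close> and \<open>m\<close> belong to the quotient by the radical (its
  dimension and its largest isotropic dimension), \<open>c\<close> is the dimension of the radical
  and \<open>t\<close> the largest isotropic dimension before taking the quotient. The type can thus
  be read off without the quotient, from \<open>d + 2c\<close> and \<open>t\<close>.\<close>

lemma type_dim_isotropic:
  fixes d m c t :: nat and \<delta> :: int
  assumes "(odd d \<and> \<delta> = 0) \<or> (even d \<and> int m = int d div 2 \<and> \<delta> = 1) \<or>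
      (even d \<and> int m = int d div 2 - 1 \<and> \<delta> = -1)" "\<delta> \<noteq> 0" "m + c = t"
  shows "(real_of_int \<delta> = 1 \<and> d + c + c = 2 * t) \<or> (real_of_int \<delta> = -1 \<and> d + c + c = 2 * t + 2)"
proof -
  have "even d \<Longrightarrow> int m = int d div 2 \<Longrightarrow> d + c + c = 2 * t" using assms(3) by presburger
  moreover have "even d \<Longrightarrow> int m = int d div 2 - 1 \<Longrightarrow> d + c + c = 2 * t + 2"
    using assms(3) by presburger
  ultimately show ?thesis using assms(1,2) by auto
qed

section \<open>Rogers-Szego polynomials and the q-binomial theorem\<close>

text \<open>This is \<open>\<Sum>s\<le>N. [N choose s]\<^sub>q \<xi>^s\<close>; the recursion is the \<open>q\<close>-Pascal rule.\<close>

fun rogers_szego :: "real \<Rightarrow> nat \<Rightarrow> real \<Rightarrow> real" where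
  "rogers_szego q 0 \<xi> = 1"
| "rogers_szego q (Suc N) \<xi> = rogers_szego q N \<xi> + \<xi> * q ^ N * rogers_szego q N (\<xi> / q)"

text \<open>Coefficientwise this is
  \<open>(q^s - 1) [N+1 choose s] = (q^(N+1) - 1) [N choose s-1]\<close>; the induction uses the
  defining recursion only. It trades values at \<open>\<xi> / q\<close> for values at
  \<open>\<xi>\<close>.\<close>

lemma rogers_szego_scale:
  assumes "q \<noteq> 0"
  shows "rogers_szego q (Suc N) (\<xi> / q) = rogers_szego q (Suc N) \<xi> - \<xi> / q * (q ^ Suc N - 1) * rogers_szego q N (\<xi> / q)"
  using assms
proof (induction N arbitrary: \<xi>)
  case 0
  then show ?case by (simp add: field_simps)
next
  case (Suc N)
  have IH: "rogers_szego q (Suc N) (\<xi> / q) = rogers_szego q (Suc N) \<xi> - \<xi> / q * (q ^ Suc N - 1) * rogers_szego q N (\<xi> / q)" for \<xi>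
    using Suc by blast
  define A where "A = rogers_szego q (Suc N)"
  define B where "B = rogers_szego q N"
  have A: "A \<xi> = B \<xi> + \<xi> * q ^ N * B (\<xi> / q)" for \<xi> by (simp add: A_def B_def)
  have IH: "A (\<xi> / q) = A \<xi> - \<xi> / q * (q ^ Suc N - 1) * B (\<xi> / q)" for \<xi>
    using IH[of \<xi>] by (simp add: A_def B_def)
  have s: "rogers_szego q (Suc (Suc N)) \<xi> = A \<xi> + \<xi> * q ^ Suc N * A (\<xi> / q)" for \<xi> by (simp add: A_def)
  have "A (\<xi> / q) + \<xi> / q * q ^ Suc N * A (\<xi> / q / q) =
     A \<xi> - \<xi> / q * (q ^ Suc N - 1) * B (\<xi> / q) + \<xi> / q * q ^ Suc N *
       (A (\<xi> / q) - \<xi> / q / q * (q ^ Suc N - 1) * B (\<xi> / q / q))"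
    using IH[of \<xi>] IH[of "\<xi> / q"] by simp
  also have "\<dots> = A \<xi> + \<xi> / q * q ^ Suc N * A (\<xi> / q) -
      \<xi> / q * (q ^ Suc N - 1) * (B (\<xi> / q) + (\<xi> / q) * q ^ N * B (\<xi> / q / q))"
    using \<open>q \<noteq> 0\<close> by (simp add: field_simps)
  also have "\<dots> = A \<xi> + \<xi> / q * q ^ Suc N * A (\<xi> / q) - \<xi> / q * (q ^ Suc N - 1) * A (\<xi> / q)"
    by (simp only: A[of "\<xi> / q"])
  also have "\<dots> = A \<xi> + \<xi> * q ^ Suc N * A (\<xi> / q) - \<xi> / q * (q ^ Suc (Suc N) - 1) * A (\<xi> / q)"
    using \<open>q \<noteq> 0\<close> by (simp add: field_simps)
  finally show ?case unfolding s unfolding A_def .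
qed

text \<open>Eliminating the argument \<open>\<xi> / q\<close> between the defining recursion and the
  scaling rule leaves a recurrence in \<open>N\<close> at a fixed \<open>\<xi>\<close>, fit for
  evaluation at \<open>- 1 / q\<close>.\<close>

lemma rogers_szego_three_term:
  assumes "q \<noteq> 0"
  shows "rogers_szego q (Suc (Suc N)) \<xi> = (1 + \<xi>) * rogers_szego q (Suc N) \<xi> + (q ^ Suc N - 1) * \<xi> * rogers_szego q N \<xi>"
proof -
  define A where "A = rogers_szego q (Suc N)"
  define B where "B = rogers_szego q N"
  have A: "A \<xi> = B \<xi> + \<xi> * q ^ N * B (\<xi> / q)" by (simp add: A_def B_def)
  have s: "rogers_szego q (Suc (Suc N)) \<xi> = A \<xi> + \<xi> * q ^ Suc N * A (\<xi> / q)" by (simp add: A_def)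
  have IH: "A (\<xi> / q) = A \<xi> - \<xi> / q * (q ^ Suc N - 1) * B (\<xi> / q)"
    using rogers_szego_scale[OF assms, of N \<xi>] by (simp add: A_def B_def)
  have "rogers_szego q (Suc (Suc N)) \<xi> = A \<xi> + \<xi> * q ^ Suc N * A \<xi> - \<xi> * (q ^ Suc N - 1) * (\<xi> * q ^ N * B (\<xi> / q))"
    unfolding s IH using assms by (simp add: field_simps)
  also have "\<xi> * q ^ N * B (\<xi> / q) = A \<xi> - B \<xi>" using A by simp
  finally show ?thesis by (simp add: A_def B_def algebra_simps)
qed

text \<open>The linear substitution of \<open>\<xi>^r h(M-r, \<xi>)\<close> for \<open>Y^r\<close>.
  Coefficients beyond \<open>M\<close> are cut off, whence the degree bounds carried along
  below.\<close>

definition rs_eval :: "real \<Rightarrow> nat \<Rightarrow> real poly \<Rightarrow> real \<Rightarrow> real" where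
  "rs_eval q M p \<xi> = (\<Sum>r\<le>M. coeff p r * \<xi> ^ r * rogers_szego q (M - r) \<xi>)"

lemma rs_eval_add: "rs_eval q M (p + r) \<xi> = rs_eval q M p \<xi> + rs_eval q M r \<xi>"
  by (simp add: rs_eval_def sum.distrib algebra_simps)

lemma rs_eval_smult: "rs_eval q M (smult c p) \<xi> = c * rs_eval q M p \<xi>"
  by (simp add: rs_eval_def sum_distrib_left mult_ac)

lemma rs_eval_sum: "rs_eval q M (\<Sum>i\<in>I. p i) \<xi> = (\<Sum>i\<in>I. rs_eval q M (p i) \<xi>)"
  by (induction I rule: infinite_finite_induct) (auto simp: rs_eval_add, simp_all add: rs_eval_def)

lemma rs_eval_monom: "r \<le> M \<Longrightarrow> rs_eval q M (monom c r) \<xi> = c * \<xi> ^ r * rogers_szego q (M - r) \<xi>"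
  by (simp add: rs_eval_def if_distrib if_distribR sum.delta' cong: if_cong)

lemma rs_eval_1: "rs_eval q 0 1 \<xi> = 1"
  by (simp add: rs_eval_def)

text \<open>Multiplying by \<open>Y\<close> raises the exponent and \<open>M\<close> together, which
  only costs a factor \<open>\<xi>\<close>. The constant term 1 raises \<open>M\<close> alone; there
  the recursion of \<open>rogers_szego\<close> applies, with
  \<open>\<xi>^r q^(M-r) = q^M (\<xi>/q)^r\<close>.\<close>

lemma rs_eval_Suc:
  assumes q: "q \<noteq> 0" and p: "degree p \<le> M"
  shows "rs_eval q (Suc M) ([:1, a:] * p) \<xi> =
    (1 + a * \<xi>) * rs_eval q M p \<xi> + \<xi> * q ^ M * rs_eval q M p (\<xi> / q)"
proof -
  have c0: "coeff p (Suc M) = 0" using p by (simp add: coeff_eq_0)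
  have "rs_eval q (Suc M) ([:1, a:] * p) \<xi> = rs_eval q (Suc M) p \<xi> + a * rs_eval q (Suc M) (pCons 0 p) \<xi>"
    by (simp add: rs_eval_add flip: rs_eval_smult)
  also have "rs_eval q (Suc M) (pCons 0 p) \<xi> = \<xi> * rs_eval q M p \<xi>"
    unfolding rs_eval_def by (subst sum.atMost_Suc_shift) (simp add: sum_distrib_left mult_ac)
  also have "rs_eval q (Suc M) p \<xi> = rs_eval q M p \<xi> + \<xi> * q ^ M * rs_eval q M p (\<xi> / q)"
  proof -
    have "rs_eval q (Suc M) p \<xi> = (\<Sum>r\<le>M. coeff p r * \<xi> ^ r * rogers_szego q (Suc (M - r)) \<xi>)"
      unfolding rs_eval_def using c0 by (simp add: Suc_diff_le)
    also have "\<dots> = (\<Sum>r\<le>M. coeff p r * \<xi> ^ r * rogers_szego q (M - r) \<xi> +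
        \<xi> * q ^ M * (coeff p r * (\<xi> / q) ^ r * rogers_szego q (M - r) (\<xi> / q)))"
    proof (rule sum.cong[OF refl])
      fix r assume "r \<in> {..M}"
      then have "q ^ M = q ^ (M - r) * q ^ r" by (simp flip: power_add)
      then show "coeff p r * \<xi> ^ r * rogers_szego q (Suc (M - r)) \<xi> = coeff p r * \<xi> ^ r * rogers_szego q (M - r) \<xi> +
        \<xi> * q ^ M * (coeff p r * (\<xi> / q) ^ r * rogers_szego q (M - r) (\<xi> / q))"
        using q by (simp add: power_divide algebra_simps)
    qed
    finally show ?thesis by (simp add: rs_eval_def sum.distrib sum_distrib_left)
  qed
  finally show ?thesis by (simp add: algebra_simps)
qed

text \<open>Both parities go through one induction on the three-term recurrence. At
  \<open>- 1 / q\<close> its two summands have a common factor, and what remains collapses to a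
  single power of \<open>q\<close>.\<close>

lemma rogers_szego_minus_inverse:
  assumes q: "q \<noteq> 0"
  shows "rogers_szego q (2 * N) (- 1 / q) = (-1) ^ N / q ^ (2 * N) * (\<Prod>k<N. q ^ (2 * k + 1) - 1)"
    and "rogers_szego q (2 * N + 1) (- 1 / q) = (-1) ^ N / q ^ (2 * N + 1) * (\<Prod>k<Suc N. q ^ (2 * k + 1) - 1)"
proof (induction N)
  case 0
  { case 1 then show ?case by simp }
  { case 2 then show ?case using q by (simp add: field_simps) }
next
  case (Suc N)
  let ?\<xi> = "- 1 / q"
  let ?P = "\<Prod>k<N. q ^ (2 * k + 1) - 1"
  let ?c = "q ^ (2 * N + 1)" 
  have e: "rogers_szego q (2 * Suc N) ?\<xi> = (-1) ^ Suc N / q ^ (2 * Suc N) * (\<Prod>k<Suc N. q ^ (2 * k + 1) - 1)"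
  proof -
    have "rogers_szego q (2 * Suc N) ?\<xi> = (1 + ?\<xi>) * rogers_szego q (2 * N + 1) ?\<xi> + (?c - 1) * ?\<xi> * rogers_szego q (2 * N) ?\<xi>"
      using rogers_szego_three_term[OF q, of "2 * N" ?\<xi>] by simp
    also have "\<dots> = (1 + ?\<xi>) * ((-1) ^ N / ?c * (?P * (?c - 1))) +
        (?c - 1) * ?\<xi> * ((-1) ^ N / q ^ (2 * N) * ?P)" unfolding Suc by simp
    also have "\<dots> = (-1) ^ Suc N / q ^ (2 * Suc N) * (?P * (?c - 1))"
      using q by (simp add: field_simps)
    finally show ?thesis by simp
  qed
  { case 1 show ?case by (rule e) }
  { case 2
    let ?R = "\<Prod>k<Suc N. q ^ (2 * k + 1) - 1"
    let ?d = "q ^ (2 * N + 2)"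
    have "rogers_szego q (2 * Suc N + 1) ?\<xi> = (1 + ?\<xi>) * rogers_szego q (2 * Suc N) ?\<xi> + (?d - 1) * ?\<xi> * rogers_szego q (2 * N + 1) ?\<xi>"
      using rogers_szego_three_term[OF q, of "Suc (2 * N)" ?\<xi>] by simp
    also have "\<dots> = (1 + ?\<xi>) * ((-1) ^ Suc N / ?d * ?R) +
        (?d - 1) * ?\<xi> * ((-1) ^ N / ?c * ?R)" unfolding Suc(2) e by simp
    also have "\<dots> = (-1) ^ Suc N / q ^ (2 * Suc N + 1) * (?R * (q ^ (2 * Suc N + 1) - 1))"
      using q by (simp add: field_simps)
    finally show ?case by (simp only: prod.lessThan_Suc) }
qed

section \<open>Gaussian coefficients and the expansion of products of quadratic factors\<close>

definition qfall :: "real \<Rightarrow> nat \<Rightarrow> nat \<Rightarrow> real" where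
  "qfall x N s = (\<Prod>k<s. x ^ (N - k) - 1)"

definition odd_prod :: "real \<Rightarrow> nat \<Rightarrow> real" where
  "odd_prod x m = (\<Prod>k<m. x ^ (2 * k + 1) - 1)"

lemma psi_minus_eq_qfall:
  assumes "s \<le> N"
  shows "psi_minus (int N - int s + 1) (int N) x = qfall x N s"
  unfolding psi_minus_def qfall_def
proof (rule prod.reindex_bij_witness[of _ "\<lambda>k. int (N - k)" "\<lambda>k. nat (int N - k)"])
  fix k assume k: "k \<in> {int N - int s + 1..int N}"
  then show "int (N - nat (int N - k)) = k" "nat (int N - k) \<in> {..<s}"
    using assms by (auto simp: of_nat_diff nat_le_iff)
  from k assms show "x ^ (N - nat (int N - k)) - 1 = x powi k - 1"
    by (auto simp: power_int_def nat_diff_distrib)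
qed (use assms in auto)

lemma qfall_nonzero:
  assumes "1 < x" "s \<le> N"
  shows "qfall x N s \<noteq> 0"
proof -
  have "x ^ (N - k) \<noteq> 1" if "k < s" for k
  proof -
    have "1 < x ^ (N - k)" by (rule one_less_power[OF assms(1)]) (use assms that in simp)
    then show ?thesis by simp
  qed
  then show ?thesis by (simp add: qfall_def)
qed

lemma gauss_binomial_eq_qfall:
  assumes "1 < x"
  shows "gauss_binomial (int N) (int s) x = qfall x N s / qfall x s s"
proof (cases "s \<le> N")
  case True
  have "psi_minus 1 (int s) x = qfall x s s" using psi_minus_eq_qfall[of s s x] by simp
  then show ?thesis using True psi_minus_eq_qfall[OF True, of x] by (simp add: gauss_binomial_def)
next
  case False
  \<comment> \<open>The factor with \<open>k = N\<close> is \<open>x^0 - 1\<close>.\<close>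
  then have "qfall x N s = 0" by (auto simp: qfall_def intro!: bexI[of _ N])
  then show ?thesis using False by (simp add: gauss_binomial_def)
qed

lemma gauss_binomial_0: "1 < x \<Longrightarrow> gauss_binomial (int N) 0 x = 1"
  using gauss_binomial_eq_qfall[of x N 0] by (simp add: qfall_def)

text \<open>With \<open>y = x^(N-s)\<close> and \<open>P = x^(s+1)\<close> the leading factor of the
  numerator splits as \<open>y P - 1 = (y - 1) + y (P - 1)\<close>.\<close>

lemma gauss_binomial_Suc:
  assumes x: "1 < x" and "s \<le> N"
  shows "gauss_binomial (int (Suc N)) (int (Suc s)) x =
    gauss_binomial (int N) (int (Suc s)) x + x ^ (N - s) * gauss_binomial (int N) (int s) x"
proof -
  have a: "qfall x (Suc M) (Suc t) = (x ^ Suc M - 1) * qfall x M t" for M t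
    unfolding qfall_def by (subst prod.lessThan_Suc_shift) simp
  have b: "qfall x N (Suc s) = qfall x N s * (x ^ (N - s) - 1)" by (simp add: qfall_def)
  have nz: "qfall x s s \<noteq> 0" "x ^ Suc s - 1 \<noteq> 0"
    using qfall_nonzero[OF x, of s s] qfall_nonzero[OF x, of 1 "Suc s"] by (auto simp: qfall_def)
  have e: "x ^ Suc N = x ^ (N - s) * x ^ Suc s" using assms by (simp flip: power_add power_Suc)
  have frac: "(y * P - 1) * F / ((P - 1) * G) = F * (y - 1) / ((P - 1) * G) + y * (F / G)"
    if "P - 1 \<noteq> 0" "G \<noteq> 0" for y P F G :: real
  proof -
    have "y * (F / G) = y * F * (P - 1) / ((P - 1) * G)" using that by simp
    then show ?thesis by (simp add: algebra_simps flip: add_divide_distrib)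
  qed
  show ?thesis
    unfolding gauss_binomial_eq_qfall[OF x] a b e by (rule frac[OF nz(2,1)])
qed

text \<open>Up to the sign \<open>(-1)^s\<close> this is the coefficient of \<open>Z^s\<close> in
  the product of the \<open>1 - c x^k Z\<close> over \<open>k < N\<close>.\<close>

definition qbin_coeff :: "real \<Rightarrow> real \<Rightarrow> nat \<Rightarrow> nat \<Rightarrow> real" where
  "qbin_coeff x c N s = x ^ (s * (s - 1) div 2) * gauss_binomial (int N) (int s) x * c ^ s"

lemma qbin_coeff_Suc:
  assumes "1 < x" "s \<le> N"
  shows "qbin_coeff x c (Suc N) (Suc s) = qbin_coeff x c N (Suc s) + c * x ^ N * qbin_coeff x c N s"
proof -
  have "Suc s * s = s * (s - 1) + 2 * s" by (cases s) auto
  then have "Suc s * (Suc s - 1) div 2 = s * (s - 1) div 2 + s" by simp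
  then have t: "x ^ (Suc s * (Suc s - 1) div 2) = x ^ (s * (s - 1) div 2) * x ^ s"
    by (simp only: power_add)
  have e: "x ^ N = x ^ (N - s) * x ^ s" using assms by (simp flip: power_add)
  show ?thesis
    unfolding qbin_coeff_def t gauss_binomial_Suc[OF assms] e by (simp add: algebra_simps)
qed

text \<open>The \<open>q\<close>-binomial theorem with \<open>Z = Y^2\<close>, by splitting off the
  last factor.\<close>

lemma prod_quadratic_factors:
  fixes x c :: real
  assumes x: "1 < x"
  shows "(\<Prod>k<N. [:1, 0, - (c * x ^ k):]) = (\<Sum>s\<le>N. monom ((-1) ^ s * qbin_coeff x c N s) (2 * s))"
proof (induction N)
  case 0
  then show ?case using gauss_binomial_0[OF x, of 0] by (simp add: qbin_coeff_def monom_0 one_pCons)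
next
  case (Suc N)
  let ?a = "\<lambda>N s. (-1) ^ s * qbin_coeff x c N s"
  \<comment> \<open>The vanishing top coefficient allows the first sum to run to
    \<open>Suc N\<close>.\<close>
  have top: "?a N (Suc N) = 0" by (simp add: qbin_coeff_def gauss_binomial_def)
  have a0: "qbin_coeff x c M 0 = 1" for M using gauss_binomial_0[OF x, of M] by (simp add: qbin_coeff_def)
  have q: "[:1, 0, - (c * x ^ N):] = 1 + monom (- (c * x ^ N)) 2"
    by (simp add: monom_altdef one_pCons numeral_2_eq_2)
  have "(\<Prod>k<Suc N. [:1, 0, - (c * x ^ k):]) =
      (\<Sum>s\<le>N. monom (?a N s) (2 * s)) * (1 + monom (- (c * x ^ N)) 2)"
    using Suc by (simp add: q)
  also have "\<dots> = (\<Sum>s\<le>Suc N. monom (?a N s) (2 * s)) +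
      (\<Sum>s\<le>N. monom (- (c * x ^ N) * ?a N s) (2 * Suc s))"
  proof -
    have "(\<Sum>s\<le>N. monom (?a N s) (2 * s)) * monom (- (c * x ^ N)) 2 =
        (\<Sum>s\<le>N. monom (- (c * x ^ N) * ?a N s) (2 * Suc s))"
      unfolding sum_distrib_right by (rule sum.cong[OF refl]) (simp add: mult_monom mult_ac)
    then show ?thesis using top by (simp only: distrib_left mult_1_right sum.atMost_Suc monom_0 monom_eq_0)
  qed
  also have "\<dots> = monom 1 0 + (\<Sum>s\<le>N. monom (?a N (Suc s)) (2 * Suc s) +
      monom (- (c * x ^ N) * ?a N s) (2 * Suc s))"
    by (subst sum.atMost_Suc_shift) (simp add: a0 sum.distrib)
  also have "(\<Sum>s\<le>N. monom (?a N (Suc s)) (2 * Suc s) + monom (- (c * x ^ N) * ?a N s) (2 * Suc s)) =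
      (\<Sum>s\<le>N. monom (?a (Suc N) (Suc s)) (2 * Suc s))"
    by (rule sum.cong[OF refl]) (simp add: add_monom qbin_coeff_Suc[OF x] algebra_simps)
  also have "monom 1 0 + \<dots> = (\<Sum>s\<le>Suc N. monom (?a (Suc N) s) (2 * s))"
    by (subst sum.atMost_Suc_shift) (simp add: a0)
  finally show ?case .
qed

text \<open>At \<open>- 1 / q\<close> the denominator \<open>q^(2s)\<close> of the power of
  \<open>\<xi>\<close> completes that of the Rogers-Szego value to \<open>q^(2h+1)\<close>, so all
  \<open>s\<close> share one prefactor. Odd exponents give the same prefactor with the opposite
  sign.\<close>

lemma rs_eval_even:
  assumes "q \<noteq> 0" "s \<le> h"
  shows "rs_eval q (2 * h + 1) (monom a (2 * s)) (- 1 / q) =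
    (-1) ^ h / q ^ (2 * h + 1) * ((-1) ^ s * a * odd_prod q (Suc (h - s)))"
proof -
  have e: "2 * h + 1 - 2 * s = 2 * (h - s) + 1" using assms by simp
  have "2 * h + 1 = 2 * s + (2 * (h - s) + 1)" "h = s + (h - s)" using assms by simp_all
  then have h: "q ^ (2 * h + 1) = q ^ (2 * s) * q ^ (2 * (h - s) + 1)"
    "(-1) ^ h = (-1 :: real) ^ s * (-1) ^ (h - s)" by (metis power_add)+
  have s: "(-1 :: real) ^ s * (-1) ^ s = 1" by (simp flip: power_add mult_2)
  have "rs_eval q (2 * h + 1) (monom a (2 * s)) (- 1 / q) = a * (- 1 / q) ^ (2 * s) *
     ((-1) ^ (h - s) / q ^ (2 * (h - s) + 1) * odd_prod q (Suc (h - s)))"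
    using rs_eval_monom[of "2 * s" "2 * h + 1" q a "- 1 / q"] assms(2)
    unfolding e rogers_szego_minus_inverse(2)[OF assms(1)] odd_prod_def by simp
  also have "(- 1 / q) ^ (2 * s) = 1 / q ^ (2 * s)" by (simp add: power_divide)
  also have "a * (1 / q ^ (2 * s)) * ((-1) ^ (h - s) / q ^ (2 * (h - s) + 1) * odd_prod q (Suc (h - s))) =
     ((-1) ^ s * (-1) ^ s) * ((-1) ^ (h - s) / (q ^ (2 * s) * q ^ (2 * (h - s) + 1)) * (a * odd_prod q (Suc (h - s))))"
    unfolding s by simp
  finally show ?thesis unfolding h by (simp add: mult_ac)
qed

lemma rs_eval_odd:
  assumes "q \<noteq> 0" "s \<le> h"
  shows "rs_eval q (2 * h + 1) (monom a (2 * s + 1)) (- 1 / q) =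
    - ((-1) ^ h / q ^ (2 * h + 1) * ((-1) ^ s * a * odd_prod q (h - s)))"
proof -
  have e: "2 * h + 1 - (2 * s + 1) = 2 * (h - s)" using assms by simp
  have "2 * h + 1 = 2 * s + 1 + 2 * (h - s)" "h = s + (h - s)" using assms by simp_all
  then have h: "q ^ (2 * h + 1) = q ^ (2 * s + 1) * q ^ (2 * (h - s))"
    "(-1) ^ h = (-1 :: real) ^ s * (-1) ^ (h - s)" by (metis power_add)+
  have s: "(-1 :: real) ^ s * (-1) ^ s = 1" by (simp flip: power_add mult_2)
  have "rs_eval q (2 * h + 1) (monom a (2 * s + 1)) (- 1 / q) = a * (- 1 / q) ^ (2 * s + 1) *
     ((-1) ^ (h - s) / q ^ (2 * (h - s)) * odd_prod q (h - s))"
    using rs_eval_monom[of "2 * s + 1" "2 * h + 1" q a "- 1 / q"] assms(2)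
    unfolding e rogers_szego_minus_inverse(1)[OF assms(1)] odd_prod_def by simp
  also have "(- 1 / q) ^ (2 * s + 1) = - (1 / q ^ (2 * s + 1))" by (simp add: power_divide)
  also have "a * - (1 / q ^ (2 * s + 1)) * ((-1) ^ (h - s) / q ^ (2 * (h - s)) * odd_prod q (h - s)) =
     - (((-1) ^ s * (-1) ^ s) * ((-1) ^ (h - s) / (q ^ (2 * s + 1) * q ^ (2 * (h - s))) * (a * odd_prod q (h - s))))"
    unfolding s by simp
  finally show ?thesis unfolding h by (simp add: mult_ac)
qed

text \<open>Expand \<open>(1 - b0 Y)(1 + b Y) = 1 + (b - b0) Y - b b0 Y^2\<close>. The
  \<open>Y^2\<close> part of term \<open>s\<close> has exponent \<open>2(s+1)\<close> and yields
  \<open>odd_prod q (h - s)\<close>, as the \<open>Y\<close> part does, so these two merge into one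
  sum. The bound \<open>N < h\<close> keeps the exponent \<open>2N + 2\<close> within range when
  \<open>b0\<close> is nonzero.\<close>

lemma rs_eval_product:
  assumes q: "1 < q" and N: "N \<le> h" "b0 = 0 \<or> N < h"
  shows "rs_eval q (2 * h + 1) ([:1, - b0:] * [:1, b:] * (\<Prod>k<N. [:1, 0, - (c * (q\<^sup>2) ^ k):])) (- 1 / q) =
    (-1) ^ h / q ^ (2 * h + 1) *
      ((\<Sum>s\<le>N. qbin_coeff (q\<^sup>2) c N s * odd_prod q (Suc (h - s))) +
       (b0 - b + b * b0) * (\<Sum>s\<le>N. qbin_coeff (q\<^sup>2) c N s * odd_prod q (h - s)))"
proof -
  let ?K = "(-1) ^ h / q ^ (2 * h + 1)"
  let ?g = "qbin_coeff (q\<^sup>2) c N"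
  let ?a = "\<lambda>s. (-1) ^ s * ?g s"
  have q0: "q \<noteq> 0" using q by simp
  have x: "1 < q\<^sup>2" using q by (simp add: one_less_power)
  have lin: "[:1, - b0:] * [:1, b:] = 1 + monom (b - b0) 1 + monom (- (b * b0)) 2"
    by (simp add: monom_altdef one_pCons numeral_2_eq_2)
  have "[:1, - b0:] * [:1, b:] * (\<Prod>k<N. [:1, 0, - (c * (q\<^sup>2) ^ k):]) =
    (\<Sum>s\<le>N. monom (?a s) (2 * s) + monom ((b - b0) * ?a s) (2 * s + 1) + monom (- (b * b0) * ?a s) (2 * Suc s))"
    unfolding lin prod_quadratic_factors[OF x]
    by (simp add: distrib_right sum_distrib_left mult_monom sum.distrib)
  then have "rs_eval q (2 * h + 1) ([:1, - b0:] * [:1, b:] * (\<Prod>k<N. [:1, 0, - (c * (q\<^sup>2) ^ k):])) (- 1 / q) =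
     (\<Sum>s\<le>N. rs_eval q (2 * h + 1) (monom (?a s) (2 * s)) (- 1 / q) +
       rs_eval q (2 * h + 1) (monom ((b - b0) * ?a s) (2 * s + 1)) (- 1 / q) +
       rs_eval q (2 * h + 1) (monom (- (b * b0) * ?a s) (2 * Suc s)) (- 1 / q))"
    by (simp only: rs_eval_sum rs_eval_add)
  also have "\<dots> = (\<Sum>s\<le>N. ?K * (?g s * odd_prod q (Suc (h - s)) + (b0 - b + b * b0) * (?g s * odd_prod q (h - s))))"
  proof (rule sum.cong[OF refl])
    fix s assume "s \<in> {..N}"
    then have s: "s \<le> h" "b0 = 0 \<or> Suc s \<le> h" using N by auto
    have sg: "(-1 :: real) ^ s * ((-1) ^ s * y) = y" for y by (simp flip: mult.assoc power_add mult_2)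
    have "rs_eval q (2 * h + 1) (monom (?a s) (2 * s)) (- 1 / q) = ?K * (?g s * odd_prod q (Suc (h - s)))"
      unfolding rs_eval_even[OF q0 s(1)] by (simp add: sg)
    moreover have "rs_eval q (2 * h + 1) (monom ((b - b0) * ?a s) (2 * s + 1)) (- 1 / q) =
        ?K * ((b0 - b) * (?g s * odd_prod q (h - s)))"
    proof -
      have "(-1) ^ s * ((b - b0) * ?a s) = (b - b0) * ?g s" using sg[of "?g s"] by (simp add: mult_ac)
      then show ?thesis unfolding rs_eval_odd[OF q0 s(1)] by (simp add: algebra_simps)
    qed
    moreover have "rs_eval q (2 * h + 1) (monom (- (b * b0) * ?a s) (2 * Suc s)) (- 1 / q) =
        ?K * (b * b0 * (?g s * odd_prod q (h - s)))"
    proof (cases "b0 = 0")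
      case True
      then show ?thesis by (simp add: rs_eval_def)
    next
      case False
      then have S: "Suc s \<le> h" using s by simp
      have "(-1) ^ Suc s * (- (b * b0) * ?a s) = b * b0 * ?g s" using sg[of "?g s"] by (simp add: mult_ac)
      moreover have "Suc (h - Suc s) = h - s" using S by simp
      ultimately show ?thesis unfolding rs_eval_even[OF q0 S] by simp
    qed
    ultimately show "rs_eval q (2 * h + 1) (monom (?a s) (2 * s)) (- 1 / q) +
       rs_eval q (2 * h + 1) (monom ((b - b0) * ?a s) (2 * s + 1)) (- 1 / q) +
       rs_eval q (2 * h + 1) (monom (- (b * b0) * ?a s) (2 * Suc s)) (- 1 / q) =
       ?K * (?g s * odd_prod q (Suc (h - s)) + (b0 - b + b * b0) * (?g s * odd_prod q (h - s)))"
      by (simp add: algebra_simps)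
  qed
  finally show ?thesis by (simp only: distrib_left sum.distrib sum_distrib_left)
qed

section \<open>Translation into the functions and exponents of the stated formula\<close>

lemma chi_eq_odd_prod: "chi 1 (int m) x = odd_prod x m"
  unfolding chi_def odd_prod_def
proof (rule prod.reindex_bij_witness[of _ "\<lambda>k. int k + 1" "\<lambda>k. nat (k - 1)"])
  fix k assume "k \<in> {1..int m}"
  then have "2 * k - 1 = int (2 * nat (k - 1) + 1)" by simp
  then show "x ^ (2 * nat (k - 1) + 1) - 1 = x powi (2 * k - 1) - 1" by (metis power_int_of_nat)
qed auto

lemma sum_int_atLeast0: "(\<Sum>m = 0..int U. F m) = (\<Sum>s\<le>U. F (int s))"
  for F :: "int \<Rightarrow> real"
  by (rule sum.reindex_bij_witness[of _ int nat]) auto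

text \<open>The base \<open>q^2\<close> doubles \<open>s choose 2\<close> to \<open>s(s-1)\<close>;
  the power of \<open>c\<close> supplies the part of the exponent that is linear in
  \<open>s\<close>.\<close>

lemma qbin_coeff_powi:
  assumes q: "0 < q"
  shows "qbin_coeff (q\<^sup>2) (q ^ e / q ^ (2 * j)) N s =
    gauss_binomial (int N) (int s) (q\<^sup>2) * q powi (int s * (int s - 1 + int e - 2 * int j))"
proof -
  have "even (s * (s - 1))" by (cases s) auto
  then have t: "2 * (s * (s - 1) div 2) = s * (s - 1)" by simp
  have "int (s * (s - 1)) = int s * (int s - 1)" by (cases s) (auto simp: algebra_simps)
  then have "int s * (int s - 1 + int e - 2 * int j) = int (s * (s - 1)) + int (e * s) - int (2 * j * s)"
    by (simp add: algebra_simps)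
  moreover have "q powi (int A + int B - int C) = q ^ A * q ^ B / q ^ C" for A B C
    using q by (simp add: power_int_diff power_int_add)
  ultimately have "q powi (int s * (int s - 1 + int e - 2 * int j)) =
      q ^ (s * (s - 1)) * q ^ (e * s) / q ^ (2 * j * s)" by metis
  also have "\<dots> = (q\<^sup>2) ^ (s * (s - 1) div 2) * (q ^ e / q ^ (2 * j)) ^ s"
  proof -
    have "(q\<^sup>2) ^ (s * (s - 1) div 2) = q ^ (s * (s - 1))" by (simp only: t flip: power_mult)
    then show ?thesis by (simp add: power_divide flip: power_mult)
  qed
  finally show ?thesis by (simp add: qbin_coeff_def mult_ac)
qed

text \<open>The three powers have separate origins: \<open>q^(j(2h+1))\<close> counts the
  complements, \<open>q^(h^2)\<close> is the alternating sum of a non-singular one, and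
  \<open>q^(2h+1)\<close> is the common denominator of the Rogers-Szego values.\<close>

lemma prefactor_powr:
  fixes q :: real
  assumes "1 < q" and "n = j + (2 * h + 1)"
  shows "q powr (3/2 * real j * real n - 1/4 * (real n)^2 - 5/4 * (real j)^2
           - 1/2 * real n + 1/2 * real j - 1/4) =
    q ^ (j * (2 * h + 1)) / (q ^ h\<^sup>2 * q ^ (2 * h + 1))"
proof -
  have "3/2 * real j * real n - 1/4 * (real n)^2 - 5/4 * (real j)^2 - 1/2 * real n + 1/2 * real j - 1/4 =
     real (j * (2 * h + 1)) - (real (h\<^sup>2) + real (2 * h + 1))"
    unfolding assms(2) by (simp add: power2_eq_square field_simps)
  then show ?thesis using assms(1) by (simp only: powr_diff powr_add powr_realpow less_trans[OF zero_less_one])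
qed

lemma powr_nat_diff:
  fixes q x :: real
  assumes "1 < q" "x = real m - real k"
  shows "q powr x = q ^ m / q ^ k"
  unfolding assms(2) using assms(1) by (simp add: powr_diff powr_realpow)

text \<open>The arithmetic of \<open>card_perp\<close>: both sides of the hypothesis count the
  orthogonal pairs from sets of sizes \<open>P\<close> and \<open>t\<close>, where \<open>a\<close>
  and \<open>b\<close> vectors are orthogonal to the whole other set.\<close>

lemma double_count_balance:
  fixes q a t P b :: real
  assumes "0 < q" and e: "a*t+(P-a)*(t/q)=b*P+(t-b)*(P/q)" 
  shows "(q-1)*(a*t)=(q-1)*(b*P)"
proof -
  have "q * (a*t+(P-a)*(t/q)) = q * (b*P+(t-b)*(P/q))" using e by simp
  then have "q * (a*t)+(P-a)*t = q * (b*P)+(t-b)*P" using assms(1) by (simp add: distrib_left)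
  then show ?thesis by (simp add: algebra_simps)
qed

text \<open>Used with \<open>A = q^j\<close> and \<open>B = q - 1\<close>, to match the linear
  factor \<open>1 + aY\<close> at \<open>\<xi> = - x q^j / q\<close> with the coefficient
  \<open>1 - \<nu> x\<close> of the recursion.\<close>

lemma slope_scaling:
  fixes A B q x y z :: real
  assumes "A \<noteq> 0" "B \<noteq> 0" "q \<noteq> 0"
  shows "(y * q / (A * B) - z * q / (A * B)) * (- x * A / q) = - ((y - z) / B * x)"
  using assms by (simp add: field_simps)

section \<open>Isotropic subspaces of a quadratic space\<close>

locale symmetric_form =
  fixes f :: "'a::{field,finite}^'n \<Rightarrow> 'a^'n \<Rightarrow> 'a" and q :: real
  assumes q_eq: "q = real CARD('a)"
    and add_left: "f (u + v) w = f u w + f v w"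
    and scale_left: "f (c *s v) w = c * f v w"
    and f_sym: "f v w = f w v"
    and two_neq_0: "(2::'a) \<noteq> 0"
begin

definition perp :: "('a^'n) set \<Rightarrow> ('a^'n) set" where
  "perp T = {v. \<forall>t\<in>T. f v t = 0}"

definition isotropic :: "('a^'n) set \<Rightarrow> bool" where
  "isotropic T \<longleftrightarrow> vec.subspace T \<and> (\<forall>v\<in>T. f v v = 0)"

definition isotropic_count :: "('a^'n) set \<Rightarrow> real" where
  "isotropic_count P = real (card {v \<in> P. f v v = 0})"

text \<open>The excess of the number of isotropic vectors over the expected
  \<open>card P / q\<close>. It vanishes if \<open>dim P + dim rad P\<close> is odd; otherwise its
  sign is the type.\<close>

definition zeta :: "('a^'n) set \<Rightarrow> real" where
  "zeta P = isotropic_count P - real (card P) / q"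

lemma q_gt_1: "1 < q"
  using card_field_gt_1[where 'a='a] by (simp add: q_eq)

lemma real_card_subspace: "vec.subspace S \<Longrightarrow> real (card S) = q ^ vec.dim S"
  for S :: "('a^'n) set"
  by (simp add: card_subspace q_eq)

lemma q_pos [simp]: "0 < q"
  using q_gt_1 by linarith

lemma add_right: "f w (u + v) = f w u + f w v"
  using add_left[of u v w] by (simp add: f_sym)

lemma scale_right: "f w (c *s v) = c * f w v"
  by (metis scale_left f_sym)

lemma zero_left [simp]: "f 0 v = 0"
  using scale_left[of 0 v v] scale_left[of 0 0 v] by simp

lemma zero_right [simp]: "f v 0 = 0"
  by (metis f_sym zero_left)

lemma minus_left: "f (- u) w = - f u w"
  using add_left[of u "- u" w] by (simp add: eq_neg_iff_add_eq_0 add.commute)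

lemma diff_left: "f (u - v) w = f u w - f v w"
  using add_left[of u "- v" w] minus_left by simp

lemma diff_right: "f w (u - v) = f w u - f w v"
  by (metis diff_left f_sym)

lemma square_add: "f (u + v) (u + v) = f u u + 2 * f u v + f v v"
  by (simp add: add_left add_right f_sym[of v u] algebra_simps)

section \<open>Orthogonality, isotropic subspaces and their counts\<close>

lemma subspace_perp: "vec.subspace (perp T)"
  by (auto simp: vec.subspace_def perp_def add_left scale_left)

lemma perp_antimono: "S \<subseteq> T \<Longrightarrow> perp T \<subseteq> perp S"
  by (auto simp: perp_def)

lemma perp_singleton_span: "perp (vec.span {g}) = perp {g}"
  by (auto simp: perp_def vec.span_singleton scale_right)

lemma perp_span: "perp (vec.span T) = perp T"
proof -
  have "T \<subseteq> perp {v}" if "v \<in> perp T" for v using that by (auto simp: perp_def f_sym)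
  then have "vec.span T \<subseteq> perp {v}" if "v \<in> perp T" for v
    using that by (simp add: vec.span_minimal subspace_perp)
  then have "perp T \<subseteq> perp (vec.span T)" by (auto simp: perp_def f_sym)
  then show ?thesis using perp_antimono[OF vec.span_superset] by blast
qed

lemma perp_Un: "perp (S \<union> T) = perp S \<inter> perp T"
  by (auto simp: perp_def)

lemma subset_perp_commute: "T \<subseteq> perp S \<longleftrightarrow> S \<subseteq> perp T"
proof -
  have "f t s = 0 \<longleftrightarrow> f s t = 0" for s t by (simp add: f_sym)
  then show ?thesis by (auto simp: perp_def)
qed

lemma isotropic_subspace: "isotropic T \<Longrightarrow> vec.subspace T"
  by (simp add: isotropic_def)

lemma isotropic_ortho:
  assumes "isotropic T" "u \<in> T" "v \<in> T"
  shows "f u v = 0"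
proof -
  have "f (u + v) (u + v) = 0" using assms by (auto simp: isotropic_def vec.subspace_add)
  then show ?thesis using assms two_neq_0 by (simp add: square_add isotropic_def)
qed

lemma isotropic_subset_perp: "isotropic T \<Longrightarrow> T \<subseteq> perp T"
  using isotropic_ortho by (auto simp: perp_def)

lemma isotropic_subset: "isotropic T \<Longrightarrow> S \<subseteq> T \<Longrightarrow> vec.subspace S \<Longrightarrow> isotropic S"
  by (auto simp: isotropic_def)

lemma isotropic_zero: "isotropic {0}"
  by (simp add: isotropic_def subspace_zero)

lemma isotropic_span_insert:
  assumes T: "isotropic T" "v \<in> perp T" "f v v = 0"
  shows "isotropic (vec.span (insert v T))"
proof -
  have "f x x = 0" if x: "x \<in> vec.span (insert v T)" for x
  proof -
    obtain c t where "t \<in> T" "x = c *s v + t"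
      using x mem_span_insert[OF isotropic_subspace[OF T(1)]] by blast
    then show ?thesis using T by (simp add: square_add scale_left scale_right perp_def isotropic_def)
  qed
  then show ?thesis by (simp add: isotropic_def)
qed

text \<open>A linear functional that is nonzero on \<open>P\<close> takes every value equally often:
  a multiple of \<open>v\<close> translates each level set onto the kernel.\<close>

lemma card_level_set:
  fixes P :: "('a^'n) set"
  assumes P: "vec.subspace P" and v: "v \<in> P" "f g v \<noteq> 0"
  shows "real (card {p \<in> P. f g p = c}) = real (card P) / q"
proof -
  have K: "card {p \<in> P. f g p = c} = card {p \<in> P. f g p = 0}" for c
  proof (rule bij_betw_same_card)
    let ?u = "(c / f g v) *s v"
    have u: "?u \<in> P" "f g ?u = c" using v P by (auto simp: scale_right vec.subspace_scale)
    show "bij_betw (\<lambda>p. p - ?u) {p \<in> P. f g p = c} {p \<in> P. f g p = 0}"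
      by (rule bij_betwI[where g = "\<lambda>p. p + ?u"])
        (use u P in \<open>auto simp: diff_right add_right intro: vec.subspace_diff vec.subspace_add\<close>)
  qed
  have e: "card {p \<in> P. f g p = d} = card {p \<in> P. f g p = c}" for d
    by (rule trans[OF K K[symmetric]])
  have "card P = card (\<Union>d. {p \<in> P. f g p = d})" by (rule arg_cong[where f=card]) auto
  also have "\<dots> = (\<Sum>d\<in>UNIV. card {p \<in> P. f g p = d})" by (rule card_UN_disjoint) auto
  also have "\<dots> = (\<Sum>d\<in>(UNIV :: 'a set). card {p \<in> P. f g p = c})" by (rule sum.cong[OF refl e])
  also have "\<dots> = CARD('a) * card {p \<in> P. f g p = c}" by simp
  finally show ?thesis by (simp add: q_eq)
qed

text \<open>Count the orthogonal pairs in \<open>P \<times> T\<close> from both sides: a vector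
  orthogonal to the whole other space has all of it as partners, any other vector exactly a fraction
  \<open>1/q\<close>.\<close>

lemma card_perp:
  assumes P: "vec.subspace P" and T: "vec.subspace T"
  shows "real (card (P \<inter> perp T)) * real (card T) = real (card (T \<inter> perp P)) * real (card P)"
proof -
  have sub: "real (card {(p, t). p \<in> P \<and> t \<in> T \<and> f p t = 0}) =
     real (card (P \<inter> perp T)) * real (card T) + (real (card P) - real (card (P \<inter> perp T))) * (real (card T) / q)"
    if P: "vec.subspace P" and T: "vec.subspace T" for P T
  proof -
    have "{(p, t). p \<in> P \<and> t \<in> T \<and> f p t = 0} = (SIGMA p:P. {t \<in> T. f p t = 0})" by auto
    then have "real (card {(p, t). p \<in> P \<and> t \<in> T \<and> f p t = 0}) = 
      (\<Sum>p\<in>P. real (card {t \<in> T. f p t = 0}))" by simp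
    also have "\<dots> = (\<Sum>p\<in>P \<inter> perp T. real (card {t \<in> T. f p t = 0})) + 
       (\<Sum>p\<in>P - perp T. real (card {t \<in> T. f p t = 0}))"
      by (subst sum.union_disjoint[symmetric]) (auto intro: sum.cong)
    also have "(\<Sum>p\<in>P \<inter> perp T. real (card {t \<in> T. f p t = 0})) = (\<Sum>p\<in>P \<inter> perp T. real (card T))"
      by (intro sum.cong refl arg_cong[where f=real] arg_cong[where f=card]) (auto simp: perp_def)
    also have "(\<Sum>p\<in>P - perp T. real (card {t \<in> T. f p t = 0})) = (\<Sum>p\<in>P - perp T. card T / q)"
      using card_level_set[OF T] by (intro sum.cong refl) (auto simp: perp_def)
    also have "\<dots> = (real (card P) - real (card (P \<inter> perp T))) * (real (card T) / q)"
    proof -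
      have "card (P - perp T) = card P - card (P \<inter> perp T)" by (rule card_Diff_subset_Int) simp
      moreover have "card (P \<inter> perp T) \<le> card P" by (rule card_mono) auto
      ultimately show ?thesis by simp
    qed
    finally show ?thesis by simp
  qed
  have "card {(p, t). p \<in> P \<and> t \<in> T \<and> f p t = 0} = card {(t, p). t \<in> T \<and> p \<in> P \<and> f t p = 0}"
    by (rule bij_betw_same_card[where f="\<lambda>(x,y). (y,x)"])
      (auto simp: bij_betw_def inj_on_def image_iff f_sym)
  then have "real (card (P \<inter> perp T)) * real (card T) + (real (card P) - real (card (P \<inter> perp T))) * (real (card T) / q) =
    real (card (T \<inter> perp P)) * real (card P) + (real (card T) - real (card (T \<inter> perp P))) * (real (card P) / q)"
    using sub[OF P T] sub[OF T P] by simp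
  then have "(q - 1) * (real (card (P \<inter> perp T)) * real (card T)) =
     (q - 1) * (real (card (T \<inter> perp P)) * real (card P))"
    by (rule double_count_balance[OF q_pos])
  then show ?thesis using q_gt_1 by simp
qed

lemma dim_perp:
  assumes P: "vec.subspace P" and T: "vec.subspace T"
  shows "vec.dim (P \<inter> perp T) + vec.dim T = vec.dim (T \<inter> perp P) + vec.dim P"
proof -
  have "q ^ (vec.dim (P \<inter> perp T) + vec.dim T) = q ^ (vec.dim (T \<inter> perp P) + vec.dim P)"
    using card_perp[OF assms] assms
    by (simp add: real_card_subspace vec.subspace_inter subspace_perp power_add)
  then show ?thesis using q_gt_1 by (simp add: power_inject_exp)
qed

text \<open>On a coset \<open>v + T\<close> with \<open>v \<notin> perp T\<close> the form is
  \<open>f v v + 2 f v t\<close>, which is equidistributed, so a fraction \<open>1/q\<close> of each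
  coset is isotropic. The pairs \<open>(v, t)\<close> average this over the cosets.\<close>

lemma card_isotropic_outside_perp:
  assumes P: "vec.subspace P" and T: "isotropic T" "T \<subseteq> P"
  shows "real (card {v \<in> P - perp T. f v v = 0}) = (real (card P) - real (card (P \<inter> perp T))) / q"
proof -
  have TT: "T \<subseteq> perp T" using isotropic_subset_perp T by blast
  have sT: "vec.subspace T" using T isotropic_subspace by blast
  let ?A = "{(v, t). v \<in> P - perp T \<and> t \<in> T \<and> f (v + t) (v + t) = 0}"
  have inv: "v + t \<in> P - perp T \<longleftrightarrow> v \<in> P - perp T" if "t \<in> T" for v t
  proof -
    have "v + t \<in> P \<longleftrightarrow> v \<in> P"
      using that T P by (metis add_diff_cancel_right' subsetD vec.subspace_add vec.subspace_diff)
    moreover have "v + t \<in> perp T \<longleftrightarrow> v \<in> perp T"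
      using that TT by (auto simp: perp_def add_left)
    ultimately show ?thesis by simp
  qed
  have "?A = (SIGMA v:P - perp T. {t \<in> T. f (v + t) (v + t) = 0})" by auto
  then have "real (card ?A) = (\<Sum>v\<in>P - perp T. real (card {t \<in> T. f (v + t) (v + t) = 0}))" by simp
  also have "\<dots> = (\<Sum>v\<in>P - perp T. real (card T) / q)"
  proof (rule sum.cong[OF refl])
    fix v assume v: "v \<in> P - perp T"
    have "f (v + t) (v + t) = 0 \<longleftrightarrow> f v t = - f v v / 2" if "t \<in> T" for t
    proof -
      have "f (v + t) (v + t) = f v v + 2 * f v t" using T that by (simp add: square_add isotropic_def)
      then show ?thesis using two_neq_0 by (simp add: field_simps add_eq_0_iff)
    qed
    then have "{t \<in> T. f (v + t) (v + t) = 0} = {t \<in> T. f v t = - f v v / 2}" by blast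
    moreover obtain t where "t \<in> T" "f v t \<noteq> 0" using v by (auto simp: perp_def)
    ultimately show "real (card {t \<in> T. f (v + t) (v + t) = 0}) = real (card T) / q"
      using card_level_set[OF sT] by auto
  qed
  finally have 1: "real (card ?A) = real (card (P - perp T)) * (real (card T) / q)" by simp
  have "card ?A = card (SIGMA t:T. {v \<in> P - perp T. f v v = 0})"
  proof (rule bij_betw_same_card, rule bij_betwI)
    show "(\<lambda>(v, t). (t, v + t)) \<in> ?A \<rightarrow> (SIGMA t:T. {v \<in> P - perp T. f v v = 0})"
      using inv by auto
    show "(\<lambda>(t, v). (v - t, t)) \<in> (SIGMA t:T. {v \<in> P - perp T. f v v = 0}) \<rightarrow> ?A"
    proof -
      have "v - t \<in> P - perp T" if "t \<in> T" "v \<in> P" "v \<notin> perp T" for t v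
        using inv[of t "v - t"] that by auto
      then show ?thesis by auto
    qed
  qed auto
  also have "\<dots> = card T * card {v \<in> P - perp T. f v v = 0}" by simp
  finally have "real (card T) * real (card {v \<in> P - perp T. f v v = 0}) = 
     real (card (P - perp T)) * (real (card T) / q)" using 1 by simp
  moreover have "card T > 0" using sT by (auto simp: card_gt_0_iff vec.subspace_def)
  moreover have "real (card (P - perp T)) = real (card P) - real (card (P \<inter> perp T))"
    by (subst card_Diff_subset_Int) (auto intro!: of_nat_diff card_mono)
  ultimately have "real (card T) * real (card {v \<in> P - perp T. f v v = 0}) =
     real (card T) * ((real (card P) - real (card (P \<inter> perp T))) / q)" by (simp add: mult.commute)
  then show ?thesis using \<open>card T > 0\<close> by (simp only: mult_cancel_left) auto
qed

lemma isotropic_count_perp: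
  assumes P: "vec.subspace P" and T: "isotropic T" "T \<subseteq> P"
  shows "isotropic_count P = isotropic_count (P \<inter> perp T) + (real (card P) - real (card (P \<inter> perp T))) / q"
proof -
  have "{v \<in> P. f v v = 0} = {v \<in> P \<inter> perp T. f v v = 0} \<union> {v \<in> P - perp T. f v v = 0}" by auto
  moreover have "card ({v \<in> P \<inter> perp T. f v v = 0} \<union> {v \<in> P - perp T. f v v = 0}) =
     card {v \<in> P \<inter> perp T. f v v = 0} + card {v \<in> P - perp T. f v v = 0}"
    by (rule card_Un_disjoint) auto
  ultimately show ?thesis using card_isotropic_outside_perp[OF assms] by (simp add: isotropic_count_def)
qed

text \<open>Outside \<open>perp T\<close> the proportion of isotropic vectors is exactly the
  \<open>1/q\<close> that \<open>zeta\<close> subtracts.\<close>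

lemma zeta_perp_iso:
  assumes "vec.subspace P" "isotropic T" "T \<subseteq> P"
  shows "zeta (P \<inter> perp T) = zeta P"
  using isotropic_count_perp[OF assms] q_pos by (simp add: zeta_def diff_divide_distrib)

text \<open>The Moebius function \<open>(-1)^s q^(s choose 2)\<close> of the lattice of subspaces.\<close>

primrec moebius :: "nat \<Rightarrow> real" where
  "moebius 0 = 1"
| "moebius (Suc s) = - (q ^ s) * moebius s"

definition isotropics :: "('a^'n) set \<Rightarrow> ('a^'n) set \<Rightarrow> ('a^'n) set set" where
  "isotropics P W = {T. isotropic T \<and> T \<subseteq> P \<and> T \<inter> W = {0}}"

text \<open>The generating function written \<open>\<Phi> P x\<close> in the overview.\<close>

definition isotropic_sum :: "('a^'n) set \<Rightarrow> ('a^'n) set \<Rightarrow> real \<Rightarrow> real" where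
  "isotropic_sum P W x = (\<Sum>T\<in>isotropics P W. moebius (vec.dim T) * x ^ vec.dim T)"

lemma isotropics_mono: "H \<subseteq> P \<Longrightarrow> isotropics H W \<subseteq> isotropics P W"
  by (auto simp: isotropics_def)

lemma dim_Int_hyperplane:
  fixes P H T :: "('a^'n) set"
  assumes "vec.subspace P" "vec.subspace H" "H \<subseteq> P" "vec.dim P = Suc (vec.dim H)"
    and "vec.subspace T" "T \<subseteq> P" "\<not> T \<subseteq> H"
  shows "vec.dim T = Suc (vec.dim (T \<inter> H))"
proof -
  have s: "vec.span (T \<union> H) \<subseteq> P" using assms by (intro vec.span_minimal) auto
  have "H \<subseteq> vec.span (T \<union> H)" "T \<subseteq> vec.span (T \<union> H)"
    using vec.span_superset[of "T \<union> H"] by auto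
  then have "H \<subset> vec.span (T \<union> H)" using assms(7) by blast
  then have "vec.dim H < vec.dim (vec.span (T \<union> H))"
    using assms(2) by (metis vec.dim_psubset vec.span_eq_iff vec.span_span)
  moreover have "vec.dim (vec.span (T \<union> H)) \<le> vec.dim P" using s by (rule vec.dim_subset)
  ultimately show ?thesis using dim_span_Un[OF assms(5,2)] assms(4) by simp
qed

text \<open>Pairs \<open>(T, v)\<close> with \<open>v \<in> T - H\<close> correspond to pairs
  \<open>(S, v)\<close> by \<open>S = T \<inter> H\<close> and \<open>T = S + <v>\<close>, where
  \<open>v\<close> is isotropic, orthogonal to \<open>S\<close> and outside \<open>H\<close>. Each
  \<open>T\<close> occurs with \<open>q^(s+1) - q^s\<close> vectors \<open>v\<close>,
  \<open>s\<close> being the dimension of \<open>S\<close>.\<close>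

lemma sum_isotropics_hyperplane:
  fixes g :: "nat \<Rightarrow> real"
  assumes P: "vec.subspace P" and H: "vec.subspace H" "H \<subseteq> P" "vec.dim P = Suc (vec.dim H)"
    and W: "W \<subseteq> H"
  shows "(\<Sum>T\<in>isotropics P W - isotropics H W. g (vec.dim T)) =
    (\<Sum>T\<in>isotropics H W. g (Suc (vec.dim T)) * real (card {v \<in> P \<inter> perp T - H. f v v = 0})
                    / (q ^ Suc (vec.dim T) - q ^ vec.dim T))"
proof -
  let ?c = "\<lambda>s. q ^ Suc s - q ^ s"
  let ?N = "\<lambda>T. {v \<in> P \<inter> perp T - H. f v v = 0}"
  have c: "?c s \<noteq> 0" for s using q_gt_1 by simp
  have A: "isotropic T" "T \<subseteq> P" "T \<inter> W = {0}" "\<not> T \<subseteq> H" "vec.subspace T"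
    "vec.dim T = Suc (vec.dim (T \<inter> H))" "vec.subspace (T \<inter> H)"
    if "T \<in> isotropics P W - isotropics H W" for T
  proof -
    show *: "isotropic T" "T \<subseteq> P" "T \<inter> W = {0}" "\<not> T \<subseteq> H" using that by (auto simp: isotropics_def)
    then show **: "vec.subspace T" by (simp add: isotropic_subspace)
    show "vec.dim T = Suc (vec.dim (T \<inter> H))" by (rule dim_Int_hyperplane[OF P H ** *(2,4)])
    show "vec.subspace (T \<inter> H)" using ** H by (simp add: vec.subspace_inter)
  qed
  have "(\<Sum>T\<in>isotropics P W - isotropics H W. g (vec.dim T)) =
    (\<Sum>T\<in>isotropics P W - isotropics H W. \<Sum>v\<in>T - H. g (vec.dim T) / ?c (vec.dim T - 1))"
  proof (rule sum.cong[OF refl])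
    fix T assume T: "T \<in> isotropics P W - isotropics H W"
    note a = A[OF T]
    have "real (card (T - H)) = real (card T) - real (card (T \<inter> H))"
      by (subst card_Diff_subset_Int) (auto intro!: of_nat_diff card_mono)
    also have "\<dots> = ?c (vec.dim T - 1)" using a by (simp add: real_card_subspace)
    finally show "g (vec.dim T) = (\<Sum>v\<in>T - H. g (vec.dim T) / ?c (vec.dim T - 1))"
      using c[of "vec.dim T - 1"] by simp
  qed
  also have "\<dots> = (\<Sum>(T, v)\<in>(SIGMA T:isotropics P W - isotropics H W. T - H). g (vec.dim T) / ?c (vec.dim T - 1))"
    by (rule sum.Sigma) auto
  also have "\<dots> = (\<Sum>(S, v)\<in>(SIGMA S:isotropics H W. ?N S). g (Suc (vec.dim S)) / ?c (vec.dim S))"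
  proof (rule sum.reindex_bij_witness[where i = "\<lambda>(S, v). (vec.span (insert v S), v)"
          and j = "\<lambda>(T, v). (T \<inter> H, v)"])
    fix a assume "a \<in> (SIGMA T:isotropics P W - isotropics H W. T - H)"
    then obtain T v where a: "a = (T, v)" and T: "T \<in> isotropics P W - isotropics H W" and v: "v \<in> T - H" by auto
    note t = A[OF T]
    have "vec.span (insert v (T \<inter> H)) = T"
    proof (rule vec.subspace_dim_equal)
      show "vec.span (insert v (T \<inter> H)) \<subseteq> T" using v t by (subst span_insert_subset_iff) auto
      show "vec.dim T \<le> vec.dim (vec.span (insert v (T \<inter> H)))"
        using v t by (subst dim_span_insert) auto
    qed (use t in auto)
    then show "(case (case a of (T, v) \<Rightarrow> (T \<inter> H, v)) of (S, v) \<Rightarrow> (vec.span (insert v S), v)) = a"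
      by (simp add: a)
    have "isotropic (T \<inter> H)" by (rule isotropic_subset[OF t(1)]) (use t in auto)
    moreover have "T \<inter> H \<inter> W = {0}" using t W by auto
    moreover have "v \<in> ?N (T \<inter> H)"
      using v t isotropic_subset_perp[OF t(1)] perp_antimono[of "T \<inter> H" T] by (auto simp: isotropic_def)
    ultimately show "(case a of (T, v) \<Rightarrow> (T \<inter> H, v)) \<in> (SIGMA S:isotropics H W. ?N S)"
      by (auto simp: a isotropics_def)
    show "(case (case a of (T, v) \<Rightarrow> (T \<inter> H, v)) of (S, v) \<Rightarrow> g (Suc (vec.dim S)) / ?c (vec.dim S)) =
        (case a of (T, v) \<Rightarrow> g (vec.dim T) / ?c (vec.dim T - 1))"
      using t by (simp add: a)
  next
    fix b assume "b \<in> (SIGMA S:isotropics H W. ?N S)"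
    then obtain S v where b: "b = (S, v)" and S: "S \<in> isotropics H W" and v: "v \<in> ?N S" by auto
    have s: "isotropic S" "S \<subseteq> H" "S \<inter> W = {0}" "vec.subspace S"
      using S by (auto simp: isotropics_def isotropic_subspace)
    let ?T = "vec.span (insert v S)"
    \<comment> \<open>Since \<open>v \<notin> H\<close>, adjoining it does not enlarge the trace on
      \<open>H\<close>.\<close>
    have int: "?T \<inter> H = S"
    proof (intro equalityI subsetI)
      fix x assume x: "x \<in> ?T \<inter> H"
      then obtain k t where kt: "t \<in> S" "x = k *s v + t" using mem_span_insert[OF s(4)] by blast
      have "k = 0"
      proof (rule ccontr)
        assume k: "k \<noteq> 0"
        have "x - t \<in> H" using x kt s H by (blast intro: vec.subspace_diff)
        then have kv: "k *s v \<in> H" using kt by simp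
        have "inverse k *s (k *s v) \<in> H" by (rule vec.subspace_scale[OF H(1) kv])
        then show False unfolding vec.scale_scale using k v by simp
      qed
      then show "x \<in> S" using kt by simp
    next
      fix x assume "x \<in> S"
      then show "x \<in> ?T \<inter> H" using s by (auto intro: vec.span_base)
    qed
    then show "(case (case b of (S, v) \<Rightarrow> (vec.span (insert v S), v)) of (T, v) \<Rightarrow> (T \<inter> H, v)) = b"
      by (simp add: b)
    have "isotropic ?T" using s v by (intro isotropic_span_insert) auto
    moreover have "?T \<subseteq> P" using s v H P by (subst span_insert_subset_iff) auto
    moreover have "?T \<inter> W = {0}"
    proof -
      have "?T \<inter> W = ?T \<inter> H \<inter> W" using W by blast
      then show ?thesis using int s by simp
    qed
    moreover have "v \<in> ?T" by (simp add: vec.span_base)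
    ultimately show "(case b of (S, v) \<Rightarrow> (vec.span (insert v S), v)) \<in>
        (SIGMA T:isotropics P W - isotropics H W. T - H)" using v by (auto simp: b isotropics_def)
  qed
  also have "\<dots> = (\<Sum>S\<in>isotropics H W. \<Sum>v\<in>?N S. g (Suc (vec.dim S)) / ?c (vec.dim S))"
    by (rule sum.Sigma[symmetric]) auto
  also have "\<dots> = (\<Sum>T\<in>isotropics H W. g (Suc (vec.dim T)) * real (card (?N T)) / ?c (vec.dim T))"
    by (simp add: mult_ac)
  finally show ?thesis .
qed

lemma real_card_perp:
  assumes P: "vec.subspace P" and T: "vec.subspace T" and "T \<inter> perp P = {0}"
  shows "real (card (P \<inter> perp T)) = q ^ vec.dim P / q ^ vec.dim T"
proof -
  have "q ^ vec.dim T \<noteq> 0" using q_gt_1 by simp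
  then show ?thesis using card_perp[OF P T] assms
    by (simp add: real_card_subspace nonzero_eq_divide_eq)
qed

text \<open>The number of extending vectors of \<open>T\<close> depends on \<open>dim T\<close>
  only: the \<open>zeta\<close> part is the same for all \<open>T\<close>, and the cardinality part
  is controlled because \<open>T\<close> avoids both radicals. These two parts produce the terms at
  \<open>x\<close> and at \<open>x / q\<close>.\<close>

lemma isotropic_sum_hyperplane:
  assumes P: "vec.subspace P" and H: "vec.subspace H" "H \<subseteq> P" "vec.dim P = Suc (vec.dim H)"
    and W: "W \<subseteq> H" and rP: "P \<inter> perp P \<subseteq> W" and rH: "H \<inter> perp H \<subseteq> W"
  shows "isotropic_sum P W x = (1 - (zeta P - zeta H) / (q - 1) * x) * isotropic_sum H W x
     - x * (q ^ vec.dim H / q) * isotropic_sum H W (x / q)"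
proof -
  let ?h = "q ^ vec.dim H"
  define \<nu> where "\<nu> = (zeta P - zeta H) / (q - 1)"
  have summand: "moebius (Suc (vec.dim T)) * x ^ Suc (vec.dim T) *
       real (card {v \<in> P \<inter> perp T - H. f v v = 0}) / (q ^ Suc (vec.dim T) - q ^ vec.dim T) =
      - (\<nu> * x) * (moebius (vec.dim T) * x ^ vec.dim T) -
      x * (?h / q) * (moebius (vec.dim T) * (x / q) ^ vec.dim T)" if "T \<in> isotropics H W" for T
  proof -
    let ?s = "vec.dim T"
    have T: "isotropic T" "T \<subseteq> H" "T \<inter> W = {0}" "vec.subspace T" "T \<subseteq> P"
      using that H by (auto simp: isotropics_def isotropic_subspace)
    have z: "0 \<in> T" "0 \<in> perp P" "0 \<in> perp H" using T by (auto simp: vec.subspace_0 perp_def)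
    \<comment> \<open>A common vector lies in a radical, hence in \<open>W\<close>, which meets
      \<open>T\<close> trivially.\<close>
    have tP: "T \<inter> perp P = {0}" and tH: "T \<inter> perp H = {0}" using T rP rH z by auto
    have "{v \<in> P \<inter> perp T. f v v = 0} =
       {v \<in> P \<inter> perp T - H. f v v = 0} \<union> {v \<in> H \<inter> perp T. f v v = 0}" using H by auto
    moreover have "card ({v \<in> P \<inter> perp T - H. f v v = 0} \<union> {v \<in> H \<inter> perp T. f v v = 0}) =
       card {v \<in> P \<inter> perp T - H. f v v = 0} + card {v \<in> H \<inter> perp T. f v v = 0}"
      by (rule card_Un_disjoint) auto
    ultimately have "real (card {v \<in> P \<inter> perp T - H. f v v = 0}) = isotropic_count (P \<inter> perp T) - isotropic_count (H \<inter> perp T)"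
      by (simp add: isotropic_count_def)
    also have "\<dots> = zeta (P \<inter> perp T) - zeta (H \<inter> perp T) +
        (real (card (P \<inter> perp T)) - real (card (H \<inter> perp T))) / q"
      by (simp add: zeta_def diff_divide_distrib)
    also have "\<dots> = zeta P - zeta H + (q * ?h / q ^ ?s - ?h / q ^ ?s) / q"
      using zeta_perp_iso[OF P T(1,5)] zeta_perp_iso[OF H(1) T(1,2)]
        real_card_perp[OF P T(4) tP] real_card_perp[OF H(1) T(4) tH] H by simp
    also have "zeta P - zeta H = \<nu> * (q - 1)" using q_gt_1 by (simp add: \<nu>_def)
    also have "(q * ?h / q ^ ?s - ?h / q ^ ?s) / q = (q - 1) * (?h / q / q ^ ?s)"
      using q_gt_1 by (simp add: divide_simps) (simp add: algebra_simps)
    finally have N: "real (card {v \<in> P \<inter> perp T - H. f v v = 0}) =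
       (q - 1) * (\<nu> + ?h / q / q ^ ?s)" by (simp only: ring_distribs mult.commute)
    have D: "q ^ Suc ?s - q ^ ?s = (q - 1) * q ^ ?s" by (simp add: algebra_simps)
    show ?thesis unfolding N D using q_gt_1 by (simp add: power_divide field_simps)
  qed
  have "isotropic_sum P W x = isotropic_sum H W x + (\<Sum>T\<in>isotropics P W - isotropics H W. moebius (vec.dim T) * x ^ vec.dim T)"
    unfolding isotropic_sum_def using isotropics_mono[OF H(2)] by (subst sum.subset_diff[of "isotropics H W"]) auto
  also have "(\<Sum>T\<in>isotropics P W - isotropics H W. moebius (vec.dim T) * x ^ vec.dim T) =
     (\<Sum>T\<in>isotropics H W. - (\<nu> * x) * (moebius (vec.dim T) * x ^ vec.dim T) -
      x * (?h / q) * (moebius (vec.dim T) * (x / q) ^ vec.dim T))"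
    using sum_isotropics_hyperplane[OF P H W, of "\<lambda>t. moebius t * x ^ t"] summand by simp
  also have "\<dots> = - (\<nu> * x) * isotropic_sum H W x - x * (?h / q) * isotropic_sum H W (x / q)"
    by (simp only: sum_subtractf isotropic_sum_def sum_distrib_left)
  finally show ?thesis by (simp add: \<nu>_def algebra_simps)
qed

section \<open>Counting isotropic vectors\<close>

definition max_iso :: "('a^'n) set \<Rightarrow> ('a^'n) set \<Rightarrow> bool" where
  "max_iso P T \<longleftrightarrow> isotropic T \<and> T \<subseteq> P \<and> (\<forall>S. isotropic S \<longrightarrow> S \<subseteq> P \<longrightarrow> vec.dim S \<le> vec.dim T)"

lemma ex_max_iso:
  assumes "vec.subspace P"
  obtains T where "max_iso P T"
proof -
  let ?D = "vec.dim ` {T. isotropic T \<and> T \<subseteq> P}"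
  have "{0} \<in> {T. isotropic T \<and> T \<subseteq> P}" using assms by (simp add: isotropic_zero vec.subspace_0)
  then have "Max ?D \<in> ?D" by (intro Max_in) auto
  then obtain T where "isotropic T" "T \<subseteq> P" "vec.dim T = Max ?D" by auto
  then have "max_iso P T" by (auto simp: max_iso_def intro!: Max_ge)
  then show ?thesis by (rule that)
qed

lemma max_iso_isotropic:
  assumes "max_iso P T" "v \<in> P" "v \<in> perp T" "f v v = 0" and P: "vec.subspace P"
  shows "v \<in> T"
proof (rule ccontr)
  assume v: "v \<notin> T"
  have T: "isotropic T" "T \<subseteq> P" "vec.subspace T" using assms by (auto simp: max_iso_def isotropic_subspace)
  have "isotropic (vec.span (insert v T))" using assms T by (intro isotropic_span_insert) auto
  moreover have "vec.span (insert v T) \<subseteq> P" using T assms by (subst span_insert_subset_iff) auto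
  ultimately have "vec.dim (vec.span (insert v T)) \<le> vec.dim T" using assms by (auto simp: max_iso_def)
  then show False using dim_span_insert[OF T(3) v] by simp
qed

text \<open>Radical vectors are isotropic and orthogonal to \<open>T\<close>, so maximality puts
  them into \<open>T\<close>.\<close>

lemma max_iso_Int_perp:
  assumes "max_iso P T" and P: "vec.subspace P"
  shows "T \<inter> perp P = P \<inter> perp P"
proof -
  have "T \<subseteq> P" using assms by (simp add: max_iso_def)
  moreover from this have "P \<inter> perp P \<subseteq> T"
    using max_iso_isotropic[OF assms(1) _ _ _ P] by (auto simp: perp_def)
  ultimately show ?thesis by blast
qed

lemma dim_Int_perp_singleton:
  assumes "vec.subspace A"
  shows "vec.dim A \<le> Suc (vec.dim (A \<inter> perp {g}))"
proof -
  have "vec.dim (vec.span {g}) \<le> 1" using vec.dim_le_card'[of "{g}"] by simp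
  then show ?thesis
    using dim_perp[OF assms vec.subspace_span[of "{g}"]] by (simp add: perp_singleton_span)
qed

text \<open>Modulo \<open>T\<close> the space \<open>P \<inter> perp T\<close> has no nonzero
  isotropic vectors. Over a finite field of odd order such a space has dimension at most 2.\<close>

lemma max_iso_dim:
  assumes T: "max_iso P T" and P: "vec.subspace P"
  shows "2 * vec.dim T \<le> vec.dim P + vec.dim (P \<inter> perp P)"
    and "vec.dim P + vec.dim (P \<inter> perp P) \<le> 2 * vec.dim T + 2"
proof -
  let ?A = "P \<inter> perp T"
  have t: "isotropic T" "T \<subseteq> P" "vec.subspace T" using T by (auto simp: max_iso_def isotropic_subspace)
  have A: "vec.subspace ?A" using P by (simp add: vec.subspace_inter subspace_perp)
  have d: "vec.dim ?A + vec.dim T = vec.dim (P \<inter> perp P) + vec.dim P"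
    using dim_perp[OF P t(3)] max_iso_Int_perp[OF T P] by simp
  have "T \<subseteq> ?A" using t isotropic_subset_perp by blast
  then have "vec.dim T \<le> vec.dim ?A" by (rule vec.dim_subset)
  then show "2 * vec.dim T \<le> vec.dim P + vec.dim (P \<inter> perp P)" using d by simp
  have aniso: "f v v \<noteq> 0" if "v \<in> ?A - T" for v using max_iso_isotropic[OF T _ _ _ P] that by auto
  have out: "\<exists>v. v \<in> B - T" if "vec.dim T < vec.dim B" for B
  proof (rule ccontr)
    assume "\<not> ?thesis"
    then have "B \<subseteq> T" by blast
    then have "vec.dim B \<le> vec.dim T" by (rule vec.dim_subset)
    then show False using that by simp
  qed
  have "vec.dim ?A \<le> vec.dim T + 2"
  proof (rule ccontr)
    assume big: "\<not> vec.dim ?A \<le> vec.dim T + 2"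
    \<comment> \<open>Each orthogonality condition costs at most one dimension, so three mutually
      orthogonal vectors outside \<open>T\<close> can be chosen; a combination of them, with
      coefficient 1 at \<open>w\<close>, is isotropic.\<close>
    obtain u where u: "u \<in> ?A - T" using out[of ?A] big by auto
    let ?B = "?A \<inter> perp {u}"
    have B: "vec.subspace ?B" using A by (simp add: vec.subspace_inter subspace_perp)
    have dB: "vec.dim ?B > vec.dim T + 1" using dim_Int_perp_singleton[OF A, of u] big by simp
    obtain v where v: "v \<in> ?B - T" using out[of ?B] dB by auto
    have "vec.dim (?B \<inter> perp {v}) > vec.dim T" using dim_Int_perp_singleton[OF B, of v] dB by simp
    then obtain w where w: "w \<in> ?B \<inter> perp {v} - T" using out by blast
    have n: "f u u \<noteq> 0" "f v v \<noteq> 0" "f w w \<noteq> 0" using aniso[of u] aniso[of v] aniso[of w] u v w by auto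
    have o: "f v u = 0" "f w u = 0" "f w v = 0"
      using v w by (auto simp: perp_def)
    then have o': "f u v = 0" "f u w = 0" "f v w = 0"
      using f_sym[of u v] f_sym[of u w] f_sym[of v w] by simp_all
    obtain x y where xy: "f u u * (x * x) + f v v * (y * y) + f w w = 0"
      using sum_of_two_scaled_squares[OF two_neq_0 n(1,2)] by blast
    let ?z = "x *s u + y *s v + w"
    have "f ?z ?z = 0" using xy o o' by (simp add: add_left add_right scale_left scale_right algebra_simps)
    moreover have "?z \<in> ?A"
    proof -
      have "u \<in> ?A" "v \<in> ?A" "w \<in> ?A" using u v w by blast+
      then show ?thesis by (intro vec.subspace_add[OF A] vec.subspace_scale[OF A])
    qed
    \<comment> \<open>Maximality forces \<open>?z\<close> into \<open>T\<close>, to which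
      \<open>w\<close> is orthogonal, although \<open>f w ?z = f w w\<close> is nonzero.\<close>
    ultimately have z: "?z \<in> T" using aniso by blast
    have "f w ?z = f w w" using o by (simp add: add_right scale_right)
    moreover have "f w ?z = 0" using w z by (auto simp: perp_def)
    ultimately show False using n by simp
  qed
  then show "vec.dim P + vec.dim (P \<inter> perp P) \<le> 2 * vec.dim T + 2" using d by simp
qed

text \<open>Inside \<open>P \<inter> perp T\<close> the isotropic vectors are exactly those of
  \<open>T\<close>, and \<open>zeta\<close> does not change on passing there.\<close>

lemma zeta_max_iso:
  assumes T: "max_iso P T" and P: "vec.subspace P"
  shows "zeta P = q ^ vec.dim T - q ^ (vec.dim P + vec.dim (P \<inter> perp P)) / q ^ Suc (vec.dim T)"
proof -
  let ?A = "P \<inter> perp T"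
  have t: "isotropic T" "T \<subseteq> P" "vec.subspace T" using T by (auto simp: max_iso_def isotropic_subspace)
  have "{v \<in> ?A. f v v = 0} = T"
    using max_iso_isotropic[OF T _ _ _ P] t isotropic_subset_perp[OF t(1)] by (auto simp: isotropic_def)
  then have "isotropic_count ?A = q ^ vec.dim T" using t by (simp add: isotropic_count_def real_card_subspace)
  moreover have "real (card ?A) * q ^ vec.dim T = q ^ (vec.dim P + vec.dim (P \<inter> perp P))"
    using card_perp[OF P t(3)] max_iso_Int_perp[OF T P] t P
    by (simp add: real_card_subspace vec.subspace_inter subspace_perp power_add mult.commute)
  then have "real (card ?A) = q ^ (vec.dim P + vec.dim (P \<inter> perp P)) / q ^ vec.dim T"
    using q_gt_1 by (subst nonzero_eq_divide_eq) auto
  ultimately have "zeta ?A = q ^ vec.dim T - q ^ (vec.dim P + vec.dim (P \<inter> perp P)) / q ^ Suc (vec.dim T)"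
    by (simp add: zeta_def)
  then show ?thesis using zeta_perp_iso[OF P t(1,2)] by simp
qed

text \<open>Parity leaves only the middle value \<open>2 dim T + 1\<close> between the two bounds,
  and then the two terms of \<open>zeta_max_iso\<close> cancel.\<close>

lemma zeta_odd:
  assumes P: "vec.subspace P" and "odd (vec.dim P + vec.dim (P \<inter> perp P))"
  shows "zeta P = 0"
proof -
  obtain T where T: "max_iso P T" using ex_max_iso[OF P] .
  have "vec.dim P + vec.dim (P \<inter> perp P) = Suc (2 * vec.dim T)"
    using odd_between max_iso_dim[OF T P] assms(2) by blast
  then show ?thesis using zeta_max_iso[OF T P] q_gt_1 by (simp add: power_add mult_2)
qed

text \<open>The two possible values of \<open>dim T\<close> give values of \<open>zeta\<close> that
  differ only in sign.\<close>

lemma zeta_even_square: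
  assumes P: "vec.subspace P" and "even (vec.dim P + vec.dim (P \<inter> perp P))"
  shows "(zeta P)\<^sup>2 = (q - 1)\<^sup>2 * q ^ (vec.dim P + vec.dim (P \<inter> perp P)) / q\<^sup>2"
proof -
  obtain T where T: "max_iso P T" using ex_max_iso[OF P] .
  consider "vec.dim P + vec.dim (P \<inter> perp P) = 2 * vec.dim T"
    | "vec.dim P + vec.dim (P \<inter> perp P) = 2 * vec.dim T + 2"
    using even_between max_iso_dim[OF T P] assms(2) by blast
  then show ?thesis
  proof cases
    case 1
    have "zeta P = q ^ vec.dim T * (1 - 1 / q)"
      using zeta_max_iso[OF T P] 1 q_gt_1 by (simp add: mult_2 power_add right_diff_distrib)
    also have "1 - 1 / q = (q - 1) / q" using q_gt_1 by (simp add: diff_divide_distrib)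
    finally show ?thesis unfolding 1 by (simp add: power_mult_distrib power_divide mult.commute flip: power_mult)
  next
    case 2
    have "zeta P = q ^ vec.dim T * (1 - q)"
      using zeta_max_iso[OF T P] 2 q_gt_1 by (simp add: mult_2 power_add right_diff_distrib)
    then have "(zeta P)\<^sup>2 = (q ^ vec.dim T)\<^sup>2 * (q - 1)\<^sup>2"
      by (simp add: power_mult_distrib power2_commute)
    then show ?thesis unfolding 2 using q_gt_1 by (simp add: power_add power_even_eq power2_eq_square[of q])
  qed
qed

section \<open>Alternating sums over isotropic subspaces\<close>

text \<open>The sum \<open>E P\<close> of the overview. Every subspace meets \<open>{0}\<close> in
  \<open>{0}\<close>, so all totally isotropic subspaces of \<open>P\<close> enter.\<close>

definition euler_sum :: "('a^'n) set \<Rightarrow> real" where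
  "euler_sum P = (\<Sum>T\<in>isotropics P {0}. moebius (vec.dim T))"

text \<open>Exchange the summations. An isotropic subspace of a complement meets \<open>W\<close>
  trivially, and \<open>q^(j(p-j-t)) = q^(j(p-j)) (1/q^j)^t\<close> complements contain a given one
  of dimension \<open>t\<close>, where \<open>p = dim P\<close>.\<close>

lemma sum_euler_complements:
  assumes W: "vec.subspace W" "W \<subseteq> P" and P: "vec.subspace P"
  shows "(\<Sum>S\<in>complements W P. euler_sum S) =
    q ^ (vec.dim W * (vec.dim P - vec.dim W)) * isotropic_sum P W (1 / q ^ vec.dim W)"
proof -
  let ?j = "vec.dim W" and ?p = "vec.dim P"
  have "isotropics S {0} = {T \<in> isotropics P W. T \<subseteq> S}" if "S \<in> complements W P" for S
    using that by (auto simp: isotropics_def complements_def isotropic_def vec.subspace_0)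
  then have "(\<Sum>S\<in>complements W P. euler_sum S) =
      (\<Sum>S\<in>complements W P. \<Sum>T\<in>{T \<in> isotropics P W. T \<subseteq> S}. moebius (vec.dim T))"
    by (simp add: euler_sum_def)
  also have "\<dots> = (\<Sum>T\<in>isotropics P W. \<Sum>S\<in>{S \<in> complements W P. T \<subseteq> S}. moebius (vec.dim T))"
    by (rule sum.swap_restrict) auto
  also have "\<dots> = (\<Sum>T\<in>isotropics P W. q ^ (?j * (?p - ?j)) * (moebius (vec.dim T) * (1 / q ^ ?j) ^ vec.dim T))"
  proof (rule sum.cong[OF refl])
    fix T assume "T \<in> isotropics P W"
    then have T: "vec.subspace T" "T \<subseteq> P" "T \<inter> W = {0}" by (auto simp: isotropics_def isotropic_subspace)
    have "vec.dim (vec.span (T \<union> W)) = vec.dim T + ?j" using dim_span_Un[OF T(1) W(1)] T by simp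
    moreover have "vec.span (T \<union> W) \<subseteq> P" using T W P by (intro vec.span_minimal) auto
    ultimately have "vec.dim T + ?j \<le> ?p" by (metis vec.dim_subset)
    then have e: "?j * (?p - ?j) = ?j * (?p - ?j - vec.dim T) + ?j * vec.dim T"
      by (simp flip: distrib_left)
    have "real (card {S \<in> complements W P. T \<subseteq> S}) = q ^ (?j * (?p - ?j - vec.dim T))"
      using card_complements_above[OF W P T] by (simp add: q_eq)
    also have "\<dots> = q ^ (?j * (?p - ?j)) * (1 / q ^ ?j) ^ vec.dim T"
      unfolding e using q_gt_1 by (simp add: power_add power_divide flip: power_mult)
    finally show "(\<Sum>S\<in>{S \<in> complements W P. T \<subseteq> S}. moebius (vec.dim T)) =
        q ^ (?j * (?p - ?j)) * (moebius (vec.dim T) * (1 / q ^ ?j) ^ vec.dim T)" by simp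
  qed
  finally show ?thesis by (simp add: isotropic_sum_def sum_distrib_left)
qed

text \<open>The totally isotropic subspaces \<open>T\<close> with \<open>w \<notin> T\<close> and \<open>T + \<langle>w\<rangle> = U\<close> are the complements of \<open>w\<close> in \<open>U\<close>; their
  weights cancel that of \<open>U\<close>.\<close>

lemma euler_sum_degenerate:
  assumes P: "vec.subspace P" and w: "w \<in> P" "w \<in> perp P" "w \<noteq> 0"
  shows "euler_sum P = 0"
proof -
  let ?L = "vec.span {w}"
  let ?A = "{T \<in> isotropics P {0}. w \<notin> T}" and ?B = "{T \<in> isotropics P {0}. w \<in> T}"
  let ?g = "\<lambda>T. vec.span (insert w T)"
  have L: "vec.subspace ?L" "vec.dim ?L = 1" using w by (simp_all add: vec.dim_insert)
  have ww: "f w w = 0" using w by (auto simp: perp_def)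
  have wT: "w \<in> perp T" if "T \<subseteq> P" for T using that w by (auto simp: perp_def)
  have gA: "?g T \<in> ?B" if T: "T \<in> ?A" for T
  proof -
    have "isotropic T" "T \<subseteq> P" using T by (auto simp: isotropics_def)
    then have "isotropic (?g T)" "?g T \<subseteq> P" using wT ww P w
      by (auto intro: isotropic_span_insert simp: span_insert_subset_iff)
    moreover have "w \<in> ?g T" by (simp add: vec.span_base)
    ultimately show ?thesis by (auto simp: isotropics_def isotropic_def vec.subspace_0)
  qed
  have fib: "{T \<in> ?A. ?g T = U} = complements ?L U" if U: "U \<in> ?B" for U
  proof -
    have u: "isotropic U" "U \<subseteq> P" "w \<in> U" "vec.subspace U" using U by (auto simp: isotropics_def isotropic_subspace)
    show ?thesis
    proof (intro equalityI subsetI)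
      fix T assume "T \<in> {T \<in> ?A. ?g T = U}"
      then have t: "vec.subspace T" "w \<notin> T" "?g T = U" by (auto simp: isotropics_def isotropic_subspace)
      have "T \<subseteq> U" using t by (metis span_insert_subset_iff subset_refl u(4))
      moreover have "T \<inter> ?L = {0}"
      proof -
        have "x = 0" if x: "x \<in> T" "x \<in> ?L" for x
        proof -
          obtain k where k: "x = k *s w" using x by (auto simp: vec.span_singleton)
          have "k = 0"
          proof (rule ccontr)
            assume "k \<noteq> 0"
            have kw: "k *s w \<in> T" using x k by simp
            have "inverse k *s (k *s w) \<in> T" by (rule vec.subspace_scale[OF t(1) kw])
            then show False unfolding vec.scale_scale using \<open>k \<noteq> 0\<close> t by simp
          qed
          then show ?thesis using k by simp
        qed
        then show ?thesis using t L by (auto simp: vec.subspace_0)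
      qed
      moreover have "vec.dim T + vec.dim ?L = vec.dim U"
        using dim_span_insert[OF t(1,2)] t(3) L by simp
      ultimately show "T \<in> complements ?L U" using t by (auto simp: complements_def)
    next
      fix T assume "T \<in> complements ?L U"
      then have t: "vec.subspace T" "T \<subseteq> U" "T \<inter> ?L = {0}" "vec.dim T + 1 = vec.dim U"
        using L by (auto simp: complements_def)
      have "w \<in> ?L" by (simp add: vec.span_base)
      then have wn: "w \<notin> T" using t w by auto
      have "?g T = U"
      proof (rule vec.subspace_dim_equal)
        show "?g T \<subseteq> U" using t u by (subst span_insert_subset_iff) auto
        show "vec.dim U \<le> vec.dim (?g T)" using dim_span_insert[OF t(1) wn] t by simp
      qed (use u in auto)
      moreover have "isotropic T" using isotropic_subset[OF u(1) t(2,1)] .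
      ultimately show "T \<in> {T \<in> ?A. ?g T = U}"
        using wn t u by (auto simp: isotropics_def vec.subspace_0)
    qed
  qed
  have "(\<Sum>T\<in>?A. moebius (vec.dim T)) = (\<Sum>U\<in>?B. \<Sum>T\<in>{T \<in> ?A. ?g T = U}. moebius (vec.dim T))"
    by (rule sum.group[symmetric]) (use gA in auto)
  also have "\<dots> = (\<Sum>U\<in>?B. - moebius (vec.dim U))"
  proof (rule sum.cong[OF refl])
    fix U assume U: "U \<in> ?B"
    have u: "isotropic U" "U \<subseteq> P" "w \<in> U" "vec.subspace U" using U by (auto simp: isotropics_def isotropic_subspace)
    have LU: "?L \<subseteq> U" using u by (intro vec.span_minimal) auto
    have "vec.dim ?L \<le> vec.dim U" using LU by (rule vec.dim_subset)
    then obtain d where d: "vec.dim U = Suc d" using L by (cases "vec.dim U") auto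
    have c: "real (card (complements ?L U)) = q ^ d"
      using card_complements[OF L(1) LU u(4)] L d by (simp add: q_eq)
    have "(\<Sum>T\<in>{T \<in> ?A. ?g T = U}. moebius (vec.dim T)) = (\<Sum>T\<in>complements ?L U. moebius d)"
      unfolding fib[OF U] using L d by (intro sum.cong) (auto simp: complements_def)
    also have "\<dots> = - moebius (vec.dim U)" using c d by simp
    finally show "(\<Sum>T\<in>{T \<in> ?A. ?g T = U}. moebius (vec.dim T)) = - moebius (vec.dim U)" .
  qed
  finally have "(\<Sum>T\<in>?A. moebius (vec.dim T)) + (\<Sum>T\<in>?B. moebius (vec.dim T)) = 0"
    by (simp add: sum_negf)
  moreover have "euler_sum P = (\<Sum>T\<in>?A. moebius (vec.dim T)) + (\<Sum>T\<in>?B. moebius (vec.dim T))"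
    unfolding euler_sum_def by (subst sum.union_disjoint[symmetric]) (auto intro: sum.cong)
  ultimately show ?thesis by simp
qed

text \<open>For isotropic \<open>w\<close> the subspaces inside \<open>w\<^sup>\<bottom>\<close> contribute 0; the others, grouped by their trace on
  \<open>w\<^sup>\<bottom>\<close>, reproduce the alternating sum of the complements of \<open>w\<close> in \<open>w\<^sup>\<bottom>\<close>, which are isometric
  to \<open>w\<^sup>\<bottom>/w\<close>.\<close>

lemma euler_sum_nondegenerate_odd:
  assumes "vec.subspace S" "S \<inter> perp S = {0}" "vec.dim S = Suc (2 * h)"
  shows "euler_sum S = (-1) ^ h * q ^ h\<^sup>2"
  using assms
proof (induction h arbitrary: S)
  case (0 S)
  have "T = {0}" if "T \<in> isotropics S {0}" for T
  proof (rule ccontr)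
    assume T: "T \<noteq> {0}"
    have t: "isotropic T" "T \<subseteq> S" "vec.subspace T" using that by (auto simp: isotropics_def isotropic_subspace)
    have "vec.dim T \<noteq> 0" using T t vec.subspace_0[OF t(3)] by auto
    then have "0 < vec.dim T" by (rule neq0_conv[THEN iffD1])
    then have "vec.dim S \<le> vec.dim T" unfolding 0(3) by linarith
    then have "T = S" using vec.subspace_dim_equal[OF t(3) 0(1) t(2)] by simp
    then show False using isotropic_subset_perp[OF t(1)] 0 T by auto
  qed
  then have "isotropics S {0} = {{0}}" using isotropic_zero 0(1) by (auto simp: isotropics_def vec.subspace_0)
  then show ?case by (simp add: euler_sum_def)
next
  case (Suc h S)
  note S = \<open>vec.subspace S\<close>
  obtain M where M: "max_iso S M" using ex_max_iso[OF S] .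
  have m: "isotropic M" "M \<subseteq> S" "vec.subspace M" using M by (auto simp: max_iso_def isotropic_subspace)
  \<comment> \<open>As \<open>dim S\<close> is at least 3, the dimension bound forces a nonzero
    isotropic vector.\<close>
  have "0 < m" if "Suc (2 * Suc h) + r \<le> 2 * m + 2" for r m :: nat using that by arith
  then have "0 < vec.dim M" using max_iso_dim(2)[OF M S] unfolding Suc(4) by blast
  then have "\<not> M \<subseteq> {0}" by (metis vec.dim_eq_0 less_irrefl)
  then obtain w where w: "w \<in> M" "w \<noteq> 0" by blast
  then have wS: "w \<in> S" "f w w = 0" using m by (auto simp: isotropic_def)
  let ?L = "vec.span {w}"
  let ?H = "S \<inter> perp {w}"
  let ?p = "vec.dim S"
  have L: "vec.subspace ?L" "vec.dim ?L = 1" using w by (simp_all add: vec.dim_insert)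
  have LS: "?L \<subseteq> S" using wS S by (intro vec.span_minimal) auto
  have wL: "w \<in> ?L" by (simp add: vec.span_base)
  have "f x x = 0" if "x \<in> ?L" for x
    using that wS by (auto simp: vec.span_singleton scale_left scale_right)
  then have isoL: "isotropic ?L" by (simp add: isotropic_def)
  have H: "vec.subspace ?H" using S by (simp add: vec.subspace_inter subspace_perp)
  have LH: "?L \<subseteq> ?H" using H wS by (intro vec.span_minimal) (auto simp: perp_def)
  have L0: "?L \<inter> perp S = {0}" using LS Suc(3) L by (auto simp: vec.subspace_0 perp_def)
  have dH: "Suc (vec.dim ?H) = ?p"
    using dim_perp[OF S L(1)] L L0 by (simp add: perp_singleton_span)
  \<comment> \<open>In the non-degenerate \<open>S\<close> the double orthogonal of
    \<open><w>\<close> is \<open><w>\<close> again; hence \<open>w\<close> spans the radical of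
    \<open>?H\<close>.\<close>
  have SH: "S \<inter> perp ?H = ?L"
  proof (rule vec.subspace_dim_equal[symmetric])
    have "?H \<inter> perp S = {0}" using Suc(3) H by (auto simp: vec.subspace_0 perp_def)
    then have "vec.dim (S \<inter> perp ?H) + vec.dim ?H = ?p" using dim_perp[OF S H] by simp
    then show "vec.dim (S \<inter> perp ?H) \<le> vec.dim ?L" using dH L by simp
    have "?H \<subseteq> perp ?L" by (auto simp: perp_singleton_span)
    then show "?L \<subseteq> S \<inter> perp ?H" using LS subset_perp_commute[of ?H ?L] by simp
  qed (use S L in \<open>auto simp: vec.subspace_inter subspace_perp\<close>)
  have "w \<in> perp ?H" using SH wL by blast
  then have eH: "euler_sum ?H = 0" using wS w by (intro euler_sum_degenerate[OF H, of w]) (auto simp: perp_def)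
  have comp: "euler_sum C = (-1) ^ h * q ^ h\<^sup>2" if C: "C \<in> complements ?L ?H" for C
  proof (rule Suc.IH)
    have c: "vec.subspace C" "C \<subseteq> ?H" "C \<inter> ?L = {0}" "vec.dim C + 1 = vec.dim ?H"
      using C L by (auto simp: complements_def)
    show "vec.subspace C" "vec.dim C = Suc (2 * h)" using c dH Suc by auto
    have "vec.span (C \<union> ?L) = ?H"
    proof (rule vec.subspace_dim_equal)
      show "vec.span (C \<union> ?L) \<subseteq> ?H" using c LH H by (intro vec.span_minimal) auto
      show "vec.dim ?H \<le> vec.dim (vec.span (C \<union> ?L))" using dim_span_Un[OF c(1) L(1)] c L by simp
    qed (use H in auto)
    \<comment> \<open>A radical vector of \<open>C\<close> is orthogonal to \<open>C\<close> and to
      \<open>w\<close>, hence to \<open>C + <w> = ?H\<close>; so it lies in \<open><w>\<close> and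
      is zero.\<close>
    then have "perp C \<inter> perp {w} = perp ?H" by (metis perp_span perp_Un perp_singleton_span)
    then have "C \<inter> perp C \<subseteq> S \<inter> perp ?H" using c by blast
    then have "C \<inter> perp C \<subseteq> ?L" unfolding SH .
    then show "C \<inter> perp C = {0}" using c by (auto simp: vec.subspace_0 perp_def)
  qed
  have p: "?p = 2 * h + 3" using Suc by simp
  have "card (complements ?L ?H) = CARD('a) ^ Suc (2 * h)"
    using card_complements[OF L(1) LH H] L dH p by simp
  then have "(\<Sum>C\<in>complements ?L ?H. euler_sum C) = q ^ Suc (2 * h) * ((-1) ^ h * q ^ h\<^sup>2)"
    using comp by (simp add: q_eq)
  then have isotropic_sum: "isotropic_sum ?H ?L (1 / q) = (-1) ^ h * q ^ h\<^sup>2"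
    using sum_euler_complements[OF L(1) LH H] L dH p q_gt_1 by simp
  let ?N = "\<lambda>T. real (card {v \<in> S \<inter> perp T - ?H. f v v = 0}) / (q ^ Suc (vec.dim T) - q ^ vec.dim T)"
  have in_L: "T \<in> isotropics ?H ?L \<longleftrightarrow> w \<notin> T" if "T \<in> isotropics ?H {0}" for T
  proof -
    have t: "vec.subspace T" "isotropic T" "T \<subseteq> ?H" using that by (auto simp: isotropics_def isotropic_subspace)
    have "w \<in> T" if x: "x \<in> T" "x \<in> ?L" "x \<noteq> 0" for x
    proof -
      obtain k where k: "x = k *s w" using x by (auto simp: vec.span_singleton)
      then have k0: "k \<noteq> 0" using x by auto
      have "inverse k *s x \<in> T" by (rule vec.subspace_scale[OF t(1) x(1)])
      then show "w \<in> T" unfolding k vec.scale_scale using k0 by simp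
    qed
    then show ?thesis using t w wL by (auto simp: isotropics_def vec.subspace_0)
  qed
  have N: "?N T = (if w \<in> T then 0 else q ^ Suc (2 * h) / q ^ vec.dim T * (1 / q) ^ vec.dim T)"
    if T: "T \<in> isotropics ?H {0}" for T
  proof -
    have t: "vec.subspace T" "isotropic T" "T \<subseteq> ?H" using T by (auto simp: isotropics_def isotropic_subspace)
    show ?thesis
    proof (cases "w \<in> T")
      case True
      \<comment> \<open>A vector of \<open>S\<close> orthogonal to some \<open>T\<close> containing
        \<open>w\<close> lies in \<open>?H\<close>.\<close>
      then have "{v \<in> S \<inter> perp T - ?H. f v v = 0} = {}" by (auto simp: perp_def)
      then show ?thesis using True by (simp only: card.empty) simp
    next
      case False
      let ?A = "S \<inter> perp T"
      have A: "vec.subspace ?A" using S by (simp add: vec.subspace_inter subspace_perp)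
      have TL: "T \<inter> perp S = {0}" using t Suc(3) by (auto simp: vec.subspace_0 perp_def)
      have cA: "real (card ?A) = q ^ ?p / q ^ vec.dim T" by (rule real_card_perp[OF S t(1) TL])
      let ?U = "vec.span (insert w T)"
      have US: "?U \<subseteq> S" using t wS S by (subst span_insert_subset_iff) auto
      have "?U \<inter> perp S = {0}" using US Suc(3) by (auto simp: vec.span_zero perp_def)
      then have "real (card (S \<inter> perp ?U)) = q ^ ?p / q ^ vec.dim ?U"
        by (intro real_card_perp[OF S]) auto
      moreover have "S \<inter> perp ?U = ?A \<inter> perp ?L"
        using perp_Un[of "{w}" T] by (auto simp: perp_span perp_singleton_span)
      ultimately have cB: "real (card (?A \<inter> perp ?L)) = q ^ ?p / q ^ Suc (vec.dim T)"
        using dim_span_insert[OF t(1) False] by simp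
      have "w \<in> ?A" using wS t f_sym by (auto simp: perp_def)
      then have "?L \<subseteq> ?A" using A by (intro vec.span_minimal) auto
      then have "real (card {v \<in> ?A - perp ?L. f v v = 0}) =
          (real (card ?A) - real (card (?A \<inter> perp ?L))) / q"
        by (rule card_isotropic_outside_perp[OF A isoL])
      moreover have "?A - perp ?L = ?A - ?H" by (auto simp: perp_singleton_span)
      ultimately have "real (card {v \<in> ?A - ?H. f v v = 0}) =
          (real (card ?A) - real (card (?A \<inter> perp ?L))) / q" by simp
      \<comment> \<open>The first two factors cancel the denominator of \<open>?N\<close>;
        \<open>(1 / q) ^ vec.dim T\<close> matches the argument of
        \<open>isotropic_sum ?H ?L (1 / q)\<close>.\<close>
      also have "\<dots> = (q - 1) * q ^ vec.dim T * (q ^ Suc (2 * h) / q ^ vec.dim T * (1 / q) ^ vec.dim T)"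
        unfolding cA cB p using q_gt_1
        by (simp add: power_add power_divide field_simps eval_nat_numeral)
      finally have "real (card {v \<in> ?A - ?H. f v v = 0}) =
          (q - 1) * q ^ vec.dim T * (q ^ Suc (2 * h) / q ^ vec.dim T * (1 / q) ^ vec.dim T)" .
      moreover have "q ^ Suc (vec.dim T) - q ^ vec.dim T = (q - 1) * q ^ vec.dim T"
        by (simp add: algebra_simps)
      ultimately show ?thesis using q_gt_1 False by simp
    qed
  qed
  have "euler_sum S = euler_sum ?H + (\<Sum>T\<in>isotropics S {0} - isotropics ?H {0}. moebius (vec.dim T))"
    unfolding euler_sum_def using isotropics_mono[of ?H S "{0}"]
    by (subst sum.subset_diff[of "isotropics ?H {0}"]) auto
  also have "\<dots> = (\<Sum>T\<in>isotropics ?H {0}. moebius (Suc (vec.dim T)) * ?N T)"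
    using sum_isotropics_hyperplane[OF S H Int_lower1 dH[symmetric], of "{0}" moebius] vec.subspace_0[OF H] eH
    by (simp add: mult.assoc)
  also have "\<dots> = (\<Sum>T\<in>isotropics ?H {0}. if w \<in> T then 0 else
      - (q ^ Suc (2 * h)) * (moebius (vec.dim T) * (1 / q) ^ vec.dim T))"
  proof (rule sum.cong[OF refl])
    fix T assume "T \<in> isotropics ?H {0}"
    show "moebius (Suc (vec.dim T)) * ?N T = (if w \<in> T then 0 else
      - (q ^ Suc (2 * h)) * (moebius (vec.dim T) * (1 / q) ^ vec.dim T))"
      unfolding N[OF \<open>T \<in> isotropics ?H {0}\<close>] using q_gt_1 by (simp add: field_simps)
  qed
  also have "\<dots> = (\<Sum>T\<in>isotropics ?H ?L. - (q ^ Suc (2 * h)) * (moebius (vec.dim T) * (1 / q) ^ vec.dim T))"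
  proof -
    have "isotropics ?H ?L \<subseteq> isotropics ?H {0}" by (auto simp: isotropics_def isotropic_def vec.subspace_0)
    then show ?thesis using in_L by (intro sum.mono_neutral_cong_right) auto
  qed
  also have "\<dots> = - (q ^ Suc (2 * h)) * isotropic_sum ?H ?L (1 / q)"
    by (simp only: isotropic_sum_def sum_distrib_left)
  \<comment> \<open>The sign changes, and \<open>(2h + 1) + h^2 = (h + 1)^2\<close>.\<close>
  finally show ?case unfolding isotropic_sum
    by (simp add: power2_eq_square power_add mult_2 mult_2_right mult_ac)
qed

section \<open>The generating function along a chain of hyperplanes\<close>

text \<open>The dimension formula shows that the orthogonal of the hyperplane exceeds the radical by
  one dimension, and \<open>g\<close> fills it.\<close>

lemma perp_hyperplane:
  assumes P: "vec.subspace P" and g: "g \<in> P" "g \<notin> perp P"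
  defines "H \<equiv> P \<inter> perp {g}"
  shows "vec.subspace H" "Suc (vec.dim H) = vec.dim P"
    and "P \<inter> perp H = vec.span (insert g (P \<inter> perp P))"
    and "vec.dim (P \<inter> perp H) = Suc (vec.dim (P \<inter> perp P))"
proof -
  let ?L = "vec.span {g}" and ?R = "P \<inter> perp P"
  have R: "vec.subspace ?R" using P by (simp add: vec.subspace_inter subspace_perp)
  show H: "vec.subspace H" using P by (simp add: H_def vec.subspace_inter subspace_perp)
  have g0: "g \<noteq> 0" using g(2) by (auto simp: perp_def)
  have "?L \<inter> perp P = {0}"
  proof -
    have "x = 0" if x: "x \<in> ?L" "x \<in> perp P" for x
    proof (rule ccontr)
      assume "x \<noteq> 0"
      obtain k where k: "x = k *s g" using x by (auto simp: vec.span_singleton)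
      then have k0: "k \<noteq> 0" using \<open>x \<noteq> 0\<close> by auto
      have "inverse k *s x \<in> perp P" by (rule vec.subspace_scale[OF subspace_perp x(2)])
      then show False unfolding k vec.scale_scale using k0 g by simp
    qed
    then show ?thesis by (auto simp: vec.span_zero perp_def)
  qed
  then show dH: "Suc (vec.dim H) = vec.dim P"
    using dim_perp[OF P, of ?L] g0 by (simp add: H_def perp_singleton_span vec.dim_insert)
  have "H \<inter> perp P = ?R" using g(1) by (auto simp: H_def perp_def f_sym)
  then show d: "vec.dim (P \<inter> perp H) = Suc (vec.dim ?R)"
    using dim_perp[OF P H] dH by simp
  show "P \<inter> perp H = vec.span (insert g ?R)"
  proof (rule vec.subspace_dim_equal[symmetric])
    have "g \<in> perp H" using subset_perp_commute[of H "{g}"] by (simp add: H_def)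
    moreover have "perp P \<subseteq> perp H" by (rule perp_antimono) (auto simp: H_def)
    ultimately show "vec.span (insert g ?R) \<subseteq> P \<inter> perp H" using P H g
      by (subst span_insert_subset_iff) (auto intro: vec.subspace_inter subspace_perp)
    show "vec.dim (P \<inter> perp H) \<le> vec.dim (vec.span (insert g ?R))"
      using d dim_span_insert[OF R, of g] g by simp
  qed (use P in \<open>auto simp: vec.subspace_inter subspace_perp\<close>)
qed

text \<open>The coefficient \<open>bP\<close> of the telescoping product, scaled by
  \<open>q^j\<close> to suit \<open>\<xi> = - x q^j / q\<close>. In type
  \<open>\<delta> = \<plusminus>1\<close> with \<open>dim P + dim rad P = 2m\<close> it is
  \<open>\<delta> q^(m-j)\<close>.\<close>

definition slope :: "('a^'n) set \<Rightarrow> nat \<Rightarrow> real" where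
  "slope P j = zeta P * q / (q ^ j * (q - 1))"

text \<open>One factor \<open>1 - b^2 Y^2\<close> for each even value \<open>d\<close> of
  \<open>dim + dim rad\<close> strictly between the ends of the chain; \<open>slope_even\<close>
  gives \<open>b^2 = q^d / q^(2j)\<close>.\<close>

definition factors :: "nat \<Rightarrow> nat \<Rightarrow> nat \<Rightarrow> real poly" where
  "factors j D0 D = (\<Prod>d\<in>{d \<in> {D0<..<D}. even d}. [:1, 0, - (q ^ d / q ^ (2 * j)):])"

lemma slope_odd:
  "vec.subspace P \<Longrightarrow> odd (vec.dim P + vec.dim (P \<inter> perp P)) \<Longrightarrow> slope P j = 0"
  by (simp add: slope_def zeta_odd)

lemma slope_even:
  assumes "vec.subspace P" "even (vec.dim P + vec.dim (P \<inter> perp P))"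
  shows "slope P j * slope P j = q ^ (vec.dim P + vec.dim (P \<inter> perp P)) / q ^ (2 * j)"
proof -
  have "slope P j * slope P j = (zeta P)\<^sup>2 * q\<^sup>2 / (q ^ (2 * j) * (q - 1)\<^sup>2)"
    by (simp add: slope_def power2_eq_square power_add mult_2 mult_2_right mult_ac)
  then show ?thesis using zeta_even_square[OF assms] q_gt_1 by simp
qed

definition corank :: "('a^'n) set \<Rightarrow> nat" where
  "corank P = vec.dim (P \<inter> perp P)"

text \<open>Descend from \<open>P\<close> to \<open>W\<close> through hyperplanes \<open>P \<inter> g\<^sup>\<bottom>\<close> with \<open>g \<in> W\<^sup>\<bottom>\<close>. A radical vector \<open>g\<close> of \<open>W\<close>
  keeps both \<open>dim P + dim rad P\<close> and \<open>zeta\<close> and contributes no factor; once the radicals of \<open>P\<close> and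
  \<open>W\<close> agree, a non-isotropic \<open>g\<close> lowers \<open>dim P + dim rad P\<close> by one, and \<open>zeta\<close> vanishes when this
  number is odd.\<close>

lemma isotropic_sum_eq_rs_eval:
  assumes W: "vec.subspace W" and P: "vec.subspace P" "W \<subseteq> P" "P \<inter> perp P \<subseteq> W"
  defines "j \<equiv> vec.dim W" and "D0 \<equiv> vec.dim W + corank W"
  shows "\<exists>p. degree p \<le> vec.dim P - j \<and>
     (\<forall>x. isotropic_sum P W x = rs_eval q (vec.dim P - j) p (- x * q ^ j / q)) \<and>
     D0 \<le> vec.dim P + corank P \<and>
     (vec.dim P + corank P = D0 \<longrightarrow> zeta P = zeta W \<and> p = 1) \<and>
     (D0 < vec.dim P + corank P \<longrightarrow>
        p = [:1, - slope W j:] * [:1, slope P j:] * factors j D0 (vec.dim P + corank P))"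
  using P
proof (induction "vec.dim P - j" arbitrary: P)
  case (0 P)
  have "vec.dim P \<le> vec.dim W" using 0 by (simp add: j_def)
  then have "W = P" by (rule vec.subspace_dim_equal[OF W 0(2,3)])
  have "isotropics W W = {{0}}"
    using W by (auto simp: isotropics_def isotropic_zero vec.subspace_0 isotropic_def)
  then have "isotropic_sum P W x = 1" for x unfolding \<open>W = P\<close>[symmetric] by (simp add: isotropic_sum_def)
  then show ?case using \<open>W = P\<close> by (intro exI[of _ 1]) (simp add: j_def D0_def rs_eval_1)
next
  case (Suc N P)
  note P = Suc(3-5)
  let ?R = "W \<inter> perp W" and ?rP = "P \<inter> perp P"
  let ?b = "\<lambda>P. slope P j"
  have jP: "vec.dim P = j + Suc N" using Suc(2) by simp
  \<comment> \<open>One hyperplane step: at \<open>\<xi> = - x q^j / q\<close> the recursion of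
    \<open>isotropic_sum_hyperplane\<close> is that of \<open>rs_eval_Suc\<close> with
    \<open>a = ?b P - ?b H\<close>.\<close>
  have step: "\<exists>p. degree p \<le> N \<and> (\<forall>x. isotropic_sum H W x = rs_eval q N p (- x * q ^ j / q)) \<and>
     D0 \<le> vec.dim H + corank H \<and>
     (vec.dim H + corank H = D0 \<longrightarrow> zeta H = zeta W \<and> p = 1) \<and>
     (D0 < vec.dim H + corank H \<longrightarrow>
        p = [:1, - ?b W:] * [:1, ?b H:] * factors j D0 (vec.dim H + corank H)) \<and>
     (\<forall>x. isotropic_sum P W x = rs_eval q (Suc N) ([:1, ?b P - ?b H:] * p) (- x * q ^ j / q))"
    if H: "vec.subspace H" "H \<subseteq> P" "Suc (vec.dim H) = vec.dim P" "W \<subseteq> H" "H \<inter> perp H \<subseteq> W" for H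
  proof -
    have dH: "vec.dim H - j = N" using H jP by simp
    obtain p where p: "degree p \<le> N" "\<And>x. isotropic_sum H W x = rs_eval q N p (- x * q ^ j / q)"
      "D0 \<le> vec.dim H + corank H" 
      "vec.dim H + corank H = D0 \<longrightarrow> zeta H = zeta W \<and> p = 1"
      "D0 < vec.dim H + corank H \<longrightarrow>
        p = [:1, - ?b W:] * [:1, ?b H:] * factors j D0 (vec.dim H + corank H)"
      using Suc(1)[of H] H dH by auto
    have "isotropic_sum P W x = rs_eval q (Suc N) ([:1, ?b P - ?b H:] * p) (- x * q ^ j / q)" for x
    proof -
      have "rs_eval q (Suc N) ([:1, ?b P - ?b H:] * p) (- x * q ^ j / q) =
        (1 + (?b P - ?b H) * (- x * q ^ j / q)) * isotropic_sum H W x +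
        (- x * q ^ j / q) * q ^ N * isotropic_sum H W (x / q)"
        using rs_eval_Suc[of q p N] p q_gt_1 by simp
      also have "(?b P - ?b H) * (- x * q ^ j / q) = - ((zeta P - zeta H) / (q - 1) * x)"
        using slope_scaling[of "q ^ j" "q - 1" q] q_gt_1 by (simp add: slope_def)
      also have "(- x * q ^ j / q) * q ^ N = - (x * (q ^ vec.dim H / q))"
        using H jP by (simp add: power_add)
      also have "(1 + - ((zeta P - zeta H) / (q - 1) * x)) * isotropic_sum H W x +
          - (x * (q ^ vec.dim H / q)) * isotropic_sum H W (x / q) = isotropic_sum P W x"
        using isotropic_sum_hyperplane[OF P(1) H(1,2) H(3)[symmetric] H(4) P(3) H(5), of x] by simp
      finally show ?thesis by simp
    qed
    then show ?thesis using p by blast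
  qed
  show ?case
  proof (cases "?R \<subseteq> perp P")
    case False
    then obtain g where g: "g \<in> W" "g \<in> perp W" "g \<notin> perp P" by blast
    then have gP: "g \<in> P" using P by blast
    have gg: "f g g = 0" using g by (auto simp: perp_def)
    define H where "H = P \<inter> perp {g}"
    note h = perp_hyperplane[OF P(1) gP g(3), folded H_def]
    have WH: "W \<subseteq> H" using P g subset_perp_commute[of "{g}" W] by (auto simp: H_def)
    have rP: "?rP \<subseteq> H" using gP by (auto simp: H_def perp_def)
    \<comment> \<open>Being isotropic, \<open>g\<close> stays in \<open>H\<close> and joins its
      radical, so the corank rises as the dimension drops.\<close>
    have "P \<inter> perp H \<subseteq> H" unfolding h(3) using h(1) rP g WH by (subst span_insert_subset_iff) auto
    then have rad: "H \<inter> perp H = P \<inter> perp H" using H_def by blast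
    have "P \<inter> perp H \<subseteq> W" unfolding h(3) using W P g by (subst span_insert_subset_iff) auto
    then have rW: "H \<inter> perp H \<subseteq> W" using rad by simp
    have cH: "corank H = Suc (corank P)" using h(4) rad by (simp add: corank_def)
    have D: "vec.dim H + corank H = vec.dim P + corank P" using cH h(2) by simp
    have isoL: "isotropic (vec.span {g})"
    proof -
      have "f x x = 0" if "x \<in> vec.span {g}" for x
        using that gg by (auto simp: vec.span_singleton scale_left scale_right)
      then show ?thesis by (simp add: isotropic_def)
    qed
    have "vec.span {g} \<subseteq> P" using gP P by (intro vec.span_minimal) auto
    then have z: "zeta H = zeta P"
      using zeta_perp_iso[OF P(1) isoL] by (simp add: H_def perp_singleton_span)
    then have b: "?b H = ?b P" by (simp add: slope_def)
    obtain p where p: "degree p \<le> N" "D0 \<le> vec.dim H + corank H"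
     "vec.dim H + corank H = D0 \<longrightarrow> zeta H = zeta W \<and> p = 1"
     "D0 < vec.dim H + corank H \<longrightarrow>
        p = [:1, - ?b W:] * [:1, ?b H:] * factors j D0 (vec.dim H + corank H)"
     "\<And>x. isotropic_sum P W x = rs_eval q (Suc N) ([:1, ?b P - ?b H:] * p) (- x * q ^ j / q)"
      using step[OF h(1) _ h(2) WH rW] by (auto simp: H_def)
    have "[:1, ?b P - ?b H:] * p = p" using b by simp
    with p show ?thesis unfolding D b z Suc(2)[symmetric]
      by (intro exI[of _ p]) simp
  next
    case True
    have perpPW: "perp P \<subseteq> perp W" using P by (intro perp_antimono) auto
    have rPR: "?rP = ?R" using True P perpPW by blast
    then have cP: "corank P = corank W" by (simp add: corank_def)
    define K where "K = P \<inter> perp W"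
    have K: "vec.subspace K" using P by (simp add: K_def vec.subspace_inter subspace_perp)
    have "W \<inter> perp P = ?rP" using P rPR by blast
    then have dK: "vec.dim K + j = corank P + vec.dim P"
      using dim_perp[OF P(1) W] by (simp add: K_def corank_def j_def)
    have KW: "K \<inter> W = ?R" using P by (auto simp: K_def)
    \<comment> \<open>Otherwise \<open>K\<close> is totally isotropic and, since
      \<open>K + W = P\<close>, lies in the radical of \<open>P\<close>; but \<open>dim K\<close>
      exceeds \<open>corank P\<close> by \<open>dim P - j > 0\<close>.\<close>
    obtain g where g: "g \<in> K" "f g g \<noteq> 0"
    proof (rule ccontr)
      assume "\<not> thesis"
      then have isoK: "isotropic K" using K that by (auto simp: isotropic_def)
      have "vec.span (K \<union> W) = P"
      proof (rule vec.subspace_dim_equal)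
        show "vec.span (K \<union> W) \<subseteq> P" using P by (intro vec.span_minimal) (auto simp: K_def)
        show "vec.dim P \<le> vec.dim (vec.span (K \<union> W))"
          using dim_span_Un[OF K W] dK KW cP by (simp add: corank_def j_def)
      qed (use P in auto)
      then have "perp P = perp K \<inter> perp W" by (metis perp_span perp_Un)
      then have "K \<subseteq> ?rP" using isotropic_subset_perp[OF isoK] by (auto simp: K_def)
      then have "vec.dim K \<le> corank P" unfolding corank_def by (rule vec.dim_subset)
      then show False using dK jP by simp
    qed
    then have gP: "g \<in> P" "g \<in> perp W" "g \<notin> perp P" by (auto simp: K_def perp_def)
    define H where "H = P \<inter> perp {g}"
    note h = perp_hyperplane[OF P(1) gP(1,3), folded H_def]
    have WH: "W \<subseteq> H" using P gP subset_perp_commute[of "{g}" W] by (auto simp: H_def)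
    \<comment> \<open>The extra direction \<open>g\<close> of \<open>P \<inter> perp H\<close> is
      not orthogonal to itself and so leaves \<open>H\<close>; the radical is unchanged.\<close>
    have rad: "H \<inter> perp H = ?rP"
    proof (intro equalityI subsetI)
      fix v assume v: "v \<in> H \<inter> perp H"
      then have "v \<in> vec.span (insert g ?rP)" using h(3) by (auto simp: H_def)
      moreover have "vec.subspace ?rP" using P by (simp add: vec.subspace_inter subspace_perp)
      ultimately obtain c t where ct: "t \<in> ?rP" "v = c *s g + t" using mem_span_insert by blast
      have "f v g = c * f g g" using ct gP by (auto simp: add_left scale_left perp_def)
      moreover have "f v g = 0" using v by (auto simp: H_def perp_def)
      ultimately have "c = 0" using g by simp
      then show "v \<in> ?rP" using ct by simp
    next
      fix v assume v: "v \<in> ?rP"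
      then have "v \<in> H" using gP by (auto simp: H_def perp_def)
      moreover have "perp P \<subseteq> perp H" by (rule perp_antimono) (auto simp: H_def)
      ultimately show "v \<in> H \<inter> perp H" using v by blast
    qed
    then have rW: "H \<inter> perp H \<subseteq> W" using P by simp
    have cH: "corank H = corank P" using rad by (simp add: corank_def)
    have D: "vec.dim P + corank P = Suc (vec.dim H + corank H)" using cH h(2) by simp
    obtain p where p: "degree p \<le> N" "D0 \<le> vec.dim H + corank H"
     "vec.dim H + corank H = D0 \<longrightarrow> zeta H = zeta W \<and> p = 1"
     "D0 < vec.dim H + corank H \<longrightarrow>
        p = [:1, - ?b W:] * [:1, ?b H:] * factors j D0 (vec.dim H + corank H)"
     "\<And>x. isotropic_sum P W x = rs_eval q (Suc N) ([:1, ?b P - ?b H:] * p) (- x * q ^ j / q)"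
      using step[OF h(1) _ h(2) WH rW] by (auto simp: H_def)
    have bP: "?b P = 0" if "odd (vec.dim P + corank P)"
      using slope_odd[OF P(1)] that by (simp add: corank_def)
    have bH: "?b H = 0" if "odd (vec.dim H + corank H)"
      using slope_odd[OF h(1)] that by (simp add: corank_def)
    have bb: "?b H * ?b H = q ^ (vec.dim H + corank H) / q ^ (2 * j)" if "even (vec.dim H + corank H)"
      using slope_even[OF h(1)] that by (simp add: corank_def)
    let ?DH = "vec.dim H + corank H"
    \<comment> \<open>The telescoping. Consecutive values of \<open>dim + corank\<close> make one of
      the two slopes zero, so \<open>1 + (?b P - ?b H) Y = (1 - ?b H Y)(1 + ?b P Y)\<close>. Here
      \<open>1 - ?b H Y\<close> meets the old factor \<open>1 + ?b H Y\<close>; at the bottom, where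
      \<open>p = 1\<close>, it is \<open>1 - ?b W Y\<close>.\<close>
    have "[:1, ?b P - ?b H:] * p = [:1, - ?b W:] * [:1, ?b P:] * factors j D0 (Suc ?DH)"
    proof (cases "?DH = D0")
      case True
      have s: "{d \<in> {D0<..<Suc D0}. even d} = {}" by auto
      have bHW: "?b H = ?b W" using p(3) True by (simp add: slope_def)
      have "?b P * ?b H = 0" using bP bH D by (cases "even ?DH") auto
      then show ?thesis using p(3) True bHW unfolding factors_def True s by simp
    next
      case False
      then have lt: "D0 < ?DH" using p(2) by simp
      show ?thesis
      proof (cases "even ?DH")
        case True
        have s: "{d \<in> {D0<..<Suc ?DH}. even d} = insert ?DH {d \<in> {D0<..<?DH}. even d}"
          using lt True by auto
        have "[:1, 0, - (q ^ ?DH / q ^ (2 * j)):] = [:1, - ?b H:] * [:1, ?b H:]"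
          using bb[OF True] by simp
        then have "factors j D0 (Suc ?DH) = [:1, - ?b H:] * [:1, ?b H:] * factors j D0 ?DH"
          unfolding factors_def s by (subst prod.insert) auto
        moreover have "?b P = 0" using bP D True by simp
        ultimately show ?thesis using p(4) lt by (simp only: mult_ac diff_0) simp
      next
        case odd: False
        have "x = ?DH \<longrightarrow> odd x" for x using odd by blast
        then have s: "{d \<in> {D0<..<Suc ?DH}. even d} = {d \<in> {D0<..<?DH}. even d}"
          using less_Suc_eq by auto
        then have F: "factors j D0 (Suc ?DH) = factors j D0 ?DH" by (simp add: factors_def)
        have "[:1, ?b H:] = 1" using bH[OF odd] by (simp add: one_pCons)
        then show ?thesis using p(4) lt
          by (simp only: F bH[OF odd] diff_zero mult_1_right mult_1_left mult_ac simp_thms)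
      qed
    qed
    moreover have "degree ([:1, ?b P - ?b H:] * p) \<le> Suc N"
    proof -
      have "degree ([:1, ?b P - ?b H:] * p) \<le> degree [:1, ?b P - ?b H:] + degree p"
        by (rule degree_mult_le)
      also have "\<dots> \<le> 1 + N" using p(1) by (intro add_mono) auto
      finally show ?thesis by simp
    qed
    ultimately show ?thesis using p(2,5) unfolding D Suc(2)[symmetric]
      by (intro exI[of _ "[:1, ?b P - ?b H:] * p"]) (simp del: mult_pCons_left)
  qed
qed

section \<open>Types and the count of non-singular complements\<close>

lemma radical_eq: "radical f W = W \<inter> perp W"
  by (auto simp: radical_def perp_def)

lemma max_isotropic_dim_eq:
  assumes P: "vec.subspace P" and T: "max_iso P T" and "\<And>v. v \<in> P \<Longrightarrow> Q v = f v v"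
  shows "max_isotropic_dim Q P = vec.dim T"
proof -
  have "{vec.dim U |U. totally_isotropic Q U \<and> U \<subseteq> P} = vec.dim ` {U. isotropic U \<and> U \<subseteq> P}"
    using assms(3) by (force simp: totally_isotropic_def isotropic_def)
  moreover have "Max (vec.dim ` {U. isotropic U \<and> U \<subseteq> P}) = vec.dim T"
    using T by (intro Max_eqI) (auto simp: max_iso_def)
  ultimately show ?thesis by (simp add: max_isotropic_dim_def)
qed

text \<open>The type selects one of the two even cases of \<open>zeta_max_iso\<close>, and so the
  sign.\<close>

lemma zeta_of_max_iso_dim:
  assumes P: "vec.subspace P" and T: "max_iso P T"
    and type: "(\<delta> = 1 \<and> vec.dim P + corank P = 2 * vec.dim T) \<or>
      (\<delta> = -1 \<and> vec.dim P + corank P = 2 * vec.dim T + 2)"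
    and D: "vec.dim P + corank P = 2 * m"
  shows "zeta P = \<delta> * (q - 1) * q ^ m / q"
proof -
  note z = zeta_max_iso[OF T P, folded corank_def]
  from type show ?thesis
  proof (elim disjE conjE)
    assume \<delta>: "\<delta> = 1" and d: "vec.dim P + corank P = 2 * vec.dim T"
    then have "m = vec.dim T" using D by simp
    then show ?thesis using z d \<delta> q_gt_1 by (simp add: mult_2 power_add diff_divide_distrib left_diff_distrib)
  next
    assume \<delta>: "\<delta> = -1" and d: "vec.dim P + corank P = 2 * vec.dim T + 2"
    then have "m = Suc (vec.dim T)" using D by simp
    then show ?thesis using z d \<delta> q_gt_1 by (simp add: mult_2 power_add left_diff_distrib diff_divide_distrib)
  qed
qed

lemma zeta_UNIV:
  assumes Q: "\<And>v. Q v = f v v" and type: "form_has_type Q (UNIV :: ('a^'n) set) \<epsilon>"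
    and n: "CARD('n) = 2 * m" and rad: "radical f UNIV = {0}"
  shows "zeta UNIV = \<epsilon> * (q - 1) * q ^ m / q"
proof -
  have U: "vec.subspace (UNIV :: ('a^'n) set)" by simp
  obtain T where T: "max_iso UNIV T" using ex_max_iso[OF U] .
  have mi: "max_isotropic_dim Q UNIV = vec.dim T" by (rule max_isotropic_dim_eq[OF U T]) (simp add: Q)
  have d: "vec.dim (UNIV :: ('a^'n) set) = 2 * m" using n by (simp add: vec.dim_UNIV card_cart_basis)
  have c: "corank UNIV = 0" using rad by (simp add: corank_def radical_eq)
  have even_type: "\<epsilon> \<noteq> 0" using type d by (auto simp: form_has_type_def)
  have "(real_of_int \<epsilon> = 1 \<and> vec.dim (UNIV :: ('a^'n) set) + corank UNIV = 2 * vec.dim T) \<or>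
      (real_of_int \<epsilon> = -1 \<and> vec.dim (UNIV :: ('a^'n) set) + corank UNIV = 2 * vec.dim T + 2)"
  proof -
    have "max_isotropic_dim Q UNIV + 0 = vec.dim T" using mi by simp
    from type_dim_isotropic[OF type[unfolded form_has_type_def] even_type this] show ?thesis
      by (simp only: c add_0_right)
  qed
  then show ?thesis by (rule zeta_of_max_iso_dim[OF U T]) (use d c in simp)
qed

text \<open>Rank-nullity on a subspace: all fibres over the image have the size of the kernel, so
  comparing cardinalities suffices.\<close>

lemma dim_linear_image:
  assumes lin: "Vector_Spaces.linear (*s) (*s) \<phi>" and U: "vec.subspace U"
  shows "vec.dim (\<phi> ` U) + vec.dim {v \<in> U. \<phi> v = 0} = vec.dim (U :: ('a^'n) set)"
proof -
  have sI: "vec.subspace (\<phi> ` U)" using lin U by (rule vec.linear_subspace_image)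
  have K: "vec.subspace {v \<in> U. \<phi> v = 0}"
    using U lin by (auto simp: vec.subspace_def vec.linear_0 vec.linear_add vec.linear_scale)
  have fib: "card {v \<in> U. \<phi> v = y} = card {v \<in> U. \<phi> v = 0}" if y: "y \<in> \<phi> ` U" for y
  proof -
    obtain u where u: "u \<in> U" "y = \<phi> u" using y by blast
    show ?thesis
    proof (rule bij_betw_same_card[OF bij_betwI[where f = "\<lambda>v. v - u" and g = "\<lambda>v. v + u"]])
      show "(\<lambda>v. v - u) \<in> {v \<in> U. \<phi> v = y} \<rightarrow> {v \<in> U. \<phi> v = 0}"
        using u U lin by (auto simp: vec.linear_diff intro: vec.subspace_diff)
      show "(\<lambda>v. v + u) \<in> {v \<in> U. \<phi> v = 0} \<rightarrow> {v \<in> U. \<phi> v = y}"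
        using u U lin by (auto simp: vec.linear_add intro: vec.subspace_add)
    qed auto
  qed
  have "card U = card (\<Union>y\<in>\<phi> ` U. {v \<in> U. \<phi> v = y})" by (rule arg_cong[where f=card]) auto
  also have "\<dots> = (\<Sum>y\<in>\<phi> ` U. card {v \<in> U. \<phi> v = y})" by (rule card_UN_disjoint) auto
  also have "\<dots> = card (\<phi> ` U) * card {v \<in> U. \<phi> v = 0}" using fib by simp
  finally have "CARD('a) ^ vec.dim U = CARD('a) ^ (vec.dim (\<phi> ` U) + vec.dim {v \<in> U. \<phi> v = 0})"
    by (simp only: card_subspace[OF U] card_subspace[OF sI] card_subspace[OF K] power_add)
  then show ?thesis using card_field_gt_1[where 'a='a] by (simp add: power_inject_exp)
qed

text \<open>Isotropic subspaces of the quotient pull back to isotropic subspaces of \<open>W\<close>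
  containing the radical, with dimension raised by \<open>corank W\<close>; so the largest
  dimensions correspond.\<close>

lemma zeta_space_has_type:
  assumes W: "vec.subspace W" and Q: "\<And>v. Q v = f v v" and type: "space_has_type Q f W \<delta>"
    and "\<delta> \<noteq> 0" and D: "vec.dim W + corank W = 2 * m"
  shows "zeta W = \<delta> * (q - 1) * q ^ m / q"
proof -
  let ?R = "W \<inter> perp W"
  obtain \<phi> Q' where \<phi>: "quotient_map \<phi> W (radical f W)" "\<forall>v\<in>W. Q' (\<phi> v) = Q v"
    and t: "form_has_type Q' (\<phi> ` W) \<delta>"
    using type unfolding space_has_type_def by blast
  have lin: "Vector_Spaces.linear (*s) (*s) \<phi>" and ker: "{v \<in> W. \<phi> v = 0} = ?R"
    using \<phi>(1) by (simp_all add: quotient_map_def radical_eq)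
  have Q': "Q' (\<phi> v) = f v v" if "v \<in> W" for v using \<phi>(2) that Q by simp
  obtain T where T: "max_iso W T" using ex_max_iso[OF W] .
  have R: "?R \<subseteq> W" by simp
  have dimg: "vec.dim (\<phi> ` U) + corank W = vec.dim U" if "vec.subspace U" "?R \<subseteq> U" "U \<subseteq> W" for U
  proof -
    have "{v \<in> U. \<phi> v = 0} = ?R" using that ker by blast
    then show ?thesis using dim_linear_image[OF lin that(1)] by (simp add: corank_def)
  qed
  have dW: "vec.dim (\<phi> ` W) + corank W = vec.dim W" using W by (intro dimg) auto
  have TT: "isotropic T" "T \<subseteq> W" "vec.subspace T" using T by (auto simp: max_iso_def isotropic_subspace)
  have "?R \<subseteq> T" using max_iso_Int_perp[OF T W] by blast
  then have dT: "vec.dim (\<phi> ` T) + corank W = vec.dim T" using TT by (intro dimg) auto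
  have "max_isotropic_dim Q' (\<phi> ` W) = vec.dim (\<phi> ` T)"
    unfolding max_isotropic_dim_def
  proof (rule Max_eqI)
    have "totally_isotropic Q' (\<phi> ` T)"
      using TT Q' vec.linear_subspace_image[OF lin TT(3)]
      by (auto simp: totally_isotropic_def isotropic_def)
    moreover have "\<phi> ` T \<subseteq> \<phi> ` W" using TT by blast
    ultimately show "vec.dim (\<phi> ` T) \<in> {vec.dim U |U. totally_isotropic Q' U \<and> U \<subseteq> \<phi> ` W}" by blast
    show "y \<le> vec.dim (\<phi> ` T)" if y: "y \<in> {vec.dim U |U. totally_isotropic Q' U \<and> U \<subseteq> \<phi> ` W}" for y
    proof -
      obtain U where U: "y = vec.dim U" "totally_isotropic Q' U" "U \<subseteq> \<phi> ` W" using y by blast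
      define V where "V = {v \<in> W. \<phi> v \<in> U}"
      have sU: "vec.subspace U" using U by (simp add: totally_isotropic_def)
      then have V: "vec.subspace V" using W lin
        by (auto simp: V_def vec.subspace_def vec.linear_0 vec.linear_add vec.linear_scale)
      have "f v v = 0" if "v \<in> V" for v
        using that U(2) Q'[of v] by (auto simp: V_def totally_isotropic_def)
      then have "isotropic V" using V by (simp add: isotropic_def)
      then have le: "vec.dim V \<le> vec.dim T" using T by (auto simp: max_iso_def V_def)
      have "?R \<subseteq> V" unfolding ker[symmetric] using vec.subspace_0[OF sU] by (auto simp: V_def)
      then have "vec.dim (\<phi> ` V) + corank W = vec.dim V" using V by (intro dimg) (auto simp: V_def)
      moreover have "\<phi> ` V = U" using U by (auto simp: V_def)
      ultimately show ?thesis using le dT U(1) by simp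
    qed
    show "finite {vec.dim U |U. totally_isotropic Q' U \<and> U \<subseteq> \<phi> ` W}"
    proof -
      have "{vec.dim U |U. totally_isotropic Q' U \<and> U \<subseteq> \<phi> ` W} \<subseteq>
          range (vec.dim :: ('a^'n) set \<Rightarrow> nat)" by auto
      then show ?thesis by (rule finite_subset) simp
    qed
  qed
  then have "(real_of_int \<delta> = 1 \<and> vec.dim W + corank W = 2 * vec.dim T) \<or>
      (real_of_int \<delta> = -1 \<and> vec.dim W + corank W = 2 * vec.dim T + 2)"
  proof -
    assume "max_isotropic_dim Q' (\<phi> ` W) = vec.dim (\<phi> ` T)"
    then have "max_isotropic_dim Q' (\<phi> ` W) + corank W = vec.dim T" using dT by simp
    from type_dim_isotropic[OF t[unfolded form_has_type_def] \<open>\<delta> \<noteq> 0\<close> this] show ?thesis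
      by (simp only: dW)
  qed
  then show ?thesis by (rule zeta_of_max_iso_dim[OF W T]) (rule D)
qed

text \<open>A complement spans the whole space together with \<open>W\<close>, which gives type
  \<open>\<epsilon>\<close>, and its odd dimension gives type 0. What remains to be counted are the
  non-singular complements.\<close>

lemma gamma_count_eq_card:
  assumes W: "vec.subspace W" and full: "form_on_full_space Q f \<epsilon>"
    and "odd (CARD('n) - vec.dim W)"
  shows "gamma_count Q f W (int CARD('n) - int (vec.dim W)) 0 \<epsilon> =
    card {S \<in> complements W UNIV. S \<inter> perp S = {0}}"
proof -
  have n: "vec.dim (UNIV :: ('a^'n) set) = CARD('n)" by (simp add: vec.dim_UNIV card_cart_basis)
  have le: "vec.dim W \<le> CARD('n)" using vec.dim_subset[of W UNIV] n by simp
  have idq: "quotient_map id S {0}" if "vec.subspace S" for S :: "('a^'n) set"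
    using that vec.linear_id by (auto simp: quotient_map_def vec.subspace_0)
  have fullsp: "singular_space Q f 0 (int CARD('n)) \<epsilon> UNIV"
  proof -
    have r: "radical f UNIV = {0}" "form_has_type Q UNIV \<epsilon>"
      using full by (simp_all add: form_on_full_space_def)
    have "quotient_map id UNIV (radical f UNIV) \<and> (\<forall>v\<in>UNIV. Q (id v) = Q v) \<and>
        form_has_type Q (id ` UNIV) \<epsilon>"
      using idq[of UNIV] r by simp
    then have "space_has_type Q f UNIV \<epsilon>" unfolding space_has_type_def by blast
    then show ?thesis using n r by (simp add: singular_space_def)
  qed
  have rad0: "vec.dim (radical f S) = 0 \<longleftrightarrow> S \<inter> perp S = {0}" if "vec.subspace S" for S
    using that by (auto simp: radical_eq vec.subspace_0 perp_def)
  have "singular_space Q f 0 (int CARD('n) - int (vec.dim W)) 0 S \<and> S \<inter> W = {0} \<and>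
      singular_space Q f 0 (int CARD('n) - int (vec.dim W) + int (vec.dim W)) \<epsilon> (vec.span (W \<union> S)) \<longleftrightarrow>
      S \<in> complements W UNIV \<and> S \<inter> perp S = {0}" for S
  proof
    assume "singular_space Q f 0 (int CARD('n) - int (vec.dim W)) 0 S \<and> S \<inter> W = {0} \<and>
      singular_space Q f 0 (int CARD('n) - int (vec.dim W) + int (vec.dim W)) \<epsilon> (vec.span (W \<union> S))"
    then show "S \<in> complements W UNIV \<and> S \<inter> perp S = {0}"
      using rad0[of S] n le by (auto simp: singular_space_def complements_def)
  next
    assume S: "S \<in> complements W UNIV \<and> S \<inter> perp S = {0}"
    then have s: "vec.subspace S" "S \<inter> W = {0}" "vec.dim S + vec.dim W = CARD('n)" "S \<inter> perp S = {0}"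
      using n by (auto simp: complements_def)
    have "vec.span (W \<union> S) = UNIV"
    proof (rule vec.subspace_dim_equal)
      show "vec.dim (UNIV :: ('a^'n) set) \<le> vec.dim (vec.span (W \<union> S))"
        using dim_span_Un[OF W s(1)] s n by (simp add: Int_commute)
    qed auto
    moreover have "space_has_type Q f S 0"
    proof -
      have "odd (vec.dim S)" using s(3) assms(3) by (metis add_diff_cancel_right')
      then have "quotient_map id S (radical f S) \<and> (\<forall>v\<in>S. Q (id v) = Q v) \<and>
          form_has_type Q (id ` S) 0"
        using idq[OF s(1)] s(4) by (simp add: radical_eq form_has_type_def)
      then show ?thesis unfolding space_has_type_def by blast
    qed
    ultimately show "singular_space Q f 0 (int CARD('n) - int (vec.dim W)) 0 S \<and> S \<inter> W = {0} \<and>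
      singular_space Q f 0 (int CARD('n) - int (vec.dim W) + int (vec.dim W)) \<epsilon> (vec.span (W \<union> S))"
      using fullsp s rad0[OF s(1)] by (auto simp: singular_space_def)
  qed
  then show ?thesis by (simp add: gamma_count_def)
qed

text \<open>Summing \<open>euler_sum\<close> over all complements keeps only the non-singular ones,
  each with the same weight.\<close>

lemma card_nondegenerate_complements:
  assumes W: "vec.subspace W" and h: "CARD('n) = vec.dim W + (2 * h + 1)"
  shows "real (card {S \<in> complements W (UNIV :: ('a^'n) set). S \<inter> perp S = {0}}) * ((-1) ^ h * q ^ h\<^sup>2) =
    q ^ (vec.dim W * (2 * h + 1)) * isotropic_sum UNIV W (1 / q ^ vec.dim W)"
proof -
  have n: "vec.dim (UNIV :: ('a^'n) set) = CARD('n)" by (simp add: vec.dim_UNIV card_cart_basis)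
  have "(\<Sum>S\<in>complements W UNIV. euler_sum S) =
     (\<Sum>S\<in>complements W UNIV. if S \<inter> perp S = {0} then (-1) ^ h * q ^ h\<^sup>2 else 0)"
  proof (rule sum.cong[OF refl])
    fix S assume "S \<in> complements W UNIV"
    then have S: "vec.subspace S" "vec.dim S = Suc (2 * h)" using n h by (auto simp: complements_def)
    show "euler_sum S = (if S \<inter> perp S = {0} then (-1) ^ h * q ^ h\<^sup>2 else 0)"
    proof (cases "S \<inter> perp S = {0}")
      case True
      then show ?thesis using euler_sum_nondegenerate_odd[OF S(1) _ S(2)] by simp
    next
      case False
      have "0 \<in> S \<inter> perp S" using vec.subspace_0[OF S(1)] by (simp add: perp_def)
      then obtain w where "w \<in> S \<inter> perp S" "w \<noteq> 0" using False by blast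
      then show ?thesis using euler_sum_degenerate[OF S(1), of w] False by simp
    qed
  qed
  also have "\<dots> = real (card {S \<in> complements W UNIV. S \<inter> perp S = {0}}) * ((-1) ^ h * q ^ h\<^sup>2)"
    by (simp add: sum.If_cases Int_def)
  finally show ?thesis using sum_euler_complements[OF W, of UNIV] n h by simp
qed

text \<open>The bounds make \<open>e\<close> the first even number above \<open>D0\<close>; the even
  numbers below \<open>D\<close> are then \<open>e + 2k\<close> with \<open>k < N\<close>.\<close>

lemma factors_eq_prod:
  assumes "even e" "D0 < e" "e \<le> D0 + 2" "D = e + 2 * N"
  shows "factors j D0 D = (\<Prod>k<N. [:1, 0, - (q ^ e / q ^ (2 * j) * (q\<^sup>2) ^ k):])"
  unfolding factors_def
proof (rule prod.reindex_bij_witness[of _ "\<lambda>k. e + 2 * k" "\<lambda>d. (d - e) div 2"])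
  fix d assume d: "d \<in> {d \<in> {D0<..<D}. even d}"
  then have "even d" "D0 < d" by auto
  then have "e \<le> d" using assms(1-3) by presburger
  then obtain t where t: "d = e + t" using le_Suc_ex by blast
  have "even t" using d t assms by simp
  then obtain k where k: "t = 2 * k" by blast
  show "e + 2 * ((d - e) div 2) = d" "(d - e) div 2 \<in> {..<N}" using d t k assms by auto
  show "[:1, 0, - (q ^ e / q ^ (2 * j) * (q\<^sup>2) ^ ((d - e) div 2)):] = [:1, 0, - (q ^ d / q ^ (2 * j)):]"
    unfolding t k by (simp add: power_add flip: power_mult)
qed (use assms in auto)

text \<open>The factor \<open>(-1)^h\<close> on the counting side cancels that of the Rogers-Szego
  values. If \<open>n = D0\<close> the polynomial is 1; otherwise it has two linear and
  \<open>N\<close> quadratic factors.\<close>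

lemma gamma_count_formula:
  fixes W :: "('a^'n) set"
  assumes W: "vec.subspace W" and full: "form_on_full_space Q f \<epsilon>"
    and h: "CARD('n) = vec.dim W + (2 * h + 1)"
  defines "D0 \<equiv> vec.dim W + corank W" and "j \<equiv> vec.dim W"
  defines "K \<equiv> q ^ (j * (2 * h + 1)) / (q ^ h\<^sup>2 * q ^ (2 * h + 1))"
  defines "\<gamma> \<equiv> real (gamma_count Q f W (int CARD('n) - int j) 0 \<epsilon>)"
  shows "CARD('n) = D0 \<Longrightarrow> \<gamma> = K * odd_prod q (Suc h)"
    and "\<lbrakk>even e; D0 < e; e \<le> D0 + 2; CARD('n) = e + 2 * N; g = qbin_coeff (q\<^sup>2) (q ^ e / q ^ (2 * j)) N;
       b0 = slope W j; b = slope UNIV j; b0 = 0 \<or> N < h\<rbrakk> \<Longrightarrow>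
     \<gamma> = K * ((\<Sum>s\<le>N. g s * odd_prod q (Suc (h - s))) + (b0 - b + b * b0) * (\<Sum>s\<le>N. g s * odd_prod q (h - s)))"
proof -
  have n: "vec.dim (UNIV :: ('a^'n) set) = CARD('n)" by (simp add: vec.dim_UNIV card_cart_basis)
  have rad: "UNIV \<inter> perp UNIV = {0}"
    using full by (simp add: form_on_full_space_def radical_eq)
  have c: "corank UNIV = 0" unfolding corank_def rad by simp
  have "odd (CARD('n) - vec.dim W)" using h by simp
  then have cnt: "\<gamma> * ((-1) ^ h * q ^ h\<^sup>2) = q ^ (j * (2 * h + 1)) * isotropic_sum UNIV W (1 / q ^ j)"
    using gamma_count_eq_card[OF W full] card_nondegenerate_complements[OF W h]
    by (simp add: \<gamma>_def j_def)
  have "UNIV \<inter> perp UNIV \<subseteq> W" unfolding rad using W by (simp add: vec.subspace_0)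
  then obtain p where p: "\<And>x. isotropic_sum UNIV W x = rs_eval q (2 * h + 1) p (- x * q ^ j / q)"
    "CARD('n) = D0 \<longrightarrow> p = 1"
    "D0 < CARD('n) \<longrightarrow> p = [:1, - slope W j:] * [:1, slope UNIV j:] * factors j D0 CARD('n)"
    using isotropic_sum_eq_rs_eval[OF W vec.subspace_UNIV, folded D0_def j_def] n c h by (auto simp: j_def)
  \<comment> \<open>The evaluation point \<open>x = q^(-j)\<close> corresponds exactly to
    \<open>\<xi> = - 1 / q\<close>.\<close>
  have "- (1 / q ^ j) * q ^ j / q = - 1 / q" using q_gt_1 by simp
  then have L: "isotropic_sum UNIV W (1 / q ^ j) = rs_eval q (2 * h + 1) p (- 1 / q)" by (simp only: p(1))
  have \<gamma>: "\<gamma> = K * S" if "rs_eval q (2 * h + 1) p (- 1 / q) = (-1) ^ h / q ^ (2 * h + 1) * S" for S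
  proof -
    have "(-1) ^ h * (\<gamma> * q ^ h\<^sup>2) = (-1) ^ h * (q ^ (j * (2 * h + 1)) / q ^ (2 * h + 1) * S)"
      using cnt unfolding L that by (simp add: mult_ac)
    then have "\<gamma> * q ^ h\<^sup>2 = q ^ (j * (2 * h + 1)) / q ^ (2 * h + 1) * S"
      by (subst (asm) mult_cancel_left) simp
    then have "\<gamma> = q ^ (j * (2 * h + 1)) / q ^ (2 * h + 1) * S / q ^ h\<^sup>2"
      using q_gt_1 by (subst nonzero_eq_divide_eq) auto
    then show ?thesis by (simp add: K_def mult_ac)
  qed
  show "\<gamma> = K * odd_prod q (Suc h)" if "CARD('n) = D0"
  proof (rule \<gamma>)
    have "p = monom 1 (2 * 0)" using p(2) that by (simp add: one_pCons monom_0)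
    then show "rs_eval q (2 * h + 1) p (- 1 / q) = (-1) ^ h / q ^ (2 * h + 1) * odd_prod q (Suc h)"
      using rs_eval_even[of q 0 h 1] q_gt_1 by simp
  qed
  show "\<gamma> = K * ((\<Sum>s\<le>N. g s * odd_prod q (Suc (h - s))) + (b0 - b + b * b0) * (\<Sum>s\<le>N. g s * odd_prod q (h - s)))"
    if a: "even e" "D0 < e" "e \<le> D0 + 2" "CARD('n) = e + 2 * N"
      and g: "g = qbin_coeff (q\<^sup>2) (q ^ e / q ^ (2 * j)) N"
      and b: "b0 = slope W j" "b = slope UNIV j" "b0 = 0 \<or> N < h"
  proof (rule \<gamma>)
    have "D0 < CARD('n)" and Nh: "N \<le> h" using a h by (auto simp: D0_def)
    then have peq: "p = [:1, - b0:] * [:1, b:] * factors j D0 CARD('n)" using p(3) b(1,2) by blast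
    show "rs_eval q (2 * h + 1) p (- 1 / q) = (-1) ^ h / q ^ (2 * h + 1) *
       ((\<Sum>s\<le>N. g s * odd_prod q (Suc (h - s))) + (b0 - b + b * b0) * (\<Sum>s\<le>N. g s * odd_prod q (h - s)))"
      unfolding peq factors_eq_prod[OF a] g by (rule rs_eval_product[OF q_gt_1 Nh b(3)])
  qed
qed

lemma slope_of_zeta:
  assumes "zeta P = \<delta> * (q - 1) * q ^ m / q"
  shows "slope P j = \<delta> * (q ^ m / q ^ j)"
  using assms q_gt_1 by (simp add: slope_def)

end

section \<open>The count in closed form, for both parities of \<open>i\<close>\<close>

theorem theorem4p19:
  fixes Q :: "'a::{field,finite}^'n \<Rightarrow> 'a" and f :: "'a^'n \<Rightarrow> 'a^'n \<Rightarrow> 'a"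
    and W :: "('a^'n) set"
    and q :: nat and n j i \<delta> \<epsilon> :: int
  assumes "q = CARD('a)" and "odd q" and "n = int CARD('n)"
    and "0 \<le> i" and "i \<le> j" and "i + j \<le> n" and "even n" and "odd j"
    and "\<delta> \<in> {0, 1, -1}" and "\<epsilon> \<in> {1, -1}" and "(j - i - \<delta>) mod 2 = 1"
    and "form_on_full_space Q f \<epsilon>"
    and "singular_space Q f i j \<delta> W"
  shows
    "(odd i \<longrightarrow>
       real (gamma_count Q f W (n - j) 0 \<epsilon>) =
         real q powr (3/2 * of_int j * of_int n - 1/4 * (of_int n)^2 - 5/4 * (of_int j)^2
                      - 1/2 * of_int n + 1/2 * of_int j - 1/4) *
         ((\<Sum>m = 0..(n - j - i) div 2.
             chi 1 ((n - j + 1) div 2 - m) (real q) *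
             gauss_binomial ((n - j - i) div 2 - 1) m ((real q)^2) *
             real q powi (m * (m - j + i + 1)))
          + (of_int \<delta> * real q powr (1/2 * of_int i - 1/2 * of_int j)
             - of_int \<epsilon> * real q powr (1/2 * of_int n - of_int j)
             + of_int \<delta> * of_int \<epsilon> *
               real q powr (1/2 * of_int n - 3/2 * of_int j + 1/2 * of_int i)) *
            (\<Sum>m = 0..(n - j - i) div 2 - 1.
               chi 1 ((n - j - 1) div 2 - m) (real q) *
               gauss_binomial ((n - j - i) div 2 - 1) m ((real q)^2) *
               real q powi (m * (m - j + i + 1)))))
     \<and>
     (even i \<longrightarrow>
       \<delta> = 0 \<and>
       real (gamma_count Q f W (n - j) 0 \<epsilon>) =
         real q powr (3/2 * of_int j * of_int n - 1/4 * (of_int n)^2 - 5/4 * (of_int j)^2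
                      - 1/2 * of_int n + 1/2 * of_int j - 1/4) *
         ((\<Sum>m = 0..(n - j - i - 1) div 2.
             chi 1 ((n - j + 1) div 2 - m) (real q) *
             gauss_binomial ((n - j - i - 1) div 2) m ((real q)^2) *
             real q powi (m * (m - j + i)))
          - of_int \<epsilon> * real q powr (1/2 * of_int n - of_int j) *
            (\<Sum>m = 0..(n - j - i - 1) div 2.
               chi 1 ((n - j - 1) div 2 - m) (real q) *
               gauss_binomial ((n - j - i - 1) div 2) m ((real q)^2) *
               real q powi (m * (m - j + i)))))"
proof -
  have quad: "quadratic_form Q f" using assms(12) by (simp add: form_on_full_space_def)
  have two: "(2::'a) \<noteq> 0" using assms(1,2) by (intro two_neq_0_of_odd_card) simp
  interpret symmetric_form f "real q"
    by unfold_locales (use quad two assms(1) in \<open>auto simp: quadratic_form_def\<close>)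
  have Q: "Q v = f v v" for v using quad by (simp add: quadratic_form_def)
  have W: "vec.subspace W" "j = int (vec.dim W)" "i = int (corank W)" "space_has_type Q f W \<delta>"
    using assms(13) by (simp_all add: singular_space_def corank_def radical_eq)
  define J I where "J = vec.dim W" and "I = corank W"
  have J: "j = int J" and I: "i = int I" using W by (simp_all add: J_def I_def)
  have oJ: "odd J" "even CARD('n)" "I + J \<le> CARD('n)"
    using assms(3,6,7,8) J I by simp_all
  have "odd (CARD('n) - J)" using oJ by simp
  then obtain h where "CARD('n) - J = 2 * h + 1" by (rule oddE)
  then have h: "CARD('n) = J + (2 * h + 1)" using oJ by simp
  obtain m where m: "CARD('n) = 2 * m" using oJ by blast
  have n: "n = int J + (2 * int h + 1)" using assms(3) h by simp
  have div1: "(n - j + 1) div 2 = int (Suc h)" "(n - j - 1) div 2 = int h"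
    using n J by simp_all
  have q1: "1 < real q" by (rule q_gt_1)
  define K where "K = real q ^ (J * (2 * h + 1)) / (real q ^ h\<^sup>2 * real q ^ (2 * h + 1))"
  have K: "real q powr (3/2 * of_int j * of_int n - 1/4 * (of_int n)^2 - 5/4 * (of_int j)^2
                      - 1/2 * of_int n + 1/2 * of_int j - 1/4) = K"
    using prefactor_powr[OF q1 h] assms(3) by (simp add: J K_def)
  define b where "b = slope UNIV J"
  define b0 where "b0 = slope W J"
  have "zeta UNIV = \<epsilon> * (real q - 1) * real q ^ m / real q"
    by (rule zeta_UNIV[OF Q _ m]) (use assms(12) in \<open>auto simp: form_on_full_space_def\<close>)
  then have "b = \<epsilon> * (real q ^ m / real q ^ J)" unfolding b_def by (rule slope_of_zeta)
  moreover have "real q powr (1/2 * of_int n - of_int j) = real q ^ m / real q ^ J"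
    by (rule powr_nat_diff[OF q1]) (use assms(3) m J in simp)
  ultimately have b: "of_int \<epsilon> * real q powr (1/2 * of_int n - of_int j) = b" by simp
  note G = gamma_count_formula[OF W(1) assms(12) h[unfolded J_def], folded J_def I_def, folded K_def]
  have \<gamma>: "gamma_count Q f W (n - j) 0 \<epsilon> = gamma_count Q f W (int CARD('n) - int J) 0 \<epsilon>"
    using assms(3) J by simp
  have chi1: "chi 1 (int (Suc h) - int s) (real q) = odd_prod (real q) (Suc (h - s))"
    and chi0: "chi 1 (int h - int s) (real q) = odd_prod (real q) (h - s)" if "s \<le> h" for s
    using chi_eq_odd_prod[of "Suc (h - s)" "real q"] chi_eq_odd_prod[of "h - s" "real q"] that
    by (simp_all add: of_nat_diff algebra_simps)
  show ?thesis
  proof (intro conjI impI)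
    assume oi: "odd i"
    then have oI: "odd I" using I by simp
    have "odd \<delta>" using assms(8,11) oi by presburger
    then have \<delta>: "\<delta> \<noteq> 0" by auto
    have "even (J + I)" using oI oJ by simp
    then obtain t where t: "J + I = 2 * t" by blast
    have "zeta W = \<delta> * (real q - 1) * real q ^ t / real q"
      by (rule zeta_space_has_type[OF W(1) Q W(4) \<delta>]) (use t in \<open>simp add: J_def I_def\<close>)
    then have b0': "b0 = \<delta> * (real q ^ t / real q ^ J)" unfolding b0_def by (rule slope_of_zeta)
    moreover have "real q powr (1/2 * of_int i - 1/2 * of_int j) = real q ^ t / real q ^ J"
    proof (rule powr_nat_diff[OF q1])
      have "real J + real I = 2 * real t" using t by (metis of_nat_add of_nat_mult of_nat_numeral)
      then show "1/2 * real_of_int i - 1/2 * real_of_int j = real t - real J" by (simp add: I J)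
    qed
    ultimately have b0: "of_int \<delta> * real q powr (1/2 * of_int i - 1/2 * of_int j) = b0" by simp
    have "real q powr (1/2 * of_int n - 3/2 * of_int j + 1/2 * of_int i) =
      real q powr (1/2 * of_int n - of_int j) * real q powr (1/2 * of_int i - 1/2 * of_int j)"
    proof -
      have "1/2 * real_of_int n - 3/2 * of_int j + 1/2 * of_int i =
          (1/2 * of_int n - of_int j) + (1/2 * of_int i - 1/2 * of_int j)" by (simp add: field_simps)
      then show ?thesis by (simp only: powr_add)
    qed
    then have bb0: "of_int \<delta> * of_int \<epsilon> * real q powr (1/2 * of_int n - 3/2 * of_int j + 1/2 * of_int i) = b * b0"
      by (simp flip: b b0)
    show "real (gamma_count Q f W (n - j) 0 \<epsilon>) =
         real q powr (3/2 * of_int j * of_int n - 1/4 * (of_int n)^2 - 5/4 * (of_int j)^2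
                      - 1/2 * of_int n + 1/2 * of_int j - 1/4) *
         ((\<Sum>m = 0..(n - j - i) div 2.
             chi 1 ((n - j + 1) div 2 - m) (real q) *
             gauss_binomial ((n - j - i) div 2 - 1) m ((real q)^2) *
             real q powi (m * (m - j + i + 1)))
          + (of_int \<delta> * real q powr (1/2 * of_int i - 1/2 * of_int j)
             - of_int \<epsilon> * real q powr (1/2 * of_int n - of_int j)
             + of_int \<delta> * of_int \<epsilon> *
               real q powr (1/2 * of_int n - 3/2 * of_int j + 1/2 * of_int i)) *
            (\<Sum>m = 0..(n - j - i) div 2 - 1.
               chi 1 ((n - j - 1) div 2 - m) (real q) *
               gauss_binomial ((n - j - i) div 2 - 1) m ((real q)^2) *
               real q powi (m * (m - j + i + 1))))"
      unfolding K b b0 bb0 div1 \<gamma>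
    proof (cases "J + I = CARD('n)")
      case True
      \<comment> \<open>The first sum is its term \<open>m = 0\<close>, with
        \<open>[-1 choose 0] = 1\<close>; the second one, up to -1, is empty.\<close>
      have "n - j - i = 0" using True assms(3) J I by simp
      then show "real (gamma_count Q f W (int CARD('n) - int J) 0 \<epsilon>) = K *
         ((\<Sum>m = 0..(n - j - i) div 2. chi 1 (int (Suc h) - m) (real q) *
             gauss_binomial ((n - j - i) div 2 - 1) m ((real q)^2) * real q powi (m * (m - j + i + 1)))
          + (b0 - b + b * b0) *
            (\<Sum>m = 0..(n - j - i) div 2 - 1. chi 1 (int h - m) (real q) *
               gauss_binomial ((n - j - i) div 2 - 1) m ((real q)^2) * real q powi (m * (m - j + i + 1))))"
        using G(1) True chi1[of 0] by (simp add: gauss_binomial_def)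
    next
      case False
      \<comment> \<open>\<open>J + I\<close> is even, so this is the next even number.\<close>
      define e where "e = J + I + 2"
      have ev: "even e" using t by (simp add: e_def)
      have "e \<le> CARD('n)" using False oJ(3) t m by (simp add: e_def)
      moreover have "even (CARD('n) - e)" using ev oJ by simp
      ultimately obtain N where N: "CARD('n) = e + 2 * N" by (metis evenE le_add_diff_inverse)
      have NI: "2 * h + 1 = I + 2 * Suc N" using N h by (simp add: e_def)
      \<comment> \<open>Strict because \<open>I\<close> is at least 1;
        \<open>gamma_count_formula\<close> asks for this when \<open>b0\<close> is nonzero.\<close>
      have Nh: "N < h" using NI oI by presburger
      have "n - j - i = 2 * int (Suc N)" using NI n J I by simp
      then have div2: "(n - j - i) div 2 = int (Suc N)" "int (Suc N) - 1 = int N" by simp_all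
      define g where "g = qbin_coeff ((real q)\<^sup>2) (real q ^ e / real q ^ (2 * J)) N"
      have es: "int s - 1 + int e - 2 * int J = int s - j + i + 1" for s by (simp add: e_def J I)
      have g: "gauss_binomial (int N) (int s) ((real q)\<^sup>2) * real q powi (int s * (int s - j + i + 1)) = g s" for s
        using qbin_coeff_powi[OF q_pos, of e J N s] unfolding es g_def by simp
      \<comment> \<open>The first sum runs up to \<open>N + 1\<close>, where
        \<open>[N choose N+1]\<close> vanishes.\<close>
      have top: "g (Suc N) = 0" by (simp add: g_def qbin_coeff_def gauss_binomial_def)
      have "(\<Sum>m = 0..int (Suc N). chi 1 (int (Suc h) - m) (real q) *
             gauss_binomial (int N) m ((real q)^2) * real q powi (m * (m - j + i + 1))) =
         (\<Sum>s\<le>N. g s * odd_prod (real q) (Suc (h - s)))"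
        unfolding sum_int_atLeast0 mult.assoc g using top Nh chi1 by (simp add: mult.commute)
      moreover have "(\<Sum>m = 0..int N. chi 1 (int h - m) (real q) *
             gauss_binomial (int N) m ((real q)^2) * real q powi (m * (m - j + i + 1))) =
         (\<Sum>s\<le>N. g s * odd_prod (real q) (h - s))"
        unfolding sum_int_atLeast0 mult.assoc g using Nh chi0 by (simp add: mult.commute)
      ultimately show "real (gamma_count Q f W (int CARD('n) - int J) 0 \<epsilon>) = K *
         ((\<Sum>m = 0..(n - j - i) div 2. chi 1 (int (Suc h) - m) (real q) *
             gauss_binomial ((n - j - i) div 2 - 1) m ((real q)^2) * real q powi (m * (m - j + i + 1)))
          + (b0 - b + b * b0) *
            (\<Sum>m = 0..(n - j - i) div 2 - 1. chi 1 (int h - m) (real q) *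
               gauss_binomial ((n - j - i) div 2 - 1) m ((real q)^2) * real q powi (m * (m - j + i + 1))))"
        using G(2)[OF ev _ _ N g_def b0_def b_def] Nh unfolding div2 by (simp add: e_def)
    qed
  next
    assume ei: "even i"
    then show "\<delta> = 0" using assms(8,9,11) by auto
    have eI: "even I" using ei I by simp
    have b0: "b0 = 0" unfolding b0_def
      by (rule slope_odd[OF W(1)]) (use eI oJ in \<open>simp add: J_def I_def corank_def\<close>)
    \<comment> \<open>Now \<open>J + I\<close> is odd: \<open>b0\<close> is zero, and the next even
      number is only one step away.\<close>
    define e where "e = J + I + 1"
    have ev: "even e" using eI oJ by (simp add: e_def)
    have "J + I \<noteq> CARD('n)" using eI oJ by presburger
    then have "e \<le> CARD('n)" using oJ(3) by (simp add: e_def)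
    moreover have "even (CARD('n) - e)" using ev oJ by simp
    ultimately obtain N where N: "CARD('n) = e + 2 * N" by (metis evenE le_add_diff_inverse)
    have NI: "2 * h = I + 2 * N" using N h by (simp add: e_def)
    then have Nh: "N \<le> h" by simp
    have "n - j - i - 1 = 2 * int N" using NI n J I by simp
    then have div2: "(n - j - i - 1) div 2 = int N" by simp
    define g where "g = qbin_coeff ((real q)\<^sup>2) (real q ^ e / real q ^ (2 * J)) N"
    have es: "int s - 1 + int e - 2 * int J = int s - j + i" for s by (simp add: e_def J I)
    have g: "gauss_binomial (int N) (int s) ((real q)\<^sup>2) * real q powi (int s * (int s - j + i)) = g s" for s
      using qbin_coeff_powi[OF q_pos, of e J N s] unfolding es g_def by simp
    have s1: "(\<Sum>m = 0..int N. chi 1 (int (Suc h) - m) (real q) *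
           gauss_binomial (int N) m ((real q)^2) * real q powi (m * (m - j + i))) =
       (\<Sum>s\<le>N. g s * odd_prod (real q) (Suc (h - s)))"
      unfolding sum_int_atLeast0 mult.assoc g using Nh chi1 by (simp add: mult.commute)
    have s0: "(\<Sum>m = 0..int N. chi 1 (int h - m) (real q) *
           gauss_binomial (int N) m ((real q)^2) * real q powi (m * (m - j + i))) =
       (\<Sum>s\<le>N. g s * odd_prod (real q) (h - s))"
      unfolding sum_int_atLeast0 mult.assoc g using Nh chi0 by (simp add: mult.commute)
    show "real (gamma_count Q f W (n - j) 0 \<epsilon>) =
         real q powr (3/2 * of_int j * of_int n - 1/4 * (of_int n)^2 - 5/4 * (of_int j)^2
                      - 1/2 * of_int n + 1/2 * of_int j - 1/4) *
         ((\<Sum>m = 0..(n - j - i - 1) div 2.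
             chi 1 ((n - j + 1) div 2 - m) (real q) *
             gauss_binomial ((n - j - i - 1) div 2) m ((real q)^2) *
             real q powi (m * (m - j + i)))
          - of_int \<epsilon> * real q powr (1/2 * of_int n - of_int j) *
            (\<Sum>m = 0..(n - j - i - 1) div 2.
               chi 1 ((n - j - 1) div 2 - m) (real q) *
               gauss_binomial ((n - j - i - 1) div 2) m ((real q)^2) *
               real q powi (m * (m - j + i))))"
      unfolding K b div1 div2 \<gamma> s1 s0
      using G(2)[OF ev _ _ N g_def b0_def b_def] b0 by (simp add: e_def)
  qed
qed

end
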